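(* The optimal deployment problem is decidable. That is, there is an algorithm that, given any input $(U,O,\mathcal{C}_0,\mathcal{T}_t)$ consisting of a finite well-formed universe $U$ of microservice types, a finite set $O$ of available nodes, a provisionally correct initial configuration $\mathcal{C}_0$, and a target microservice type $\mathcal{T}_t\in U$, always terminates and does the following. If there is a deployment plan $\mathcal{C}_0 \xrightarrow{\alpha_1}\mathcal{C}_1\xrightarrow{\alpha_2}\cdots\xrightarrow{\alpha_m}\mathcal{C}_m$ from $\mathcal{C}_0$, with $\mathcal{C}_i=\langle Z_i,T_i,N_i,B_i\rangle$, such that (i) for all $1\le i\le m$ and all $z\in Z_i$, $T_i(z)\in U$ and $N_i(z)\in O$, and (ii) there is $z\in Z_m$ with $T_m(z)=\mathcal{T}_t$, then the algorithm outputs a deployment plan satisfying (i) and (ii) that, among all deployment plans satisfying (i) and (ii), minimizes the total cost $\sum_{o\in \mathrm{ran}(N_m)} o.\mathtt{cost}$ of the nodes used in its last configuration. Otherwise, it outputs "no".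
   Context: **Basic sets.** Let $\mathcal{I}$ (interfaces), $\mathcal{Z}$ (microservices, i.e. instance names; an infinite supply) and a finite set $\mathcal{R}$ (kinds of resources) be disjoint sets. $\mathbb{N}$ denotes the natural numbers including $0$, $\mathbb{N}^+=\mathbb{N}\setminus\{0\}$, $\mathbb{N}^+_\infty=\mathbb{N}^+\cup\{\infty\}$. For a partial function $f$, $\mathrm{dom}(f)$ and $\mathrm{ran}(f)$ denote its domain and image. All input data are finite objects (partial functions on interfaces have finite domain, configurations have finitely many microservices and bindings). **Microservice type.** A 5-tuple $\mathcal{T}=\langle P,D_s,D_w,C,R\rangle$ where: - $P:\mathcal{I}\rightharpoonup\mathbb{N}^+_\infty$ (provided interfaces, with the maximum number of connected microservices); - $D_s:\mathcal{I}\rightharpoonup\mathbb{N}^+$ (strong required interfaces, with the minimum number of connected microservices); - $D_w:\mathcal{I}\rightharpoonup\mathbb{N}$ (weak required interfaces, with minimum number, $0$ allowed); - $C\subseteq\mathcal{I}$ (conflicting interfaces); - $R:\mathcal{R}\to\mathbb{N}$ total (resource consumption). The sets $\mathrm{dom}(D_s),\mathrm{dom}(D_w),C$ are pairwise disjoint. The components are written $\mathcal{T}.\mathtt{prov}$, $\mathcal{T}.\mathtt{req_s}$, $\mathcal{T}.\mathtt{req_w}$, $\mathcal{T}.\mathtt{conf}$, $\mathcal{T}.\mathtt{res}$. The set of all types is $\Gamma$. **Well-formed universe.** A universe is a finite set $U\subseteq\Gamma$. It is well-formed if the directed graph on $U$ with an edge $(\mathcal{T},\mathcal{T}')$ whenever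 $\mathrm{dom}(\mathcal{T}.\mathtt{req_s})\cap\mathrm{dom}(\mathcal{T}'.\mathtt{prov})\ne\emptyset$ is acyclic (in particular, has no self-loops). **Nodes.** Each node $o$ in the set $\mathcal{N}$ of nodes has a resource availability $o.\mathtt{res}:\mathcal{R}\to\mathbb{N}$ and a cost $o.\mathtt{cost}\in\mathbb{N}$. **Configuration.** A 4-tuple $\langle Z,T,N,B\rangle$ with $Z\subseteq\mathcal{Z}$ (deployed microservices), $T:Z\to\Gamma$, $N:Z\to\mathcal{N}$ (hosting nodes), and $B\subseteq\mathcal{I}\times Z\times Z$ (bindings: interface, requirer, provider) such that every $\langle p,z_1,z_2\rangle\in B$ has $z_1\ne z_2$ and $p\in(\mathrm{dom}(T(z_1).\mathtt{req_s})\cup\mathrm{dom}(T(z_1).\mathtt{req_w}))\cap\mathrm{dom}(T(z_2).\mathtt{prov})$. **Provisionally correct configuration.** $\langle Z,T,N,B\rangle$ is provisionally correct if for each $o\in\mathrm{ran}(N)$ and each $r\in\mathcal{R}$, $o.\mathtt{res}(r)\ge\sum_{z\in Z,\,N(z)=o}T(z).\mathtt{res}(r)$, and for each $z\in Z$: - if $T(z).\mathtt{req_s}(p)=n$, then there are $n$ distinct $z_1,\dots,z_n\in Z\setminus\{z\}$ with $\langle p,z,z_i\rangle\in B$ and $p\in\mathrm{dom}(T(z_i).\mathtt{prov})$ for all $i$; - if $T(z).\mathtt{prov}(p)=n$, then there are no $m>n$ distinct $z_1,\dots,z_m\in Z\setminus\{z\}$ with $\langle p,z_i,z\rangle\in B$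 and $p\in\mathrm{dom}(T(z_i).\mathtt{req_s})\cup\mathrm{dom}(T(z_i).\mathtt{req_w})$ for all $i$. **Correct configuration.** A provisionally correct configuration such that, for each $z\in Z$: - if $T(z).\mathtt{req_w}(p)=n$, then there are $n$ distinct $z_1,\dots,z_n\in Z\setminus\{z\}$ with $\langle p,z,z_i\rangle\in B$ and $p\in\mathrm{dom}(T(z_i).\mathtt{prov})$ for all $i$; - if $p\in T(z).\mathtt{conf}$, then $p\notin\mathrm{dom}(T(z').\mathtt{prov})$ for each $z'\in Z\setminus\{z\}$. **Actions and transitions.** From $\mathcal{C}=\langle Z,T,N,B\rangle$: - $\mathit{bind}(p,z_1,z_2)$ with $z_1\neq z_2$ in $Z$: allowed if $\langle p,z_1,z_2\rangle\notin B$ and $p\in\mathrm{dom}(T(z_1).\mathtt{req_w})\cap\mathrm{dom}(T(z_2).\mathtt{prov})$; adds $\langle p,z_1,z_2\rangle$ to $B$. - $\mathit{unbind}(p,z_1,z_2)$ with $z_1\neq z_2$ in $Z$: allowed if $\langle p,z_1,z_2\rangle\in B$ and $p\in\mathrm{dom}(T(z_1).\mathtt{req_w})\cap\mathrm{dom}(T(z_2).\mathtt{prov})$; removes $\langle p,z_1,z_2\rangle$ from $B$. - $\mathit{new}(z,\mathcal{T},o,B_s)$ with $z\in\mathcal{Z}$, $\mathcal{T}\in\Gamma$, $o\in\mathcal{N}$ and $B_s:\mathrm{dom}(\mathcal{T}.\mathtt{req_s})\to 2^{\mathcal{Z}\setminus\{z\}}$ satisfying $|B_s(p)|\ge\mathcal{T}.\mathtt{req_s}(p)$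 for all $p\in\mathrm{dom}(\mathcal{T}.\mathtt{req_s})$: allowed if $z\notin Z$ and, for all $p\in\mathrm{dom}(\mathcal{T}.\mathtt{req_s})$ and $z'\in B_s(p)$, $z'\in Z$ and $p\in\mathrm{dom}(T(z').\mathtt{prov})$; yields $\langle Z\cup\{z\},\,T\cup\{z\mapsto\mathcal{T}\},\,N\cup\{z\mapsto o\},\,B\cup\{\langle p,z,z'\rangle\mid p\in\mathrm{dom}(\mathcal{T}.\mathtt{req_s}),\,z'\in B_s(p)\}\rangle$. - $\mathit{del}(z)$: removes $z$ from $Z$, restricts $T$ and $N$ accordingly, and removes all bindings involving $z$. $\mathcal{C}\xrightarrow{\alpha}\mathcal{C}'$ means that action $\alpha$ is allowed in $\mathcal{C}$ and yields $\mathcal{C}'$. **Deployment plan.** A deployment plan from a provisionally correct $\mathcal{C}_0$ is a finite sequence of actions $\alpha_1,\dots,\alpha_m$ such that there are provisionally correct configurations $\mathcal{C}_1,\dots,\mathcal{C}_m$ with $\mathcal{C}_{i-1}\xrightarrow{\alpha_i}\mathcal{C}_i$ for $1\le i\le m$, and $\mathcal{C}_m$ is correct. *)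

theory Defs
  imports
    "HOL-Library.Extended_Nat"
    "HOL-Library.Nat_Bijection"
    "HOL-Library.Countable"
begin

section \<open>Microservices, nodes and configurations\<close>

text \<open>
  Interfaces and instance names are represented by natural numbers: an algorithm manipulates
  finite names, and the supply of instance names has to be infinite. The finite set of kinds of
  resources is a type \<open>'r\<close> of class \<open>finite\<close>. A partial function is a map, and the domain and
  image of a map are the library's \<^const>\<open>dom\<close> and \<^const>\<open>ran\<close>.
\<close>

type_synonym iface = nat
type_synonym inst = nat

record 'r mtype =
  prov :: "iface \<rightharpoonup> enat"
  req_s :: "iface \<rightharpoonup> nat"
  req_w :: "iface \<rightharpoonup> nat"
  conf :: "iface set"
  res :: "'r \<Rightarrow> nat"

text \<open>Nodes carry a name, so that distinct nodes may have equal resources and equal cost.\<close>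

record 'r node =
  name :: nat
  avail :: "'r \<Rightarrow> nat"
  cost :: nat

text \<open>The set \<open>\<Gamma>\<close> of all microservice types.\<close>

definition mtypes :: "('r::finite) mtype set" where
  "mtypes = {\<T>.
     finite (dom (prov \<T>)) \<and> 0 \<notin> ran (prov \<T>) \<and>
     finite (dom (req_s \<T>)) \<and> 0 \<notin> ran (req_s \<T>) \<and>
     finite (dom (req_w \<T>)) \<and>
     finite (conf \<T>) \<and>
     dom (req_s \<T>) \<inter> dom (req_w \<T>) = {} \<and>
     dom (req_s \<T>) \<inter> conf \<T> = {} \<and>
     dom (req_w \<T>) \<inter> conf \<T> = {}}"

definition well_formed_universe :: "('r::finite) mtype set \<Rightarrow> bool" where
  "well_formed_universe U \<longleftrightarrow>
     finite U \<and> U \<subseteq> mtypes \<and>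
     acyclic {(\<T>, \<T>'). \<T> \<in> U \<and> \<T>' \<in> U \<and> dom (req_s \<T>) \<inter> dom (prov \<T>') \<noteq> {}}"

text \<open>A binding \<open>(p, z\<^sub>1, z\<^sub>2)\<close> consists of interface, requirer and provider.\<close>

record 'r config =
  insts :: "inst set"
  mtyp :: "inst \<rightharpoonup> 'r mtype"
  host :: "inst \<rightharpoonup> 'r node"
  bindings :: "(iface \<times> inst \<times> inst) set"

abbreviation mtyp_of :: "('r::finite) config \<Rightarrow> inst \<Rightarrow> 'r mtype" where
  "mtyp_of \<C> z \<equiv> the (mtyp \<C> z)"

abbreviation req_dom :: "('r::finite) mtype \<Rightarrow> iface set" where
  "req_dom \<T> \<equiv> dom (req_s \<T>) \<union> dom (req_w \<T>)"

definition configuration :: "('r::finite) config \<Rightarrow> bool" where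
  "configuration \<C> \<longleftrightarrow>
     finite (insts \<C>) \<and>
     dom (mtyp \<C>) = insts \<C> \<and> ran (mtyp \<C>) \<subseteq> mtypes \<and>
     dom (host \<C>) = insts \<C> \<and>
     finite (bindings \<C>) \<and>
     (\<forall>(p, z1, z2) \<in> bindings \<C>.
        z1 \<in> insts \<C> \<and> z2 \<in> insts \<C> \<and> z1 \<noteq> z2 \<and>
        p \<in> req_dom (mtyp_of \<C> z1) \<inter> dom (prov (mtyp_of \<C> z2)))"

text \<open>
  \<open>n\<close> distinct providers (requirers) are given as a finite set of cardinality \<open>n\<close>.
\<close>

definition enough_providers :: "('r::finite) config \<Rightarrow> inst \<Rightarrow> iface \<Rightarrow> nat \<Rightarrow> bool" where
  "enough_providers \<C> z p n \<longleftrightarrow>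
     (\<exists>S \<subseteq> insts \<C> - {z}. finite S \<and> card S = n \<and>
        (\<forall>z' \<in> S. (p, z, z') \<in> bindings \<C> \<and> p \<in> dom (prov (mtyp_of \<C> z'))))"

definition within_capacity :: "('r::finite) config \<Rightarrow> inst \<Rightarrow> iface \<Rightarrow> enat \<Rightarrow> bool" where
  "within_capacity \<C> z p n \<longleftrightarrow>
     \<not> (\<exists>S \<subseteq> insts \<C> - {z}. finite S \<and> enat (card S) > n \<and>
          (\<forall>z' \<in> S. (p, z', z) \<in> bindings \<C> \<and> p \<in> req_dom (mtyp_of \<C> z')))"

definition provisionally_correct :: "('r::finite) config \<Rightarrow> bool" where
  "provisionally_correct \<C> \<longleftrightarrow>
     configuration \<C> \<and>
     (\<forall>o\<^sub>1 \<in> ran (host \<C>). \<forall>r.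
        avail o\<^sub>1 r \<ge> (\<Sum>z \<in> {z \<in> insts \<C>. host \<C> z = Some o\<^sub>1}. res (mtyp_of \<C> z) r)) \<and>
     (\<forall>z \<in> insts \<C>.
        (\<forall>p n. req_s (mtyp_of \<C> z) p = Some n \<longrightarrow> enough_providers \<C> z p n) \<and>
        (\<forall>p n. prov (mtyp_of \<C> z) p = Some n \<longrightarrow> within_capacity \<C> z p n))"

definition correct :: "('r::finite) config \<Rightarrow> bool" where
  "correct \<C> \<longleftrightarrow>
     provisionally_correct \<C> \<and>
     (\<forall>z \<in> insts \<C>.
        (\<forall>p n. req_w (mtyp_of \<C> z) p = Some n \<longrightarrow> enough_providers \<C> z p n) \<and>
        (\<forall>p \<in> conf (mtyp_of \<C> z). \<forall>z' \<in> insts \<C> - {z}. p \<notin> dom (prov (mtyp_of \<C> z'))))"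


section \<open>Actions and deployment plans\<close>

datatype 'r action =
    Bind iface inst inst
  | Unbind iface inst inst
  | New inst "'r mtype" "'r node" "iface \<rightharpoonup> inst set"
  | Del inst

text \<open>
  \<open>step \<C> \<alpha> \<C>'\<close> holds if \<open>\<alpha>\<close> is an action that is allowed in \<open>\<C>\<close> and yields \<open>\<C>'\<close>.
  The map \<open>Bs\<close> in \<^term>\<open>New z \<T> o\<^sub>1 Bs\<close> is total on the strongly required interfaces of \<open>\<T>\<close>.
\<close>

inductive step :: "('r::finite) config \<Rightarrow> 'r action \<Rightarrow> 'r config \<Rightarrow> bool" where
  bind: "\<lbrakk>z1 \<in> insts \<C>; z2 \<in> insts \<C>; z1 \<noteq> z2; (p, z1, z2) \<notin> bindings \<C>;
          p \<in> dom (req_w (mtyp_of \<C> z1)) \<inter> dom (prov (mtyp_of \<C> z2))\<rbrakk>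
    \<Longrightarrow> step \<C> (Bind p z1 z2) (\<C>\<lparr>bindings := bindings \<C> \<union> {(p, z1, z2)}\<rparr>)"
| unbind: "\<lbrakk>z1 \<in> insts \<C>; z2 \<in> insts \<C>; z1 \<noteq> z2; (p, z1, z2) \<in> bindings \<C>;
          p \<in> dom (req_w (mtyp_of \<C> z1)) \<inter> dom (prov (mtyp_of \<C> z2))\<rbrakk>
    \<Longrightarrow> step \<C> (Unbind p z1 z2) (\<C>\<lparr>bindings := bindings \<C> - {(p, z1, z2)}\<rparr>)"
| new: "\<lbrakk>\<T> \<in> mtypes; dom Bs = dom (req_s \<T>);
          \<forall>p \<in> dom (req_s \<T>). z \<notin> the (Bs p) \<and> card (the (Bs p)) \<ge> the (req_s \<T> p);
          z \<notin> insts \<C>;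
          \<forall>p \<in> dom (req_s \<T>). \<forall>z' \<in> the (Bs p).
             z' \<in> insts \<C> \<and> p \<in> dom (prov (mtyp_of \<C> z'))\<rbrakk>
    \<Longrightarrow> step \<C> (New z \<T> o\<^sub>1 Bs)
          \<lparr>insts = insts \<C> \<union> {z},
           mtyp = (mtyp \<C>)(z \<mapsto> \<T>),
           host = (host \<C>)(z \<mapsto> o\<^sub>1),
           bindings = bindings \<C> \<union> {(p, z, z') | p z'. p \<in> dom (req_s \<T>) \<and> z' \<in> the (Bs p)}\<rparr>"
| del: "z \<in> insts \<C>
    \<Longrightarrow> step \<C> (Del z)
          \<lparr>insts = insts \<C> - {z},
           mtyp = (mtyp \<C>) |` (insts \<C> - {z}),
           host = (host \<C>) |` (insts \<C> - {z}),
           bindings = {(p, z1, z2) \<in> bindings \<C>. z1 \<noteq> z \<and> z2 \<noteq> z}\<rparr>"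

text \<open>
  \<open>plan_via \<C>\<^sub>0 \<alpha>s \<C>s\<close>: the actions \<open>\<alpha>s\<close> form a deployment plan from \<open>\<C>\<^sub>0\<close> whose successive
  configurations, the initial one included, are \<open>\<C>s\<close>. With \<open>m = length \<alpha>s\<close>, the configuration
  \<open>\<C>\<^sub>i\<close> is \<^term>\<open>\<C>s ! i\<close> for \<open>i \<le> m\<close>, while \<open>\<alpha>\<^sub>i\<close> is \<open>\<alpha>s ! (i - 1)\<close>.
\<close>

definition plan_via :: "('r::finite) config \<Rightarrow> 'r action list \<Rightarrow> 'r config list \<Rightarrow> bool" where
  "plan_via \<C>0 \<alpha>s \<C>s \<longleftrightarrow>
     length \<C>s = Suc (length \<alpha>s) \<and> \<C>s ! 0 = \<C>0 \<and>
     (\<forall>i \<le> length \<alpha>s. provisionally_correct (\<C>s ! i)) \<and>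
     (\<forall>i < length \<alpha>s. step (\<C>s ! i) (\<alpha>s ! i) (\<C>s ! Suc i)) \<and>
     correct (\<C>s ! length \<alpha>s)"

definition solution_via ::
  "('r::finite) mtype set \<Rightarrow> 'r node set \<Rightarrow> 'r config \<Rightarrow> 'r mtype \<Rightarrow>
   'r action list \<Rightarrow> 'r config list \<Rightarrow> bool" where
  "solution_via U Os \<C>0 \<T>t \<alpha>s \<C>s \<longleftrightarrow>
     plan_via \<C>0 \<alpha>s \<C>s \<and>
     (\<forall>i \<in> {1..length \<alpha>s}. \<forall>z \<in> insts (\<C>s ! i).
        mtyp_of (\<C>s ! i) z \<in> U \<and> the (host (\<C>s ! i) z) \<in> Os) \<and>
     (\<exists>z \<in> insts (\<C>s ! length \<alpha>s). mtyp_of (\<C>s ! length \<alpha>s) z = \<T>t)"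

definition total_cost :: "('r::finite) config \<Rightarrow> nat" where
  "total_cost \<C> = (\<Sum>o\<^sub>1 \<in> ran (host \<C>). cost o\<^sub>1)"

definition deployment_solution ::
  "('r::finite) mtype set \<Rightarrow> 'r node set \<Rightarrow> 'r config \<Rightarrow> 'r mtype \<Rightarrow> 'r action list \<Rightarrow> bool" where
  "deployment_solution U Os \<C>0 \<T>t \<alpha>s \<longleftrightarrow> (\<exists>\<C>s. solution_via U Os \<C>0 \<T>t \<alpha>s \<C>s)"

definition optimal_solution ::
  "('r::finite) mtype set \<Rightarrow> 'r node set \<Rightarrow> 'r config \<Rightarrow> 'r mtype \<Rightarrow> 'r action list \<Rightarrow> bool" where
  "optimal_solution U Os \<C>0 \<T>t \<alpha>s \<longleftrightarrow>
     (\<exists>\<C>s. solution_via U Os \<C>0 \<T>t \<alpha>s \<C>s \<and>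
        (\<forall>\<alpha>s' \<C>s'. solution_via U Os \<C>0 \<T>t \<alpha>s' \<C>s' \<longrightarrow>
           total_cost (\<C>s ! length \<alpha>s) \<le> total_cost (\<C>s' ! length \<alpha>s')))"

definition deployment_input ::
  "('r::finite) mtype set \<Rightarrow> 'r node set \<Rightarrow> 'r config \<Rightarrow> 'r mtype \<Rightarrow> bool" where
  "deployment_input U Os \<C>0 \<T>t \<longleftrightarrow>
     well_formed_universe U \<and> finite Os \<and> provisionally_correct \<C>0 \<and> \<T>t \<in> U"


section \<open>Algorithms\<close>

text \<open>
  An algorithm is a term denoting a partial recursive function in the sense of Kleene;
  \<open>computes f xs y\<close> says that the evaluation of \<open>f\<close> on the arguments \<open>xs\<close> terminates with
  result \<open>y\<close>. Primitive recursion and minimisation act on the first argument.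
\<close>

datatype recf =
    Zero
  | Succ
  | Proj nat
  | Comp recf "recf list"
  | PrimRec recf recf
  | Mu recf

inductive computes :: "recf \<Rightarrow> nat list \<Rightarrow> nat \<Rightarrow> bool" where
  Zero: "computes Zero xs 0"
| Succ: "computes Succ [x] (Suc x)"
| Proj: "i < length xs \<Longrightarrow> computes (Proj i) xs (xs ! i)"
| Comp: "\<lbrakk>length ys = length gs; \<forall>i < length gs. computes (gs ! i) xs (ys ! i);
          computes f ys z\<rbrakk>
    \<Longrightarrow> computes (Comp f gs) xs z"
| PrimRec_0: "computes f xs y \<Longrightarrow> computes (PrimRec f g) (0 # xs) y"
| PrimRec_Suc: "\<lbrakk>computes (PrimRec f g) (n # xs) y; computes g (n # y # xs) z\<rbrakk>
    \<Longrightarrow> computes (PrimRec f g) (Suc n # xs) z"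
| Mu: "\<lbrakk>computes f (n # xs) 0; \<forall>k < n. \<exists>y. y > 0 \<and> computes f (k # xs) y\<rbrakk>
    \<Longrightarrow> computes (Mu f) xs n"

inductive_cases computes_elims:
  "computes Zero xs y"
  "computes Succ xs y"
  "computes (Proj i) xs y"
  "computes (Comp f gs) xs y"
  "computes (PrimRec f g) (0 # xs) y"
  "computes (PrimRec f g) (Suc n # xs) y"
  "computes (Mu f) xs y"

lemma computes_deterministic: "computes f xs y \<Longrightarrow> computes f xs y' \<Longrightarrow> y = y'"
proof (induction arbitrary: y' rule: computes.induct)
  case (Comp ys gs xs f z)
  from Comp.prems obtain ys' where
    ys': "length ys' = length gs" "\<forall>i < length gs. computes (gs ! i) xs (ys' ! i)"
      "computes f ys' y'"
    by (rule computes_elims(4))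
  have "ys ! i = ys' ! i" if "i < length ys" for i
    using Comp.IH(1) Comp.hyps ys'(2) that by simp
  then have "ys = ys'"
    using Comp.hyps ys'(1) by (simp add: nth_equalityI)
  with Comp.IH(2) ys'(3) show ?case by blast
next
  case (PrimRec_Suc f g n xs y z)
  from PrimRec_Suc.prems obtain u where "computes (PrimRec f g) (n # xs) u"
    and "computes g (n # u # xs) y'"
    by (rule computes_elims(6))
  with PrimRec_Suc.IH show ?case by blast
next
  case (Mu f n xs)
  from Mu.prems obtain n': "computes f (y' # xs) 0"
    and less: "\<forall>k < y'. \<exists>y. y > 0 \<and> computes f (k # xs) y"
    by (rule computes_elims(7))
  have "\<not> n < y'"
    using Mu.IH(1) less by blast
  moreover have "\<not> y' < n"
    using Mu.IH(2) n' by blast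
  ultimately show ?case by simp
qed (blast elim: computes_elims)+


section \<open>Inputs and outputs as natural numbers\<close>

text \<open>
  Finite sets of numbers are coded by \<^const>\<open>set_encode\<close>, that is, by \<open>\<Sum>a\<in>A. 2 ^ a\<close>, finite
  partial functions by their graphs, and tuples by \<^const>\<open>list_encode\<close>. Resource kinds are coded
  by the fixed injection \<^const>\<open>to_nat\<close>. The codes are one-to-one on the finite objects in
  question, as shown below.
\<close>

definition enc_map :: "('v \<Rightarrow> nat) \<Rightarrow> (nat \<rightharpoonup> 'v) \<Rightarrow> nat" where
  "enc_map enc f = set_encode {prod_encode (a, enc v) | a v. f a = Some v}"

fun enc_enat :: "enat \<Rightarrow> nat" where
  "enc_enat \<infinity> = 0"
| "enc_enat (enat n) = Suc n"

definition enc_res :: "('r::finite \<Rightarrow> nat) \<Rightarrow> nat" where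
  "enc_res f = set_encode (range (\<lambda>r. prod_encode (to_nat r, f r)))"

definition enc_mtype :: "('r::finite) mtype \<Rightarrow> nat" where
  "enc_mtype \<T> = list_encode
     [enc_map enc_enat (prov \<T>), enc_map id (req_s \<T>), enc_map id (req_w \<T>),
      set_encode (conf \<T>), enc_res (res \<T>)]"

definition enc_node :: "('r::finite) node \<Rightarrow> nat" where
  "enc_node o\<^sub>1 = list_encode [name o\<^sub>1, enc_res (avail o\<^sub>1), cost o\<^sub>1]"

definition enc_binding :: "iface \<times> inst \<times> inst \<Rightarrow> nat" where
  "enc_binding = (\<lambda>(p, z1, z2). list_encode [p, z1, z2])"

definition enc_config :: "('r::finite) config \<Rightarrow> nat" where
  "enc_config \<C> = list_encode
     [set_encode (insts \<C>), enc_map enc_mtype (mtyp \<C>), enc_map enc_node (host \<C>),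
      set_encode (enc_binding ` bindings \<C>)]"

definition enc_input ::
  "('r::finite) mtype set \<Rightarrow> 'r node set \<Rightarrow> 'r config \<Rightarrow> 'r mtype \<Rightarrow> nat" where
  "enc_input U Os \<C>0 \<T>t = list_encode
     [set_encode (enc_mtype ` U), set_encode (enc_node ` Os), enc_config \<C>0, enc_mtype \<T>t]"

fun enc_action :: "('r::finite) action \<Rightarrow> nat" where
  "enc_action (Bind p z1 z2) = list_encode [0, p, z1, z2]"
| "enc_action (Unbind p z1 z2) = list_encode [1, p, z1, z2]"
| "enc_action (New z \<T> o\<^sub>1 Bs) =
     list_encode [2, z, enc_mtype \<T>, enc_node o\<^sub>1, enc_map set_encode Bs]"
| "enc_action (Del z) = list_encode [3, z]"

text \<open>\<^const>\<open>None\<close> stands for the answer ``no''.\<close>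

fun enc_output :: "('r::finite) action list option \<Rightarrow> nat" where
  "enc_output None = 0"
| "enc_output (Some \<alpha>s) = Suc (list_encode (map enc_action \<alpha>s))"

lemma finite_map_graph:
  assumes "finite (dom f)"
  shows "finite {prod_encode (a, enc v) | a v. f a = Some v}"
proof -
  have "{prod_encode (a, enc v) | a v. f a = Some v}
      \<subseteq> (\<lambda>a. prod_encode (a, enc (the (f a)))) ` dom f"
  proof
    fix x
    assume "x \<in> {prod_encode (a, enc v) | a v. f a = Some v}"
    then obtain a v where "x = prod_encode (a, enc v)" "f a = Some v" by blast
    then have "x = prod_encode (a, enc (the (f a)))" "a \<in> dom f" by auto
    then show "x \<in> (\<lambda>a. prod_encode (a, enc (the (f a)))) ` dom f" by (rule image_eqI)
  qed
  then show ?thesis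
    using assms finite_surj by blast
qed

lemma enc_map_inject:
  assumes "finite (dom f)" "finite (dom g)" "inj_on enc (ran f \<union> ran g)"
    and eq: "enc_map enc f = enc_map enc g"
  shows "f = g"
proof -
  have graphs: "{prod_encode (a, enc v) | a v. f a = Some v}
      = {prod_encode (a, enc v) | a v. g a = Some v}"
    using eq set_encode_eq[OF finite_map_graph[OF assms(1)] finite_map_graph[OF assms(2)]]
    unfolding enc_map_def by blast
  have 1: "\<exists>w. g a = Some w \<and> enc v = enc w" if "f a = Some v" for a v
  proof -
    have "prod_encode (a, enc v) \<in> {prod_encode (a, enc v) | a v. g a = Some v}"
      using that graphs by blast
    then show ?thesis by (auto simp: prod_encode_eq)
  qed
  have 2: "\<exists>w. f a = Some w \<and> enc v = enc w" if "g a = Some v" for a v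
  proof -
    have "prod_encode (a, enc v) \<in> {prod_encode (a, enc v) | a v. f a = Some v}"
      using that graphs by blast
    then show ?thesis by (auto simp: prod_encode_eq)
  qed
  show ?thesis
  proof
    fix a
    show "f a = g a"
    proof (cases "f a")
      case None
      then show ?thesis using 2[of a] by (cases "g a") auto
    next
      case (Some v)
      then obtain w where w: "g a = Some w" "enc v = enc w" using 1 by blast
      then have "v = w"
        using assms(3) Some by (auto simp: inj_on_def ran_def)
      with Some w show ?thesis by simp
    qed
  qed
qed

lemma inj_enc_enat: "inj enc_enat"
proof (rule injI)
  fix m n :: enat
  assume "enc_enat m = enc_enat n"
  then show "m = n" by (cases m; cases n) auto
qed

lemma inj_enc_res: "inj enc_res"
proof (rule injI, rule ext)
  fix f g :: "'r::finite \<Rightarrow> nat" and r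
  assume "enc_res f = enc_res g"
  then have "range (\<lambda>r. prod_encode (to_nat r, f r)) = range (\<lambda>r. prod_encode (to_nat r, g r))"
    by (simp add: enc_res_def set_encode_eq)
  then have "prod_encode (to_nat r, f r) \<in> range (\<lambda>r. prod_encode (to_nat r, g r))"
    by blast
  then obtain r' where "prod_encode (to_nat r, f r) = prod_encode (to_nat r', g r')"
    by (rule rangeE)
  then have "r = r'" "f r = g r'" by (auto simp: prod_encode_eq)
  then show "f r = g r" by simp
qed

lemma inj_on_enc_mtype: "inj_on enc_mtype (mtypes :: ('r::finite) mtype set)"
proof (rule inj_onI)
  fix s t :: "'r mtype"
  assume st: "s \<in> mtypes" "t \<in> mtypes" and eq: "enc_mtype s = enc_mtype t"
  have eqs: "enc_map enc_enat (prov s) = enc_map enc_enat (prov t)"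
    "enc_map id (req_s s) = enc_map id (req_s t)"
    "enc_map id (req_w s) = enc_map id (req_w t)"
    "set_encode (conf s) = set_encode (conf t)"
    "enc_res (res s) = enc_res (res t)"
    using eq by (auto simp only: enc_mtype_def list_encode_eq list.inject)
  show "s = t"
  proof (rule mtype.equality)
    show "prov s = prov t"
      using st
      by (intro enc_map_inject[OF _ _ _ eqs(1)] inj_on_subset[OF inj_enc_enat])
        (auto simp: mtypes_def)
    show "req_s s = req_s t"
      using st by (intro enc_map_inject[OF _ _ _ eqs(2)]) (auto simp: mtypes_def)
    show "req_w s = req_w t"
      using st by (intro enc_map_inject[OF _ _ _ eqs(3)]) (auto simp: mtypes_def)
    show "conf s = conf t"
      using st eqs(4) by (simp add: mtypes_def set_encode_eq)
    show "res s = res t"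
      using eqs(5) by (rule injD[OF inj_enc_res])
  qed simp
qed

lemma inj_enc_node: "inj enc_node"
proof (rule injI)
  fix s t :: "('r::finite) node"
  assume "enc_node s = enc_node t"
  then have "name s = name t" "enc_res (avail s) = enc_res (avail t)" "cost s = cost t"
    by (auto simp only: enc_node_def list_encode_eq list.inject)
  then show "s = t"
    by (intro node.equality) (auto intro: injD[OF inj_enc_res])
qed

lemma inj_enc_binding: "inj enc_binding"
  by (rule injI) (auto simp: enc_binding_def list_encode_eq simp del: list_encode.simps)

lemma inj_on_enc_config:
  "inj_on enc_config {\<C> :: ('r::finite) config. configuration \<C>}"
proof (rule inj_onI)
  fix \<C> \<D> :: "'r config"
  assume "\<C> \<in> {\<C>. configuration \<C>}" "\<D> \<in> {\<C>. configuration \<C>}"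
    and eq: "enc_config \<C> = enc_config \<D>"
  then have c: "configuration \<C>" and d: "configuration \<D>" by auto
  have eqs: "set_encode (insts \<C>) = set_encode (insts \<D>)"
    "enc_map enc_mtype (mtyp \<C>) = enc_map enc_mtype (mtyp \<D>)"
    "enc_map enc_node (host \<C>) = enc_map enc_node (host \<D>)"
    "set_encode (enc_binding ` bindings \<C>) = set_encode (enc_binding ` bindings \<D>)"
    using eq by (auto simp only: enc_config_def list_encode_eq list.inject)
  show "\<C> = \<D>"
  proof (rule config.equality)
    show "insts \<C> = insts \<D>"
      using eqs(1) c d by (simp add: configuration_def set_encode_eq)
    show "mtyp \<C> = mtyp \<D>"
      using c d
      by (intro enc_map_inject[OF _ _ _ eqs(2)] inj_on_subset[OF inj_on_enc_mtype])
        (auto simp: configuration_def)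
    show "host \<C> = host \<D>"
      using c d
      by (intro enc_map_inject[OF _ _ _ eqs(3)] inj_on_subset[OF inj_enc_node])
        (auto simp: configuration_def)
    show "bindings \<C> = bindings \<D>"
      using eqs(4) c d
      by (simp add: configuration_def set_encode_eq inj_image_eq_iff[OF inj_enc_binding])
  qed simp
qed

lemma enc_input_inject:
  fixes U U' :: "('r::finite) mtype set"
  assumes "deployment_input U Os \<C>0 \<T>t" "deployment_input U' Os' \<C>0' \<T>t'"
    and eq: "enc_input U Os \<C>0 \<T>t = enc_input U' Os' \<C>0' \<T>t'"
  shows "U = U' \<and> Os = Os' \<and> \<C>0 = \<C>0' \<and> \<T>t = \<T>t'"
proof -
  have eqs: "set_encode (enc_mtype ` U) = set_encode (enc_mtype ` U')"
    "set_encode (enc_node ` Os) = set_encode (enc_node ` Os')"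
    "enc_config \<C>0 = enc_config \<C>0'" "enc_mtype \<T>t = enc_mtype \<T>t'"
    using eq by (auto simp only: enc_input_def list_encode_eq list.inject)
  have sub: "finite U" "finite U'" "U \<subseteq> mtypes" "U' \<subseteq> mtypes" "finite Os" "finite Os'"
    using assms(1,2) by (auto simp: deployment_input_def well_formed_universe_def)
  have "U = U'"
    using eqs(1) sub by (simp add: set_encode_eq inj_on_image_eq_iff[OF inj_on_enc_mtype])
  moreover have "Os = Os'"
    using eqs(2) sub by (simp add: set_encode_eq inj_image_eq_iff[OF inj_enc_node])
  moreover have "\<C>0 = \<C>0'"
    using eqs(3) assms(1,2) inj_onD[OF inj_on_enc_config]
    by (auto simp: deployment_input_def provisionally_correct_def)
  moreover have "\<T>t = \<T>t'"
    using eqs(4) assms(1,2) sub inj_onD[OF inj_on_enc_mtype]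
    by (auto simp: deployment_input_def)
  ultimately show ?thesis by simp
qed

fun finite_action :: "('r::finite) action \<Rightarrow> bool" where
  "finite_action (New z \<T> o\<^sub>1 Bs) \<longleftrightarrow>
     \<T> \<in> mtypes \<and> finite (dom Bs) \<and> (\<forall>S \<in> ran Bs. finite S)"
| "finite_action _ \<longleftrightarrow> True"

lemma inj_on_enc_action: "inj_on enc_action {\<alpha> :: ('r::finite) action. finite_action \<alpha>}"
proof (rule inj_onI)
  fix \<alpha> \<beta> :: "'r action"
  assume fin: "\<alpha> \<in> {\<alpha>. finite_action \<alpha>}" "\<beta> \<in> {\<alpha>. finite_action \<alpha>}"
    and eq: "enc_action \<alpha> = enc_action \<beta>"
  have *: "Bs = Bs'"
    if "enc_map set_encode Bs = enc_map set_encode Bs'" "finite (dom Bs)" "finite (dom Bs')"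
      "\<forall>S \<in> ran Bs. finite S" "\<forall>S \<in> ran Bs'. finite S" for Bs Bs' :: "iface \<rightharpoonup> inst set"
    using that by (intro enc_map_inject[OF _ _ _ that(1)]) (auto simp: inj_on_def set_encode_eq)
  show "\<alpha> = \<beta>"
    using fin eq
    by (cases \<alpha>; cases \<beta>)
      (simp_all add: list_encode_eq * inj_on_eq_iff[OF inj_on_enc_mtype] inj_eq[OF inj_enc_node]
        del: list_encode.simps)
qed

lemma step_finite_action:
  assumes "configuration \<C>" "step \<C> \<alpha> \<C>'"
  shows "finite_action \<alpha>"
  using assms(2,1)
proof cases
  case (new \<T> Bs z o\<^sub>1)
  have "finite S" if "S \<in> ran Bs" for S
  proof -
    from that obtain p where "Bs p = Some S" by (auto simp: ran_def)
    with new have "S \<subseteq> insts \<C>" by (metis domI option.sel subsetI)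
    with assms(1) show ?thesis by (auto simp: configuration_def intro: finite_subset)
  qed
  with new show ?thesis by (simp add: mtypes_def)
qed auto

lemma deployment_solution_finite_actions:
  assumes "deployment_solution U Os \<C>0 \<T>t \<alpha>s"
  shows "\<forall>\<alpha> \<in> set \<alpha>s. finite_action \<alpha>"
proof -
  from assms obtain \<C>s where
    "\<forall>i \<le> length \<alpha>s. provisionally_correct (\<C>s ! i)"
    "\<forall>i < length \<alpha>s. step (\<C>s ! i) (\<alpha>s ! i) (\<C>s ! Suc i)"
    unfolding deployment_solution_def solution_via_def plan_via_def by blast
  then show ?thesis
    unfolding provisionally_correct_def
    by (metis in_set_conv_nth less_imp_le step_finite_action)
qed

lemma enc_output_inject:
  assumes "deployment_solution U Os \<C>0 \<T>t \<alpha>s" "deployment_solution U' Os' \<C>0' \<T>t' \<beta>s"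
    and eq: "enc_output (Some \<alpha>s) = enc_output (Some \<beta>s)"
  shows "\<alpha>s = \<beta>s"
proof -
  have "set \<alpha>s \<union> set \<beta>s \<subseteq> {\<alpha>. finite_action \<alpha>}"
    using deployment_solution_finite_actions assms(1,2) by blast
  then have "inj_on enc_action (set \<alpha>s \<union> set \<beta>s)"
    using inj_on_enc_action inj_on_subset by blast
  moreover have "map enc_action \<alpha>s = map enc_action \<beta>s"
    using eq by (simp add: list_encode_eq)
  ultimately show ?thesis
    using map_inj_on by blast
qed

end

theory Submission
  imports Defs
begin

text \<open>
  In a well-formed universe all instances of a configuration can be deleted in topological order of
  the strong requirements, and every correct configuration can be built up from nothing in the
  reverse order. So, apart from the initial configuration itself, the possible final configurations
  are the correct configurations over \<open>U\<close> and \<open>Os\<close>, provided that the initial one has at most one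
  instance outside \<open>U\<close> and \<open>Os\<close> and that it can be deleted first.

  The number of instances of a correct configuration is not bounded, as instances need not consume
  resources. But it can be thinned out: keep a fixed number of instances of each type, and choose
  the remaining ones so that, for every interface, the capacities still add up to the demands. The
  sums to be kept nonnegative are sums of vectors with small integer entries, and a vector sequence
  of sum zero splits into short blocks of sum zero; so few further instances suffice. As there are
  many providers of the interfaces concerned, the bindings can then be chosen anew.

  Hence it is decidable by bounded search whether a solution of at most a given cost exists, and
  if there is one, an unbounded search for the codes of an optimal plan and of its configurations
  terminates.
\<close>

section \<open>Total recursive functions\<close>

text \<open>Thinning out cannot create a conflict, exceed a resource limit or raise the cost. Only
  the required numbers of providers can fail, and they are not monotone in the set of instances: a
  removed instance takes its demand and its capacity away together. Per interface the difference of
  the two is one integer per instance, so a vector sum has to stay nonnegative in all interfaces at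
  once; this is where the zero-sum blocks enter. The sums alone do not yield bindings, since an
  instance may neither bind to itself nor bind twice to one provider on the same interface. With
  demands and capacities at most \<open>n\<close>, more than \<open>n * n + n\<close> providers
  leave enough room for rerouting, hence \<open>Suc (n * n + n)\<close> instances kept per type. On
  the side of computability, all predicates must become recursive functions of numbers, while the
  encoders are injective on proper objects only. \<open>realizable\<close> therefore refers to a
  domain on which lookups succeed and codes are unambiguous, and it is closed under the constructors
  from which the predicates are built.\<close>

definition total_rec :: "nat \<Rightarrow> (nat list \<Rightarrow> nat) \<Rightarrow> bool" where
  "total_rec m f \<longleftrightarrow> (\<exists>t. \<forall>xs. length xs = m \<longrightarrow> computes t xs (f xs))"

lemma total_rec_cong:
  assumes "total_rec m f" "\<And>xs. length xs = m \<Longrightarrow> f xs = g xs"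
  shows "total_rec m g"
  using assms unfolding total_rec_def by metis

lemma total_rec_nth: "i < m \<Longrightarrow> total_rec m (\<lambda>xs. xs ! i)"
  unfolding total_rec_def by (metis computes.Proj)

lemma total_rec_comp:
  assumes f: "total_rec (length gs) f" and gs: "\<forall>g \<in> set gs. total_rec m g"
  shows "total_rec m (\<lambda>xs. f (map (\<lambda>g. g xs) gs))"
proof -
  obtain t where t: "\<And>xs. length xs = length gs \<Longrightarrow> computes t xs (f xs)"
    using f unfolding total_rec_def by blast
  obtain T where T: "\<And>g xs. g \<in> set gs \<Longrightarrow> length xs = m \<Longrightarrow> computes (T g) xs (g xs)"
    using gs unfolding total_rec_def by metis
  have "computes (Comp t (map T gs)) xs (f (map (\<lambda>g. g xs) gs))" if "length xs = m" for xs
    by (rule computes.Comp[where ys = "map (\<lambda>g. g xs) gs"]) (auto intro: T t that)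
  then show ?thesis unfolding total_rec_def by blast
qed

lemma total_rec_comp1:
  assumes "total_rec 1 (\<lambda>xs. h (xs ! 0))" "total_rec m f"
  shows "total_rec m (\<lambda>xs. h (f xs))"
  using total_rec_comp[of "[f]" "\<lambda>xs. h (xs ! 0)" m] assms by simp

lemma total_rec_drop:
  assumes "total_rec m f"
  shows "total_rec (j + m) (\<lambda>xs. f (drop j xs))"
proof (rule total_rec_cong)
  let ?gs = "map (\<lambda>i xs. xs ! (j + i)) [0..<m]"
  show "total_rec (j + m) (\<lambda>xs. f (map (\<lambda>g. g xs) ?gs))"
    using assms by (intro total_rec_comp) (auto intro: total_rec_nth)
  fix xs :: "nat list"
  assume "length xs = j + m"
  then have "map (\<lambda>g. g xs) ?gs = drop j xs"
    by (intro nth_equalityI) auto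
  then show "f (map (\<lambda>g. g xs) ?gs) = f (drop j xs)" by simp
qed

lemma total_rec_Suc:
  assumes "total_rec m f"
  shows "total_rec m (\<lambda>xs. Suc (f xs))"
proof (rule total_rec_comp1[OF _ assms])
  have "computes Succ xs (Suc (xs ! 0))" if "length xs = 1" for xs
    using that by (cases xs) (auto intro: computes.Succ)
  then show "total_rec 1 (\<lambda>xs. Suc (xs ! 0))"
    unfolding total_rec_def by blast
qed

lemma total_rec_const: "total_rec m (\<lambda>_. c)"
proof (induction c)
  case 0
  show ?case unfolding total_rec_def by (blast intro: computes.Zero)
next
  case (Suc c)
  then show ?case by (rule total_rec_Suc)
qed

text \<open>\<open>PrimRec\<close> wants the recursion argument in front and keeps the others as
  parameters; the value \<open>n xs\<close> is put in front of \<open>xs\<close> by a composition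
  with projections.\<close>

lemma total_rec_rec_nat:
  assumes f: "total_rec m f"
    and g: "total_rec (2 + m) (\<lambda>xs. g (xs ! 0) (xs ! 1) (drop 2 xs))"
    and n: "total_rec m n"
  shows "total_rec m (\<lambda>xs. rec_nat (f xs) (\<lambda>k y. g k y xs) (n xs))"
proof -
  obtain tf where tf: "\<And>xs. length xs = m \<Longrightarrow> computes tf xs (f xs)"
    using f unfolding total_rec_def by blast
  obtain tg where tg: "\<And>xs. length xs = 2 + m \<Longrightarrow>
      computes tg xs (g (xs ! 0) (xs ! 1) (drop 2 xs))"
    using g unfolding total_rec_def by blast
  have rec: "computes (PrimRec tf tg) (k # xs) (rec_nat (f xs) (\<lambda>k y. g k y xs) k)"
    if "length xs = m" for xs k
  proof (induction k)
    case 0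
    show ?case using tf[OF that] by (simp add: computes.PrimRec_0)
  next
    case (Suc k)
    show ?case
      using computes.PrimRec_Suc[OF Suc.IH] tg[of "k # _ # xs"] that by simp
  qed
  have "total_rec (Suc m) (\<lambda>ys. rec_nat (f (drop 1 ys)) (\<lambda>k y. g k y (drop 1 ys)) (ys ! 0))"
    unfolding total_rec_def
  proof (intro exI allI impI)
    fix ys :: "nat list"
    assume "length ys = Suc m"
    then show "computes (PrimRec tf tg) ys
        (rec_nat (f (drop 1 ys)) (\<lambda>k y. g k y (drop 1 ys)) (ys ! 0))"
      using rec by (cases ys) auto
  qed
  then have "total_rec m (\<lambda>xs. (\<lambda>ys. rec_nat (f (drop 1 ys)) (\<lambda>k y. g k y (drop 1 ys)) (ys ! 0))
      (map (\<lambda>g. g xs) (n # map (\<lambda>i xs. xs ! i) [0..<m])))"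
    using n by (intro total_rec_comp) (auto intro: total_rec_nth)
  then show ?thesis
  proof (rule total_rec_cong)
    fix xs :: "nat list"
    assume "length xs = m"
    then have "map (\<lambda>g. g xs) (map (\<lambda>i xs. xs ! i) [0..<m]) = xs"
      by (intro nth_equalityI) auto
    then show "rec_nat (f (drop 1 (map (\<lambda>g. g xs) (n # map (\<lambda>i xs. xs ! i) [0..<m]))))
        (\<lambda>k y. g k y (drop 1 (map (\<lambda>g. g xs) (n # map (\<lambda>i xs. xs ! i) [0..<m]))))
        (map (\<lambda>g. g xs) (n # map (\<lambda>i xs. xs ! i) [0..<m]) ! 0)
        = rec_nat (f xs) (\<lambda>k y. g k y xs) (n xs)"
      by simp
  qed
qed

section \<open>Arithmetic, bounded sums and pairing\<close>

lemma total_rec_add: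
  assumes "total_rec m f" "total_rec m g"
  shows "total_rec m (\<lambda>xs. f xs + g xs)"
proof (rule total_rec_cong)
  show "total_rec m (\<lambda>xs. rec_nat (f xs) (\<lambda>k y. Suc y) (g xs))"
    using assms by (intro total_rec_rec_nat total_rec_Suc total_rec_nth) auto
  have "rec_nat a (\<lambda>k y. Suc y) n = a + n" for a n by (induction n) auto
  then show "rec_nat (f xs) (\<lambda>k y. Suc y) (g xs) = f xs + g xs" for xs by simp
qed

lemma total_rec_mult:
  assumes "total_rec m f" "total_rec m g"
  shows "total_rec m (\<lambda>xs. f xs * g xs)"
proof (rule total_rec_cong)
  show "total_rec m (\<lambda>xs. rec_nat 0 (\<lambda>k y. y + f xs) (g xs))"
    using assms
    by (intro total_rec_rec_nat total_rec_const total_rec_add total_rec_nth total_rec_drop) auto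
  have "rec_nat 0 (\<lambda>k y. y + a) n = a * n" for a n :: nat by (induction n) auto
  then show "rec_nat 0 (\<lambda>k y. y + f xs) (g xs) = f xs * g xs" for xs by simp
qed

lemma total_rec_diff:
  assumes "total_rec m f" "total_rec m g"
  shows "total_rec m (\<lambda>xs. f xs - g xs)"
proof (rule total_rec_cong)
  have pred: "total_rec m (\<lambda>xs. h xs - 1)" if "total_rec m h" for m h
  proof (rule total_rec_cong)
    show "total_rec m (\<lambda>xs. rec_nat 0 (\<lambda>k y. k) (h xs))"
      using that by (intro total_rec_rec_nat total_rec_const total_rec_nth) auto
    have "rec_nat 0 (\<lambda>k y. k) n = n - 1" for n by (cases n) auto
    then show "rec_nat 0 (\<lambda>k y. k) (h xs) = h xs - 1" for xs by simp
  qed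
  show "total_rec m (\<lambda>xs. rec_nat (f xs) (\<lambda>k y. y - 1) (g xs))"
    using assms by (intro total_rec_rec_nat pred total_rec_nth) auto
  have "rec_nat a (\<lambda>k y. y - 1) n = a - n" for a n :: nat by (induction n) auto
  then show "rec_nat (f xs) (\<lambda>k y. y - 1) (g xs) = f xs - g xs" for xs by simp
qed

lemma total_rec_eq:
  assumes "total_rec m f" "total_rec m g"
  shows "total_rec m (\<lambda>xs. of_bool (f xs = g xs))"
proof (rule total_rec_cong)
  show "total_rec m (\<lambda>xs. 1 - ((f xs - g xs) + (g xs - f xs)))"
    using assms by (intro total_rec_diff total_rec_add total_rec_const)
qed auto

lemma total_rec_sum:
  assumes b: "total_rec m b" and h: "total_rec (1 + m) (\<lambda>xs. h (xs ! 0) (drop 1 xs))"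
  shows "total_rec m (\<lambda>xs. \<Sum>a<b xs. h a xs)"
proof (rule total_rec_cong)
  \<comment> \<open>The summand does not read the accumulator, so position 1 of the recursion
    arguments is left out.\<close>
  let ?gs = "(\<lambda>xs. xs ! 0) # map (\<lambda>i xs. xs ! (2 + i)) [0..<m]"
  have "total_rec (2 + m) (\<lambda>xs. h (xs ! 0) (drop 2 xs))"
  proof (rule total_rec_cong)
    show "total_rec (2 + m) (\<lambda>xs. (\<lambda>ys. h (ys ! 0) (drop 1 ys)) (map (\<lambda>g. g xs) ?gs))"
      using h by (intro total_rec_comp) (auto intro: total_rec_nth)
    fix xs :: "nat list"
    assume "length xs = 2 + m"
    then have "map (\<lambda>g. g xs) (map (\<lambda>i xs. xs ! (2 + i)) [0..<m]) = drop 2 xs"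
      by (intro nth_equalityI) auto
    then show "h (map (\<lambda>g. g xs) ?gs ! 0) (drop 1 (map (\<lambda>g. g xs) ?gs))
        = h (xs ! 0) (drop 2 xs)" by simp
  qed
  then show "total_rec m (\<lambda>xs. rec_nat 0 (\<lambda>k y. y + h k xs) (b xs))"
    using b by (intro total_rec_rec_nat total_rec_const total_rec_add total_rec_nth) auto
  have "rec_nat 0 (\<lambda>k y. y + h k xs) n = (\<Sum>a<n. h a xs)" for n xs by (induction n) auto
  then show "rec_nat 0 (\<lambda>k y. y + h k xs) (b xs) = (\<Sum>a<b xs. h a xs)" for xs by simp
qed

lemma total_rec_prod_encode:
  assumes "total_rec m f" "total_rec m g"
  shows "total_rec m (\<lambda>xs. prod_encode (f xs, g xs))"
proof -
  have "total_rec m (\<lambda>xs. triangle (h xs))" if "total_rec m h" for h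
  proof (rule total_rec_cong)
    show "total_rec m (\<lambda>xs. rec_nat 0 (\<lambda>k y. y + Suc k) (h xs))"
      using that
      by (intro total_rec_rec_nat total_rec_const total_rec_add total_rec_Suc total_rec_nth) auto
    have "rec_nat 0 (\<lambda>k y. y + Suc k) n = triangle n" for n by (induction n) auto
    then show "rec_nat 0 (\<lambda>k y. y + Suc k) (h xs) = triangle (h xs)" for xs by simp
  qed
  then show ?thesis
    using assms unfolding prod_encode_def by (auto intro!: total_rec_add)
qed

text \<open>Both components of a pair are at most its code, so exactly one summand survives.
  Decoding thereby becomes a bounded sum of functions already known to be recursive.\<close>

lemma sum_of_bool_eq_prod_encode:
  "(\<Sum>a<Suc n. \<Sum>b<Suc n. h a b * of_bool (prod_encode (a, b) = n))
    = (h (fst (prod_decode n)) (snd (prod_decode n)) :: nat)"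
proof -
  obtain u v where uv: "prod_decode n = (u, v)" by force
  then have n: "n = prod_encode (u, v)" by (metis prod_decode_inverse)
  then have "u \<le> n" "v \<le> n" using le_prod_encode_1 le_prod_encode_2 by auto
  have "(\<Sum>a<Suc n. \<Sum>b<Suc n. h a b * of_bool (prod_encode (a, b) = n))
      = (\<Sum>a<Suc n. \<Sum>b<Suc n. if b = v then h a b * of_bool (a = u) else 0)"
    by (intro sum.cong) (auto simp: n)
  also have "\<dots> = (\<Sum>a<Suc n. if a = u then h a v else 0)"
    using \<open>v \<le> n\<close> by (intro sum.cong) (auto simp: less_Suc_eq_le)
  also have "\<dots> = h u v" using \<open>u \<le> n\<close> by (simp add: less_Suc_eq_le)
  finally show ?thesis by (simp add: uv)
qed

lemma total_rec_prod_decode: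
  assumes f: "total_rec m f"
  shows "total_rec m (\<lambda>xs. fst (prod_decode (f xs)))" "total_rec m (\<lambda>xs. snd (prod_decode (f xs)))"
proof -
  have dd: "total_rec (1 + (1 + 1)) (\<lambda>xs. drop 1 (drop 1 xs) ! 0)"
    "total_rec (1 + (1 + 1)) (\<lambda>xs. drop 1 xs ! 0)" "total_rec (1 + 1) (\<lambda>xs. drop 1 xs ! 0)"
    by (rule total_rec_drop total_rec_drop[where m = "1 + 1"] total_rec_nth | simp)+
  have *: "total_rec 1 (\<lambda>xs. \<Sum>a<Suc (xs ! 0). \<Sum>b<Suc (xs ! 0).
      (if first then a else b) * of_bool (prod_encode (a, b) = xs ! 0))" for first
    by (cases first; simp only: if_True if_False;
        intro total_rec_sum total_rec_Suc total_rec_mult total_rec_eq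
          total_rec_prod_encode dd total_rec_nth) simp_all
  show "total_rec m (\<lambda>xs. fst (prod_decode (f xs)))"
    using *[of True] sum_of_bool_eq_prod_encode[of "\<lambda>a b. a"]
    by (intro total_rec_comp1[OF _ f]) (simp del: sum.lessThan_Suc)
  show "total_rec m (\<lambda>xs. snd (prod_decode (f xs)))"
    using *[of False] sum_of_bool_eq_prod_encode[of "\<lambda>a b. b"]
    by (intro total_rec_comp1[OF _ f]) (simp del: sum.lessThan_Suc)
qed

text \<open>Further arguments are packed by \<open>prod_encode\<close>, which ends the bookkeeping
  about arities and positions.\<close>

definition rec1 :: "(nat \<Rightarrow> nat) \<Rightarrow> bool" where
  "rec1 f \<longleftrightarrow> total_rec 1 (\<lambda>xs. f (xs ! 0))"

lemma rec1_id: "rec1 (\<lambda>x. x)"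
  unfolding rec1_def by (rule total_rec_nth) simp

lemma rec1_const: "rec1 (\<lambda>_. c)"
  unfolding rec1_def by (rule total_rec_const)

lemma rec1_comp: "rec1 f \<Longrightarrow> rec1 g \<Longrightarrow> rec1 (\<lambda>x. f (g x))"
  unfolding rec1_def by (rule total_rec_comp1)

lemma rec1_Suc: "rec1 f \<Longrightarrow> rec1 (\<lambda>x. Suc (f x))"
  unfolding rec1_def by (rule total_rec_Suc)

lemma rec1_add: "rec1 f \<Longrightarrow> rec1 g \<Longrightarrow> rec1 (\<lambda>x. f x + g x)"
  unfolding rec1_def by (rule total_rec_add)

lemma rec1_mult: "rec1 f \<Longrightarrow> rec1 g \<Longrightarrow> rec1 (\<lambda>x. f x * g x)"
  unfolding rec1_def by (rule total_rec_mult)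

lemma rec1_diff: "rec1 f \<Longrightarrow> rec1 g \<Longrightarrow> rec1 (\<lambda>x. f x - g x)"
  unfolding rec1_def by (rule total_rec_diff)

lemma rec1_eq: "rec1 f \<Longrightarrow> rec1 g \<Longrightarrow> rec1 (\<lambda>x. of_bool (f x = g x))"
  unfolding rec1_def by (rule total_rec_eq)

lemma rec1_prod_encode: "rec1 f \<Longrightarrow> rec1 g \<Longrightarrow> rec1 (\<lambda>x. prod_encode (f x, g x))"
  unfolding rec1_def by (rule total_rec_prod_encode)

lemma rec1_prod_decode:
  assumes "rec1 f"
  shows "rec1 (\<lambda>x. fst (prod_decode (f x)))" "rec1 (\<lambda>x. snd (prod_decode (f x)))"
  using assms unfolding rec1_def by (auto intro: total_rec_prod_decode)

lemma rec1_not: "rec1 (\<lambda>x. of_bool (P x)) \<Longrightarrow> rec1 (\<lambda>x. of_bool (\<not> P x))"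
proof -
  have "(\<lambda>x. of_bool (\<not> P x)) = (\<lambda>x. 1 - of_bool (P x) :: nat)" by auto
  then show "rec1 (\<lambda>x. of_bool (P x)) \<Longrightarrow> ?thesis"
    using rec1_diff[OF rec1_const[of 1]] by simp
qed

lemma rec1_conj:
  "rec1 (\<lambda>x. of_bool (P x)) \<Longrightarrow> rec1 (\<lambda>x. of_bool (Q x)) \<Longrightarrow> rec1 (\<lambda>x. of_bool (P x \<and> Q x))"
  using rec1_mult[of "\<lambda>x. of_bool (P x)" "\<lambda>x. of_bool (Q x)"] by (simp add: of_bool_conj)

lemma rec1_le: "rec1 f \<Longrightarrow> rec1 g \<Longrightarrow> rec1 (\<lambda>x. of_bool (f x \<le> g x))"
  using rec1_eq[OF rec1_diff[of f g] rec1_const[of 0]] by simp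

lemma rec1_if:
  assumes "rec1 (\<lambda>x. of_bool (P x))" "rec1 f" "rec1 g"
  shows "rec1 (\<lambda>x. if P x then f x else g x)"
proof -
  have "(\<lambda>x. if P x then f x else g x) = (\<lambda>x. of_bool (P x) * f x + of_bool (\<not> P x) * g x)"
    by auto
  then show ?thesis using assms by (simp add: rec1_add rec1_mult rec1_not)
qed

lemma rec1_sum:
  assumes "rec1 b" "rec1 h"
  shows "rec1 (\<lambda>x. \<Sum>a<b x. h (prod_encode (a, x)))"
  unfolding rec1_def
proof (rule total_rec_sum)
  show "total_rec 1 (\<lambda>xs. b (xs ! 0))" using assms(1) by (simp add: rec1_def)
  have "total_rec (1 + 1) (\<lambda>xs. drop 1 xs ! 0)"
    by (rule total_rec_drop total_rec_nth | simp)+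
  then show "total_rec (1 + 1) (\<lambda>xs. h (prod_encode (xs ! 0, drop 1 xs ! 0)))"
    using assms(2) unfolding rec1_def
    by - (rule total_rec_comp1[of h], auto intro!: total_rec_prod_encode total_rec_nth)
qed

lemma rec1_rec_nat:
  assumes "rec1 a" "rec1 g" "rec1 n"
  shows "rec1 (\<lambda>x. rec_nat (a x) (\<lambda>k y. g (prod_encode (k, prod_encode (y, x)))) (n x))"
  unfolding rec1_def
proof (rule total_rec_rec_nat)
  have "total_rec (2 + 1) (\<lambda>xs. drop 2 xs ! 0)"
    by (rule total_rec_drop total_rec_nth | simp)+
  then show "total_rec (2 + 1)
      (\<lambda>xs. g (prod_encode (xs ! 0, prod_encode (xs ! 1, drop 2 xs ! 0))))"
    using assms(2) unfolding rec1_def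
    by - (rule total_rec_comp1[of g], auto intro!: total_rec_prod_encode total_rec_nth)
qed (use assms in \<open>simp_all add: rec1_def\<close>)

lemma rec1_power2:
  assumes "rec1 f"
  shows "rec1 (\<lambda>x. 2 ^ f x)"
proof -
  let ?g = "\<lambda>w. 2 * fst (prod_decode (snd (prod_decode w)))"
  have "rec_nat 1 (\<lambda>k y. ?g (prod_encode (k, prod_encode (y, x)))) n = 2 ^ n" for x n
    by (induction n) auto
  moreover have "rec1 (\<lambda>x. rec_nat 1 (\<lambda>k y. ?g (prod_encode (k, prod_encode (y, x)))) (f x))"
    using assms by (intro rec1_rec_nat rec1_mult rec1_const rec1_prod_decode rec1_id)
  ultimately show ?thesis by simp
qed

lemma rec1_ex:
  assumes "rec1 b" "rec1 (\<lambda>w. of_bool (P (fst (prod_decode w)) (snd (prod_decode w))))"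
  shows "rec1 (\<lambda>x. of_bool (\<exists>a<b x. P a x))"
proof -
  have "rec1 (\<lambda>x. of_bool (\<not> (\<Sum>a<b x. of_bool (P a x)) = (0::nat)))"
    using rec1_sum[OF assms] by (intro rec1_not rec1_eq rec1_const) simp
  moreover have "(\<not> (\<Sum>a<b x. of_bool (P a x)) = (0::nat)) = (\<exists>a<b x. P a x)" for x
    by auto
  ultimately show ?thesis by simp
qed

text \<open>The quotient \<open>m div d\<close> counts the positive multiples of \<open>d\<close>
  that are at most \<open>m\<close>, and multipliers \<open>Suc q\<close> with \<open>q < m\<close>
  reach all of them.\<close>

lemma rec1_div:
  assumes "rec1 f" "rec1 g" "\<And>x. g x > 0"
  shows "rec1 (\<lambda>x. f x div g x)"
proof -
  have "(\<Sum>q<m. of_bool (Suc q * d \<le> m)) = m div d" if "d > 0" for m d :: nat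
  proof -
    have "(\<Sum>q<m. of_bool (Suc q * d \<le> m)) = card {q. q < m \<and> Suc q * d \<le> m}"
      by (simp add: sum.If_cases of_bool_def Int_def conj_commute)
    also have "{q. q < m \<and> Suc q * d \<le> m} = {..<m div d}"
    proof -
      have "q < m" if "Suc q * d \<le> m" for q
      proof -
        have "Suc q * 1 \<le> Suc q * d" using \<open>d > 0\<close> by (intro mult_le_mono2) simp
        from this that have "Suc q * 1 \<le> m" by (rule order_trans)
        then show ?thesis by simp
      qed
      then show ?thesis
        using that by (auto simp: less_eq_div_iff_mult_less_eq Suc_le_eq[symmetric] simp del: mult_Suc)
    qed
    finally show ?thesis by simp
  qed
  moreover have "rec1 (\<lambda>x. \<Sum>q<f x. (\<lambda>w. of_bool (Suc (fst (prod_decode w)) * g (snd (prod_decode w))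
      \<le> f (snd (prod_decode w)))) (prod_encode (q, x)))"
    by (intro assms(1) rec1_sum rec1_le rec1_mult rec1_Suc rec1_prod_decode rec1_id
        rec1_comp[OF assms(2)] rec1_comp[OF assms(1)])
  ultimately show ?thesis using assms(3) by simp
qed

lemma rec1_set_decode:
  assumes "rec1 f" "rec1 g"
  shows "rec1 (\<lambda>x. of_bool (f x \<in> set_decode (g x)))"
proof -
  let ?q = "\<lambda>x. g x div 2 ^ f x"
  have "rec1 (\<lambda>x. of_bool (?q x - 2 * (?q x div 2) = 1))"
    using assms by (intro rec1_eq rec1_diff rec1_mult rec1_div rec1_power2 rec1_const) auto
  moreover have "(q - 2 * (q div 2) = 1) = odd q" for q :: nat by presburger
  ultimately show ?thesis by (simp add: set_decode_def)
qed

section \<open>Realizable functions between coded objects\<close>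

text \<open>This turns quantifiers and sums over a coded set into bounded ones.\<close>

lemma less_set_encode: "finite A \<Longrightarrow> a \<in> A \<Longrightarrow> a < set_encode A"
proof -
  assume A: "finite A" "a \<in> A"
  have "a < 2 ^ a" by simp
  also have "\<dots> \<le> set_encode A"
    unfolding set_encode_def using A by (simp add: member_le_sum)
  finally show ?thesis .
qed

lemma less_code_set_decode: "a \<in> set_decode n \<Longrightarrow> a < n"
  using less_set_encode[of "set_decode n"] by simp

lemma rec1_ex_set:
  assumes "rec1 s" "rec1 p"
  shows "rec1 (\<lambda>n. of_bool (\<exists>a \<in> set_decode (s n). p (prod_encode (a, n)) = 1))"
proof -
  have "rec1 (\<lambda>n. of_bool (\<exists>a < s n. a \<in> set_decode (s n) \<and> p (prod_encode (a, n)) = 1))"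
    using assms
    by (intro rec1_ex rec1_conj rec1_set_decode rec1_prod_decode rec1_id rec1_eq rec1_const
        rec1_comp[OF assms(1)] rec1_comp[OF assms(2)] rec1_prod_encode)
  moreover have "(\<exists>a < s n. a \<in> set_decode (s n) \<and> p (prod_encode (a, n)) = 1)
      = (\<exists>a \<in> set_decode (s n). p (prod_encode (a, n)) = 1)" for n
    using less_code_set_decode by blast
  ultimately show ?thesis by simp
qed

lemma rec1_Collect_less:
  assumes "rec1 b" "rec1 (\<lambda>w. of_bool (P (fst (prod_decode w)) (snd (prod_decode w))))"
  shows "rec1 (\<lambda>n. set_encode {a. a < b n \<and> P a n})"
proof -
  have "rec1 (\<lambda>n. \<Sum>a<b n. (\<lambda>w. of_bool (P (fst (prod_decode w)) (snd (prod_decode w)))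
      * 2 ^ fst (prod_decode w)) (prod_encode (a, n)))"
    using assms by (intro rec1_sum rec1_mult rec1_power2 rec1_prod_decode rec1_id)
  moreover have "set_encode {a. a < b n \<and> P a n} = (\<Sum>a<b n. of_bool (P a n) * 2 ^ a)" for n
    unfolding set_encode_def by (rule sum.mono_neutral_cong_left) auto
  ultimately show ?thesis by simp
qed

lemma rec1_sum_set:
  assumes "rec1 s" "rec1 g"
  shows "rec1 (\<lambda>n. \<Sum>a \<in> set_decode (s n). g (prod_encode (a, n)))"
proof -
  have "rec1 (\<lambda>n. \<Sum>a<s n. (\<lambda>w. of_bool (fst (prod_decode w) \<in> set_decode (s (snd (prod_decode w))))
      * g w) (prod_encode (a, n)))"
    using assms
    by (intro rec1_sum rec1_mult rec1_set_decode rec1_prod_decode rec1_id rec1_comp[OF assms(1)])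
  moreover have "(\<Sum>a \<in> set_decode (s n). g (prod_encode (a, n)))
      = (\<Sum>a<s n. of_bool (a \<in> set_decode (s n)) * g (prod_encode (a, n)))" for n
    by (rule sum.mono_neutral_cong_left) (auto dest: less_code_set_decode)
  ultimately show ?thesis by simp
qed

lemma rec1_image_set:
  assumes "rec1 s" "rec1 g"
  shows "rec1 (\<lambda>n. set_encode ((\<lambda>a. g (prod_encode (a, n))) ` set_decode (s n)))"
proof -
  let ?P = "\<lambda>b n. \<exists>a \<in> set_decode (s n). g (prod_encode (a, n)) = b"
  let ?q = "\<lambda>v. of_bool (g (prod_encode (fst (prod_decode v), snd (prod_decode (snd (prod_decode v)))))
      = fst (prod_decode (snd (prod_decode v)))) :: nat"
  have "rec1 (\<lambda>w. of_bool (\<exists>a \<in> set_decode (s (snd (prod_decode w))). ?q (prod_encode (a, w)) = 1))"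
    using assms
    by (intro rec1_ex_set rec1_eq rec1_prod_decode rec1_id rec1_prod_encode
        rec1_comp[OF assms(2)] rec1_comp[OF assms(1)])
  then have "rec1 (\<lambda>w. of_bool (?P (fst (prod_decode w)) (snd (prod_decode w))))"
    by (simp del: One_nat_def)
  \<comment> \<open>Each value is at most the sum of all values, which bounds the search for
    elements of the image.\<close>
  then have "rec1 (\<lambda>n. set_encode {b. b < Suc (\<Sum>a \<in> set_decode (s n). g (prod_encode (a, n))) \<and> ?P b n})"
    using assms by (intro rec1_Collect_less rec1_Suc rec1_sum_set)
  moreover have "{b. b < Suc (\<Sum>a \<in> set_decode (s n). g (prod_encode (a, n))) \<and> ?P b n}
      = (\<lambda>a. g (prod_encode (a, n))) ` set_decode (s n)" for n
    by (auto simp: less_Suc_eq_le intro!: member_le_sum)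
  ultimately show ?thesis by simp
qed

lemma length_le_list_encode: "length xs \<le> list_encode xs"
proof (induction xs)
  case (Cons x xs)
  then show ?case using le_prod_encode_2[of "list_encode xs" x] by simp
qed simp

text \<open>The empty list, coded by 0, is its own tail.\<close>

lemma funpow_tl_code:
  "((\<lambda>n. snd (prod_decode (n - 1))) ^^ i) (list_encode xs) = list_encode (drop i xs)"
proof (induction i)
  case (Suc i)
  have 0: "prod_decode 0 = (0, 0)" using prod_encode_inverse[of "(0, 0)"] by (simp add: prod_encode_def)
  show ?case
  proof (cases "drop i xs")
    case Nil
    then show ?thesis using Suc by (simp add: 0 drop_Suc tl_drop[symmetric])
  next
    case (Cons y ys)
    then have "drop (Suc i) xs = ys" by (metis drop_Suc tl_drop list.sel(3))
    with Cons Suc show ?thesis by simp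
  qed
qed simp

text \<open>\<open>[]\<close> is the only list with code 0, so the length counts the positions at
  which the iterated tail is still nonzero; \<open>length_le_list_encode\<close> bounds them.
  Entries are heads of iterated tails, with the value 0 out of range.\<close>

lemma rec1_list:
  assumes "rec1 f"
  shows rec1_list_length: "rec1 (\<lambda>n. length (list_decode (f n)))"
    and rec1_list_nth: "rec1 g \<Longrightarrow> rec1 (\<lambda>n. if g n < length (list_decode (f n)) then list_decode (f n) ! g n else 0)"
proof -
  let ?t = "\<lambda>n. snd (prod_decode (n - 1))"
  have rec_nat_funpow: "rec_nat a (\<lambda>k y. ?t y) i = (?t ^^ i) a" for a i
    by (induction i) auto
  have tl: "rec1 (\<lambda>n. list_encode (drop (h n) (list_decode (k n))))" if "rec1 h" "rec1 k" for h k
  proof -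
    have "rec1 (\<lambda>n. rec_nat (k n) (\<lambda>i y. (\<lambda>w. ?t (fst (prod_decode (snd (prod_decode w)))))
        (prod_encode (i, prod_encode (y, n)))) (h n))"
      using that by (intro rec1_rec_nat rec1_prod_decode rec1_diff rec1_const rec1_id)
    moreover have "list_encode (drop i (list_decode c)) = (?t ^^ i) c" for i c
      using funpow_tl_code[of i "list_decode c"] by simp
    ultimately show ?thesis by (simp add: rec_nat_funpow del: One_nat_def)
  qed
  have len: "rec1 (\<lambda>n. length (list_decode (f n)))" if f: "rec1 f" for f
  proof -
    have "rec1 (\<lambda>n. \<Sum>i<f n. (\<lambda>w. of_bool (\<not> list_encode (drop (fst (prod_decode w))
        (list_decode (f (snd (prod_decode w))))) = 0)) (prod_encode (i, n)))"
      using f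
      by (intro rec1_sum rec1_not rec1_eq rec1_const tl rec1_prod_decode rec1_id rec1_comp[OF f])
    moreover have "(\<Sum>i<c. of_bool (\<not> list_encode (drop i (list_decode c)) = 0))
        = length (list_decode c)" for c
    proof -
      have nz: "(list_encode ys = 0) = (ys = [])" for ys by (cases ys) auto
      have "{..<c} \<inter> {i. \<not> length (list_decode c) \<le> i} = {..<length (list_decode c)}"
        using length_le_list_encode[of "list_decode c"] by auto
      then show ?thesis by (simp add: nz)
    qed
    ultimately show ?thesis by simp
  qed
  show "rec1 (\<lambda>n. length (list_decode (f n)))" by (rule len[OF assms])
  assume g: "rec1 g"
  have "rec1 (\<lambda>n. if Suc (g n) \<le> length (list_decode (f n))
      then fst (prod_decode (list_encode (drop (g n) (list_decode (f n))) - 1)) else 0)"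
    using assms g by (intro rec1_if rec1_le rec1_Suc len rec1_prod_decode rec1_diff rec1_const tl)
  moreover have "fst (prod_decode (list_encode (drop i xs) - 1)) = xs ! i" if "i < length xs" for i xs
    using that by (simp add: Cons_nth_drop_Suc[symmetric])
  ultimately show "rec1 (\<lambda>n. if g n < length (list_decode (f n)) then list_decode (f n) ! g n else 0)"
    by (simp add: Suc_le_eq cong: if_cong)
qed

text \<open>Realizers are total; their values on numbers that do not code an element of the domain are
  arbitrary.\<close>

definition realizable :: "'e set \<Rightarrow> ('e \<Rightarrow> nat) \<Rightarrow> ('a \<Rightarrow> nat) \<Rightarrow> ('e \<Rightarrow> 'a) \<Rightarrow> bool" where
  "realizable D E enc f \<longleftrightarrow> (\<exists>F. rec1 F \<and> (\<forall>e \<in> D. F (E e) = enc (f e)))"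

abbreviation enc_set :: "('a \<Rightarrow> nat) \<Rightarrow> 'a set \<Rightarrow> nat" where
  "enc_set enc A \<equiv> set_encode (enc ` A)"

text \<open>The environment under a quantifier: the bound variable is paired with the old
  environment. As its range \<open>A e\<close> is part of the domain, facts about members of
  \<open>A e\<close> are available when the body is realized.\<close>

definition ext_dom :: "'e set \<Rightarrow> ('e \<Rightarrow> 'a set) \<Rightarrow> ('a \<times> 'e) set" where
  "ext_dom D A = {v. snd v \<in> D \<and> fst v \<in> A (snd v)}"

definition ext_enc :: "('a \<Rightarrow> nat) \<Rightarrow> ('e \<Rightarrow> nat) \<Rightarrow> 'a \<times> 'e \<Rightarrow> nat" where
  "ext_enc enc E v = prod_encode (enc (fst v), E (snd v))"

lemma in_ext_dom [simp]: "v \<in> ext_dom D A \<longleftrightarrow> snd v \<in> D \<and> fst v \<in> A (snd v)"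
  by (simp add: ext_dom_def)

section \<open>Closure properties of realizability\<close>

lemma realizable_cong:
  assumes "realizable D E enc f" "\<And>e. e \<in> D \<Longrightarrow> f e = g e"
  shows "realizable D E enc g"
  using assms by (auto simp: realizable_def)

lemma realizable_subset: "realizable D E enc f \<Longrightarrow> D' \<subseteq> D \<Longrightarrow> realizable D' E enc f"
  by (auto simp: realizable_def)

lemma realizable_const: "realizable D E enc (\<lambda>_. c)"
  unfolding realizable_def using rec1_const by blast

lemma realizable_map:
  assumes "realizable D E enc1 f" "rec1 h" "\<And>e. e \<in> D \<Longrightarrow> h (enc1 (f e)) = enc2 (g e)"
  shows "realizable D E enc2 g"
proof -
  obtain F where "rec1 F" "\<forall>e \<in> D. F (E e) = enc1 (f e)"
    using assms(1) by (auto simp: realizable_def)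
  then show ?thesis
    using assms(2,3) unfolding realizable_def
    by (intro exI[of _ "\<lambda>n. h (F n)"]) (auto intro: rec1_comp)
qed

lemma realizable_pair:
  assumes "realizable D E enc1 f" "realizable D E enc2 g"
  shows "realizable D E id (\<lambda>e. prod_encode (enc1 (f e), enc2 (g e)))"
proof -
  obtain F G where "rec1 F" "\<forall>e \<in> D. F (E e) = enc1 (f e)" "rec1 G" "\<forall>e \<in> D. G (E e) = enc2 (g e)"
    using assms by (auto simp: realizable_def)
  then show ?thesis
    unfolding realizable_def
    by (intro exI[of _ "\<lambda>n. prod_encode (F n, G n)"]) (auto intro!: rec1_prod_encode)
qed

lemma realizable_map2:
  assumes "realizable D E enc1 f" "realizable D E enc2 g"
    and "rec1 (\<lambda>w. h (fst (prod_decode w)) (snd (prod_decode w)))"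
    and "\<And>e. e \<in> D \<Longrightarrow> h (enc1 (f e)) (enc2 (g e)) = enc3 (k e)"
  shows "realizable D E enc3 k"
  by (rule realizable_map[OF realizable_pair[OF assms(1,2)] assms(3)]) (simp add: assms(4))

lemma realizable_var: "realizable (ext_dom D A) (ext_enc enc E) enc (\<lambda>v. fst v)"
  unfolding realizable_def
  by (rule exI[of _ "\<lambda>w. fst (prod_decode w)"]) (auto simp: ext_enc_def intro!: rec1_prod_decode rec1_id)

lemma realizable_weaken:
  assumes "realizable D E enc' f"
  shows "realizable (ext_dom D A) (ext_enc enc E) enc' (\<lambda>v. f (snd v))"
proof -
  obtain F where "rec1 F" "\<forall>e \<in> D. F (E e) = enc' (f e)"
    using assms(1) by (auto simp: realizable_def)
  then show ?thesis
    unfolding realizable_def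
    by (intro exI[of _ "\<lambda>w. F (snd (prod_decode w))"])
      (auto simp: ext_enc_def intro: rec1_comp[OF _ rec1_prod_decode(2)[OF rec1_id]])
qed

lemma realizable_not:
  assumes "realizable D E of_bool P"
  shows "realizable D E of_bool (\<lambda>e. \<not> P e)"
  by (rule realizable_map[OF assms rec1_diff[OF rec1_const[of 1] rec1_id]]) auto

text \<open>The values are multiplied, so \<open>Q\<close> need only be realized where \<open>P\<close> holds. This takes care of
  partial operations such as the lookup of an instance that may not exist.\<close>

lemma realizable_conj:
  assumes "realizable D E of_bool P" "realizable {e \<in> D. P e} E of_bool Q"
  shows "realizable D E of_bool (\<lambda>e. P e \<and> Q e)"
proof -
  obtain F G where "rec1 F" "\<forall>e \<in> D. F (E e) = of_bool (P e)"
    "rec1 G" "\<forall>e \<in> {e \<in> D. P e}. G (E e) = of_bool (Q e)"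
    using assms by (auto simp: realizable_def)
  then show ?thesis
    unfolding realizable_def
    by (intro exI[of _ "\<lambda>n. F n * G n"]) (auto intro!: rec1_mult)
qed

lemma realizable_imp:
  assumes "realizable D E of_bool P" "realizable {e \<in> D. P e} E of_bool Q"
  shows "realizable D E of_bool (\<lambda>e. P e \<longrightarrow> Q e)"
  using realizable_not[OF realizable_conj[OF assms(1) realizable_not[OF assms(2)]]] by simp

lemma realizable_disj:
  assumes "realizable D E of_bool P" "realizable D E of_bool Q"
  shows "realizable D E of_bool (\<lambda>e. P e \<or> Q e)"
  using realizable_imp[OF realizable_not[OF assms(1)] realizable_subset[OF assms(2)]]
  by (simp add: imp_conv_disj)

lemma realizable_finite_all:
  fixes P :: "'i::finite \<Rightarrow> 'e \<Rightarrow> bool"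
  assumes "\<And>i. realizable D E of_bool (P i)"
  shows "realizable D E of_bool (\<lambda>e. \<forall>i. P i e)"
proof -
  have "realizable D E of_bool (\<lambda>e. \<forall>i\<in>I. P i e)" if "finite I" for I
    using that
  proof induction
    case empty
    show ?case by (simp add: realizable_const)
  next
    case (insert i I)
    then show ?case
      using realizable_conj[OF assms[of i] realizable_subset[OF insert.IH]] by simp
  qed
  from this[of UNIV] show ?thesis by simp
qed

lemma realizable_Suc: "realizable D E id f \<Longrightarrow> realizable D E id (\<lambda>e. Suc (f e))"
  by (erule realizable_map) (auto intro!: rec1_Suc rec1_id)

lemma realizable_add:
  assumes "realizable D E id f" "realizable D E id g"
  shows "realizable D E id (\<lambda>e. f e + g e)"
  by (rule realizable_map2[OF assms, of "(+)"]) (auto intro!: rec1_add rec1_prod_decode rec1_id)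

lemma realizable_le:
  assumes "realizable D E id f" "realizable D E id g"
  shows "realizable D E of_bool (\<lambda>e. f e \<le> g e)"
  by (rule realizable_map2[OF assms, of "\<lambda>x y. of_bool (x \<le> y)"])
    (auto intro!: rec1_le rec1_prod_decode rec1_id)

lemma realizable_less:
  assumes "realizable D E id f" "realizable D E id g"
  shows "realizable D E of_bool (\<lambda>e. f e < g e)"
  using realizable_le[OF realizable_Suc[OF assms(1)] assms(2)] by (simp add: Suc_le_eq)

text \<open>Injectivity is asked only at the two values compared, because encoders such as
  \<open>enc_mtype\<close> are injective only on proper objects.\<close>

lemma realizable_eq:
  assumes "realizable D E enc f" "realizable D E enc g"
    and "\<And>e. e \<in> D \<Longrightarrow> enc (f e) = enc (g e) \<Longrightarrow> f e = g e"
  shows "realizable D E of_bool (\<lambda>e. f e = g e)"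
  by (rule realizable_map2[OF assms(1,2), of "\<lambda>x y. of_bool (x = y)"])
    (auto dest: assms(3) intro!: rec1_eq rec1_prod_decode rec1_id)

lemma realizable_ex:
  assumes A: "realizable D E (enc_set enc) A" and fin: "\<And>e. e \<in> D \<Longrightarrow> finite (A e)"
    and P: "realizable (ext_dom D A) (ext_enc enc E) of_bool (\<lambda>v. P (fst v) (snd v))"
  shows "realizable D E of_bool (\<lambda>e. \<exists>x \<in> A e. P x e)"
proof -
  obtain S F where S: "rec1 S" "\<forall>e \<in> D. S (E e) = enc_set enc (A e)"
    and F: "rec1 F" "\<forall>v \<in> ext_dom D A. F (ext_enc enc E v) = of_bool (P (fst v) (snd v))"
    using A P by (auto simp: realizable_def)
  have "F (prod_encode (enc x, E e)) = of_bool (P x e)" if "e \<in> D" "x \<in> A e" for x e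
    using F(2)[rule_format, of "(x, e)"] that by (simp add: ext_enc_def)
  then show ?thesis
    unfolding realizable_def using rec1_ex_set[OF S(1) F(1)] S(2) fin
    by (intro exI conjI) auto
qed

lemma realizable_all:
  assumes "realizable D E (enc_set enc) A" "\<And>e. e \<in> D \<Longrightarrow> finite (A e)"
    and "realizable (ext_dom D A) (ext_enc enc E) of_bool (\<lambda>v. P (fst v) (snd v))"
  shows "realizable D E of_bool (\<lambda>e. \<forall>x \<in> A e. P x e)"
  using realizable_not[OF realizable_ex[OF assms(1,2) realizable_not[OF assms(3)]]] by simp

lemma realizable_sum:
  assumes A: "realizable D E (enc_set enc) A" and fin: "\<And>e. e \<in> D \<Longrightarrow> finite (A e)"
    and inj: "\<And>e. e \<in> D \<Longrightarrow> inj_on enc (A e)"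
    and g: "realizable (ext_dom D A) (ext_enc enc E) id (\<lambda>v. g (fst v) (snd v))"
  shows "realizable D E id (\<lambda>e. \<Sum>x \<in> A e. g x e)"
proof -
  obtain S F where S: "rec1 S" "\<forall>e \<in> D. S (E e) = enc_set enc (A e)"
    and F: "rec1 F" "\<forall>v \<in> ext_dom D A. F (ext_enc enc E v) = g (fst v) (snd v)"
    using A g by (auto simp: realizable_def)
  have "F (prod_encode (enc x, E e)) = g x e" if "e \<in> D" "x \<in> A e" for x e
    using F(2)[rule_format, of "(x, e)"] that by (simp add: ext_enc_def)
  then show ?thesis
    unfolding realizable_def using rec1_sum_set[OF S(1) F(1)] S(2) fin inj
    by (intro exI conjI) (auto simp: sum.reindex)
qed

lemma realizable_card:
  assumes "realizable D E (enc_set enc) A" "\<And>e. e \<in> D \<Longrightarrow> finite (A e)"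
    "\<And>e. e \<in> D \<Longrightarrow> inj_on enc (A e)"
  shows "realizable D E id (\<lambda>e. card (A e))"
  using realizable_sum[OF assms realizable_const[where c = 1]] by simp

lemma realizable_image:
  assumes A: "realizable D E (enc_set enc) A" and fin: "\<And>e. e \<in> D \<Longrightarrow> finite (A e)"
    and g: "realizable (ext_dom D A) (ext_enc enc E) enc2 (\<lambda>v. g (fst v) (snd v))"
  shows "realizable D E (enc_set enc2) (\<lambda>e. (\<lambda>x. g x e) ` A e)"
proof -
  obtain S F where S: "rec1 S" "\<forall>e \<in> D. S (E e) = enc_set enc (A e)"
    and F: "rec1 F" "\<forall>v \<in> ext_dom D A. F (ext_enc enc E v) = enc2 (g (fst v) (snd v))"
    using A g by (auto simp: realizable_def)
  have "F (prod_encode (enc x, E e)) = enc2 (g x e)" if "e \<in> D" "x \<in> A e" for x e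
    using F(2)[rule_format, of "(x, e)"] that by (simp add: ext_enc_def)
  then have "(\<lambda>a. F (prod_encode (a, E e))) ` set_decode (S (E e)) = enc2 ` (\<lambda>x. g x e) ` A e"
    if "e \<in> D" for e
    using S(2) fin that by (simp add: image_image)
  then show ?thesis
    unfolding realizable_def using rec1_image_set[OF S(1) F(1)] by (intro exI conjI) auto
qed

lemma realizable_filter:
  assumes A: "realizable D E (enc_set enc) A" and fin: "\<And>e. e \<in> D \<Longrightarrow> finite (A e)"
    and inj: "\<And>e. e \<in> D \<Longrightarrow> inj_on enc (A e)"
    and P: "realizable (ext_dom D A) (ext_enc enc E) of_bool (\<lambda>v. P (fst v) (snd v))"
  shows "realizable D E (enc_set enc) (\<lambda>e. {x \<in> A e. P x e})"
proof -
  obtain S F where S: "rec1 S" "\<forall>e \<in> D. S (E e) = enc_set enc (A e)"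
    and F: "rec1 F" "\<forall>v \<in> ext_dom D A. F (ext_enc enc E v) = of_bool (P (fst v) (snd v))"
    using A P by (auto simp: realizable_def)
  have FP: "F (prod_encode (enc x, E e)) = of_bool (P x e)" if "e \<in> D" "x \<in> A e" for x e
    using F(2)[rule_format, of "(x, e)"] that by (simp add: ext_enc_def)
  let ?Q = "\<lambda>a n. a \<in> set_decode (S n) \<and> F (prod_encode (a, n)) = 1"
  have "rec1 (\<lambda>n. set_encode {a. a < S n \<and> ?Q a n})"
    by (intro S(1) rec1_Collect_less rec1_conj rec1_set_decode rec1_prod_decode rec1_id rec1_eq
        rec1_const rec1_comp[OF S(1)] rec1_comp[OF F(1)] rec1_prod_encode)
  moreover have "{a. a < S (E e) \<and> ?Q a (E e)} = enc ` {x \<in> A e. P x e}" if "e \<in> D" for e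
  proof -
    have "{a. a < S (E e) \<and> ?Q a (E e)} = {a \<in> enc ` A e. F (prod_encode (a, E e)) = 1}"
      using S(2) fin that less_code_set_decode[of _ "S (E e)"] by auto
    also have "\<dots> = enc ` {x \<in> A e. P x e}" using FP that by (auto simp del: One_nat_def)
    finally show ?thesis .
  qed
  ultimately show ?thesis unfolding realizable_def by (intro exI conjI) auto
qed

text \<open>Membership is tested on codes. The last assumption excludes an \<open>f e\<close>
  outside \<open>A e\<close> that shares its code with an element.\<close>

lemma realizable_member:
  assumes "realizable D E enc f" "realizable D E (enc_set enc) A" "\<And>e. e \<in> D \<Longrightarrow> finite (A e)"
    and "\<And>e x. e \<in> D \<Longrightarrow> x \<in> A e \<Longrightarrow> enc (f e) = enc x \<Longrightarrow> f e \<in> A e"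
  shows "realizable D E of_bool (\<lambda>e. f e \<in> A e)"
proof (rule realizable_map2[OF assms(1,2), of "\<lambda>a s. of_bool (a \<in> set_decode s)"])
  show "rec1 (\<lambda>w. of_bool (fst (prod_decode w) \<in> set_decode (snd (prod_decode w))))"
    by (intro rec1_set_decode rec1_prod_decode rec1_id)
  fix e assume "e \<in> D"
  then show "of_bool (enc (f e) \<in> set_decode (enc_set enc (A e))) = of_bool (f e \<in> A e)"
    using assms(3,4) by auto
qed

lemma realizable_ex_less:
  assumes b: "realizable D E id b"
    and P: "realizable (ext_dom D (\<lambda>e. {..<b e})) (ext_enc id E) of_bool (\<lambda>v. P (fst v) (snd v))"
  shows "realizable D E of_bool (\<lambda>e. \<exists>i<b e. P i e)"
proof -
  have "realizable D E (enc_set id) (\<lambda>e. {..<b e})"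
  proof (rule realizable_map[OF b])
    show "rec1 (\<lambda>n. set_encode {a. a < n \<and> 0 = 0})"
      by (intro rec1_Collect_less rec1_eq rec1_const rec1_id)
    show "set_encode {a. a < id (b e) \<and> 0 = 0} = enc_set id {..<b e}" for e
      by (simp add: lessThan_def)
  qed
  from realizable_ex[OF this _ P] show ?thesis by (simp add: Bex_def)
qed

lemma realizable_all_less:
  assumes "realizable D E id b"
    and "realizable (ext_dom D (\<lambda>e. {..<b e})) (ext_enc id E) of_bool (\<lambda>v. P (fst v) (snd v))"
  shows "realizable D E of_bool (\<lambda>e. \<forall>i<b e. P i e)"
  using realizable_not[OF realizable_ex_less[OF assms(1) realizable_not[OF assms(2)]]] by simp

lemma realizable_ex_decode:
  assumes a: "realizable D E id a"
    and code: "realizable D E of_bool (\<lambda>e. a e \<in> enc ` X e)"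
    and P: "realizable (ext_dom D X) (ext_enc enc E) of_bool (\<lambda>v. P (fst v) (snd v))"
  shows "realizable D E of_bool (\<lambda>e. \<exists>x \<in> X e. a e = enc x \<and> P x e)"
proof (rule realizable_cong)
  obtain F where F: "rec1 F" "\<forall>v \<in> ext_dom D X. F (ext_enc enc E v) = of_bool (P (fst v) (snd v))"
    using P by (auto simp: realizable_def)
  have FP: "F (prod_encode (enc x, E e)) = of_bool (P x e)" if "e \<in> D" "x \<in> X e" for x e
    using F(2)[rule_format, of "(x, e)"] that by (simp add: ext_enc_def)
  have "F (prod_encode (a e, E e)) = of_bool (\<exists>x \<in> X e. a e = enc x \<and> P x e)"
    if "e \<in> D" "a e \<in> enc ` X e" for e
  proof -
    from that obtain x where x: "x \<in> X e" "a e = enc x" by auto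
    \<comment> \<open>The realizer sees an element only through its code, so elements with equal
      codes satisfy \<open>P\<close> alike, and any preimage of \<open>a e\<close> decides the
      existential.\<close>
    moreover have "P y e = P x e" if "y \<in> X e" "enc y = enc x" for y
      using FP[OF \<open>e \<in> D\<close> that(1)] FP[OF \<open>e \<in> D\<close> x(1)] that(2) by (metis of_bool_eq_iff)
    ultimately have "(\<exists>x \<in> X e. a e = enc x \<and> P x e) = P x e" by metis
    then show ?thesis using FP[OF \<open>e \<in> D\<close> x(1)] x(2) by (simp only:)
  qed
  moreover obtain G where "rec1 G" "\<forall>e \<in> D. G (E e) = a e"
    using a by (auto simp: realizable_def)
  ultimately have "realizable {e \<in> D. a e \<in> enc ` X e} E of_bool (\<lambda>e. \<exists>x \<in> X e. a e = enc x \<and> P x e)"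
    unfolding realizable_def
    by (intro exI[of _ "\<lambda>n. F (prod_encode (G n, n))"] conjI rec1_comp[OF F(1)] rec1_prod_encode rec1_id)
      simp_all
  with code show "realizable D E of_bool (\<lambda>e. a e \<in> enc ` X e \<and> (\<exists>x \<in> X e. a e = enc x \<and> P x e))"
    by (rule realizable_conj)
qed auto

text \<open>Meant for a set \<open>X e\<close> that is not itself coded in the environment, such as
  all configurations with small code: the numbers below \<open>b e\<close> are searched for codes of
  members.\<close>

lemma realizable_ex_code:
  assumes b: "realizable D E id b" and X: "\<And>e x. e \<in> D \<Longrightarrow> x \<in> X e \<Longrightarrow> enc x < b e"
    and code: "realizable (ext_dom D (\<lambda>e. {..<b e})) (ext_enc id E) of_bool (\<lambda>v. fst v \<in> enc ` X (snd v))"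
    and P: "realizable (ext_dom (ext_dom D (\<lambda>e. {..<b e})) (\<lambda>v. X (snd v))) (ext_enc enc (ext_enc id E)) of_bool
      (\<lambda>v. P (fst v) (snd (snd v)))"
  shows "realizable D E of_bool (\<lambda>e. \<exists>x \<in> X e. P x e)"
proof (rule realizable_cong)
  show "realizable D E of_bool (\<lambda>e. \<exists>a<b e. \<exists>x \<in> X e. a = enc x \<and> P x e)"
    by (rule realizable_ex_less[OF b] realizable_ex_decode realizable_var code P)+
qed (use X in blast)

section \<open>Lists and finite maps\<close>

lemma realizable_Nil: "realizable D E list_encode (\<lambda>e. [])"
  by (rule realizable_const)

lemma realizable_Cons:
  assumes "realizable D E id x" "realizable D E list_encode xs"
  shows "realizable D E list_encode (\<lambda>e. x e # xs e)"
  by (rule realizable_map2[OF assms, of "\<lambda>a b. Suc (prod_encode (a, b))"])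
    (auto intro!: rec1_Suc rec1_prod_encode rec1_prod_decode rec1_id)

lemma realizable_length:
  assumes "realizable D E list_encode xs"
  shows "realizable D E id (\<lambda>e. length (xs e))"
  by (rule realizable_map[OF assms, of "\<lambda>n. length (list_decode n)"])
    (auto intro!: rec1_list_length rec1_id)

lemma realizable_nth:
  assumes "realizable D E list_encode xs" "realizable D E id i" "\<And>e. e \<in> D \<Longrightarrow> i e < length (xs e)"
  shows "realizable D E id (\<lambda>e. xs e ! i e)"
  by (rule realizable_map2[OF assms(1,2),
        of "\<lambda>n i. if i < length (list_decode n) then list_decode n ! i else 0"])
    (auto intro!: rec1_list_nth rec1_prod_decode rec1_id assms(3))

definition enc_pair :: "('a \<Rightarrow> nat) \<Rightarrow> nat \<times> 'a \<Rightarrow> nat" where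
  "enc_pair enc p = prod_encode (fst p, enc (snd p))"

definition map_graph :: "('a \<rightharpoonup> 'b) \<Rightarrow> ('a \<times> 'b) set" where
  "map_graph f = {(a, b). f a = Some b}"

lemma finite_map_graph_iff: "finite (dom f) \<Longrightarrow> finite (map_graph f)"
proof -
  assume "finite (dom f)"
  moreover have "map_graph f = (\<lambda>a. (a, the (f a))) ` dom f" by (force simp: map_graph_def)
  ultimately show ?thesis by simp
qed

text \<open>Through this equation the closure properties for finite sets carry over to domains,
  ranges and restrictions of maps.\<close>

lemma enc_map_graph: "enc_map enc f = enc_set (enc_pair enc) (map_graph f)"
proof -
  have "{prod_encode (a, enc v) |a v. f a = Some v} = enc_pair enc ` map_graph f"
    by (force simp: map_graph_def enc_pair_def)
  then show ?thesis by (simp add: enc_map_def)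
qed

lemma realizable_map_graph:
  "realizable D E (enc_map enc) f \<longleftrightarrow> realizable D E (enc_set (enc_pair enc)) (\<lambda>e. map_graph (f e))"
  by (simp add: realizable_def enc_map_graph)

lemma realizable_fst:
  assumes "realizable D E (enc_pair enc) p"
  shows "realizable D E id (\<lambda>e. fst (p e))"
  by (rule realizable_map[OF assms, of "\<lambda>w. fst (prod_decode w)"])
    (auto simp: enc_pair_def intro!: rec1_prod_decode rec1_id)

lemma realizable_snd:
  assumes "realizable D E (enc_pair enc) p"
  shows "realizable D E enc (\<lambda>e. snd (p e))"
  by (rule realizable_map[OF assms, of "\<lambda>w. snd (prod_decode w)"])
    (auto simp: enc_pair_def intro!: rec1_prod_decode rec1_id)

lemma realizable_Pair:
  assumes "realizable D E id a" "realizable D E enc b"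
  shows "realizable D E (enc_pair enc) (\<lambda>e. (a e, b e))"
  using realizable_pair[OF assms] by (simp add: realizable_def enc_pair_def)

lemma realizable_dom:
  assumes "realizable D E (enc_map enc) f" "\<And>e. e \<in> D \<Longrightarrow> finite (dom (f e))"
  shows "realizable D E (enc_set id) (\<lambda>e. dom (f e))"
proof (rule realizable_cong)
  show "realizable D E (enc_set id) (\<lambda>e. (\<lambda>x. fst x) ` map_graph (f e))"
    using assms by (intro realizable_image) (auto simp: realizable_map_graph
        intro: finite_map_graph_iff realizable_fst realizable_var)
  show "fst ` map_graph (f e) = dom (f e)" for e by (force simp: map_graph_def)
qed

lemma realizable_ran:
  assumes "realizable D E (enc_map enc) f" "\<And>e. e \<in> D \<Longrightarrow> finite (dom (f e))"
  shows "realizable D E (enc_set enc) (\<lambda>e. ran (f e))"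
proof (rule realizable_cong)
  show "realizable D E (enc_set enc) (\<lambda>e. (\<lambda>x. snd x) ` map_graph (f e))"
    using assms by (intro realizable_image) (auto simp: realizable_map_graph
        intro: finite_map_graph_iff realizable_snd realizable_var)
  show "snd ` map_graph (f e) = ran (f e)" for e by (force simp: map_graph_def ran_def)
qed

text \<open>The value is found by filtering the codes of the graph, so that \<open>enc\<close> need not be injective.\<close>

lemma realizable_lookup:
  assumes f: "realizable D E (enc_map enc) f" and fin: "\<And>e. e \<in> D \<Longrightarrow> finite (dom (f e))"
    and a: "realizable D E id a" and dom: "\<And>e. e \<in> D \<Longrightarrow> a e \<in> dom (f e)"
  shows "realizable D E enc (\<lambda>e. the (f e (a e)))"
proof (rule realizable_map2[OF f a])
  let ?g = "\<lambda>m a. \<Sum>b \<in> set_decode m. (\<lambda>w. if fst (prod_decode (fst (prod_decode w)))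
      = snd (prod_decode (snd (prod_decode w))) then snd (prod_decode (fst (prod_decode w))) else 0)
      (prod_encode (b, prod_encode (m, a)))"
  have "rec1 (\<lambda>w. \<Sum>b \<in> set_decode (fst (prod_decode w)). (\<lambda>w. if fst (prod_decode (fst (prod_decode w)))
      = snd (prod_decode (snd (prod_decode w))) then snd (prod_decode (fst (prod_decode w))) else 0)
      (prod_encode (b, w)))"
    by (intro rec1_sum_set rec1_if rec1_eq rec1_const rec1_prod_decode rec1_id)
  then show "rec1 (\<lambda>w. ?g (fst (prod_decode w)) (snd (prod_decode w)))"
    by (simp cong: if_cong)
  fix e
  assume e: "e \<in> D"
  then obtain v where v: "f e (a e) = Some v" using dom by blast
  let ?G = "enc_pair enc ` map_graph (f e)"
  have fG: "finite ?G" using fin e finite_map_graph_iff by blast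
  have "?g (enc_map enc (f e)) (a e)
      = (\<Sum>b \<in> ?G. if fst (prod_decode b) = a e then snd (prod_decode b) else 0)"
    using fG by (simp add: enc_map_graph cong: if_cong)
  also have "\<dots> = (\<Sum>b \<in> ?G. if b = prod_encode (a e, enc v) then enc v else 0)"
    by (intro sum.cong) (auto simp: map_graph_def enc_pair_def v)
  also have "\<dots> = enc v"
    using fG v by (subst sum.delta) (auto simp: map_graph_def enc_pair_def intro!: image_eqI[where x = "(a e, v)"])
  finally show "?g (enc_map enc (f e)) (id (a e)) = enc (the (f e (a e)))"
    by (simp add: v cong: if_cong)
qed

section \<open>Deleting and rebuilding configurations\<close>

text \<open>Every configuration met while \<open>C\<close> is taken down or built up has this form,
  so types and hosts are always read off from the same \<open>C\<close>.\<close>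

definition sub_config :: "('r::finite) config \<Rightarrow> inst set \<Rightarrow> (iface \<times> inst \<times> inst) set \<Rightarrow> 'r config" where
  "sub_config C Y B = \<lparr>insts = Y, mtyp = mtyp C |` Y, host = host C |` Y, bindings = B\<rparr>"

lemma sub_config_simps [simp]:
  "insts (sub_config C Y B) = Y" "bindings (sub_config C Y B) = B"
  "mtyp (sub_config C Y B) = mtyp C |` Y" "host (sub_config C Y B) = host C |` Y"
  by (simp_all add: sub_config_def)

lemma sub_config_sub_config:
  "sub_config (sub_config C Y B) Y' B' = sub_config C (Y \<inter> Y') B'" if "Y' \<subseteq> Y"
  using that by (simp add: sub_config_def Int_absorb1)

lemma restrict_map_dom: "dom f = A \<Longrightarrow> f |` A = f"
  by (rule ext) (auto simp: restrict_map_def domIff)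

lemma restrict_map_upd_the: "dom f = A \<Longrightarrow> z \<in> A \<Longrightarrow> (f |` (A - {z}))(z \<mapsto> the (f z)) = f"
  by (rule ext) (auto simp: restrict_map_def)

lemma sub_config_self:
  assumes "dom (mtyp C) = insts C" "dom (host C) = insts C"
  shows "sub_config C (insts C) (bindings C) = (C :: ('r::finite) config)"
proof -
  show ?thesis
    using restrict_map_dom[OF assms(1)] restrict_map_dom[OF assms(2)]
    by (intro config.equality) simp_all
qed

definition over :: "('r::finite) mtype set \<Rightarrow> 'r node set \<Rightarrow> 'r config \<Rightarrow> bool" where
  "over U Os C \<longleftrightarrow> (\<forall>z \<in> insts C. mtyp_of C z \<in> U \<and> the (host C z) \<in> Os)"

lemma over_sub_config: "over U Os C \<Longrightarrow> Y \<subseteq> insts C \<Longrightarrow> over U Os (sub_config C Y B)"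
  by (auto simp: over_def)

lemma configuration_bindingD:
  assumes "configuration C" "(p, z1, z2) \<in> bindings C"
  shows "z1 \<in> insts C" "z2 \<in> insts C" "z1 \<noteq> z2"
    "p \<in> req_dom (mtyp_of C z1)" "p \<in> dom (prov (mtyp_of C z2))"
  using assms unfolding configuration_def by fast+

lemma configuration_sub_config:
  assumes "configuration C" "Y \<subseteq> insts C" "B \<subseteq> bindings C"
    and BY: "\<And>p z1 z2. (p, z1, z2) \<in> B \<Longrightarrow> z1 \<in> Y \<and> z2 \<in> Y"
  shows "configuration (sub_config C Y B)"
  unfolding configuration_def
proof (intro conjI)
  show "finite (insts (sub_config C Y B))" "finite (bindings (sub_config C Y B))"
    using assms(1-3) by (auto simp: configuration_def intro: finite_subset)
  show "dom (mtyp (sub_config C Y B)) = insts (sub_config C Y B)"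
    "dom (host (sub_config C Y B)) = insts (sub_config C Y B)"
    using assms(1,2) by (auto simp: configuration_def)
  show "ran (mtyp (sub_config C Y B)) \<subseteq> mtypes"
    using assms(1) ran_restrictD by (fastforce simp: configuration_def ran_def)
  show "\<forall>(p, z1, z2) \<in> bindings (sub_config C Y B).
      z1 \<in> insts (sub_config C Y B) \<and> z2 \<in> insts (sub_config C Y B) \<and> z1 \<noteq> z2 \<and>
      p \<in> req_dom (mtyp_of (sub_config C Y B) z1) \<inter> dom (prov (mtyp_of (sub_config C Y B) z2))"
  proof (intro ballI, clarify)
    fix p z1 z2
    assume b: "(p, z1, z2) \<in> bindings (sub_config C Y B)"
    then have "(p, z1, z2) \<in> bindings C" using assms(3) by auto
    with b BY[of p z1 z2] configuration_bindingD[OF assms(1), of p z1 z2]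
    show "z1 \<in> insts (sub_config C Y B) \<and> z2 \<in> insts (sub_config C Y B) \<and> z1 \<noteq> z2 \<and>
      p \<in> req_dom (mtyp_of (sub_config C Y B) z1) \<inter> dom (prov (mtyp_of (sub_config C Y B) z2))"
      by simp
  qed
qed

text \<open>Fewer instances and fewer bindings only relax resource limits and capacities. Strong
  requirements survive because a kept instance keeps all of its strong bindings and, by
  \<open>BY\<close>, their providers.\<close>

lemma provisionally_correct_sub_config:
  assumes C: "provisionally_correct C" "Y \<subseteq> insts C" "B \<subseteq> bindings C"
    and BY: "\<And>p z1 z2. (p, z1, z2) \<in> B \<Longrightarrow> z1 \<in> Y \<and> z2 \<in> Y"
    and strong: "\<And>p z1 z2. \<lbrakk>(p, z1, z2) \<in> bindings C; z1 \<in> Y; p \<in> dom (req_s (mtyp_of C z1))\<rbrakk>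
      \<Longrightarrow> (p, z1, z2) \<in> B"
  shows "provisionally_correct (sub_config C Y B)"
  unfolding provisionally_correct_def
proof (intro conjI ballI allI impI)
  have conf: "configuration C" using C by (simp add: provisionally_correct_def)
  show "configuration (sub_config C Y B)"
    using conf C(2,3) BY by (rule configuration_sub_config)
  fix o' r
  assume "o' \<in> ran (host (sub_config C Y B))"
  then have "o' \<in> ran (host C)" by (auto simp: ran_def restrict_map_def split: if_splits)
  then have "(\<Sum>z | z \<in> insts C \<and> host C z = Some o'. res (mtyp_of C z) r) \<le> avail o' r"
    using C(1) by (simp add: provisionally_correct_def)
  moreover have "(\<Sum>z | z \<in> Y \<and> host C z = Some o'. res (mtyp_of C z) r)
      \<le> (\<Sum>z | z \<in> insts C \<and> host C z = Some o'. res (mtyp_of C z) r)"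
    using conf C(2) by (intro sum_mono2) (auto simp: configuration_def)
  moreover have "(\<Sum>z | z \<in> Y \<and> host C z = Some o'. res (mtyp_of C z) r)
      = (\<Sum>z | z \<in> insts (sub_config C Y B) \<and> host (sub_config C Y B) z = Some o'.
          res (mtyp_of (sub_config C Y B) z) r)"
    by (rule sum.cong) auto
  ultimately show "(\<Sum>z | z \<in> insts (sub_config C Y B) \<and> host (sub_config C Y B) z = Some o'.
      res (mtyp_of (sub_config C Y B) z) r) \<le> avail o' r" by linarith
next
  fix z p n
  assume "z \<in> insts (sub_config C Y B)" "req_s (mtyp_of (sub_config C Y B) z) p = Some n"
  then have z: "z \<in> Y" "req_s (mtyp_of C z) p = Some n" by auto
  then have "enough_providers C z p n"
    using C by (auto simp: provisionally_correct_def)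
  then obtain S where S: "S \<subseteq> insts C - {z}" "finite S" "card S = n"
    "\<forall>z' \<in> S. (p, z, z') \<in> bindings C \<and> p \<in> dom (prov (mtyp_of C z'))"
    by (auto simp: enough_providers_def)
  then have B: "\<forall>z' \<in> S. (p, z, z') \<in> B" using z strong by blast
  then have "S \<subseteq> Y" using BY by blast
  with B S show "enough_providers (sub_config C Y B) z p n"
    unfolding enough_providers_def by (intro exI[of _ S]) (auto simp: restrict_map_def)
next
  fix z p n
  assume "z \<in> insts (sub_config C Y B)" "prov (mtyp_of (sub_config C Y B) z) p = Some n"
  then have z: "z \<in> Y" "prov (mtyp_of C z) p = Some n" by auto
  then have "within_capacity C z p n"
    using C by (auto simp: provisionally_correct_def)
  then show "within_capacity (sub_config C Y B) z p n"
    unfolding within_capacity_def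
  proof (rule contrapos_nn)
    assume "\<exists>S \<subseteq> insts (sub_config C Y B) - {z}. finite S \<and> n < enat (card S) \<and>
      (\<forall>z' \<in> S. (p, z', z) \<in> bindings (sub_config C Y B) \<and>
        p \<in> req_dom (mtyp_of (sub_config C Y B) z'))"
    then obtain S where S: "S \<subseteq> Y - {z}" "finite S" "n < enat (card S)"
      "\<forall>z' \<in> S. (p, z', z) \<in> B \<and> p \<in> req_dom (mtyp_of (sub_config C Y B) z')"
      by auto
    then have "\<forall>z' \<in> S. (p, z', z) \<in> bindings C \<and> p \<in> req_dom (mtyp_of C z')"
      using C(3) by (fastforce simp: restrict_map_def)
    then show "\<exists>S \<subseteq> insts C - {z}. finite S \<and> n < enat (card S) \<and>
      (\<forall>z' \<in> S. (p, z', z) \<in> bindings C \<and> p \<in> req_dom (mtyp_of C z'))"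
      using S C(2) by (intro exI[of _ S]) auto
  qed
qed

definition strip :: "('r::finite) config \<Rightarrow> inst \<Rightarrow> 'r config" where
  "strip C z = sub_config C (insts C - {z}) {(p, z1, z2) \<in> bindings C. z1 \<noteq> z \<and> z2 \<noteq> z}"

text \<open>The argument with which \<open>New\<close> recreates \<open>z\<close>, recovered from
  the bindings of the resulting configuration.\<close>

definition strong_providers :: "('r::finite) config \<Rightarrow> inst \<Rightarrow> iface \<rightharpoonup> inst set" where
  "strong_providers C z p =
     (if p \<in> dom (req_s (mtyp_of C z)) then Some {z'. (p, z, z') \<in> bindings C} else None)"

text \<open>The actions that suffice for optimal plans, given by their codes. Creations and bindings are
  described backwards, as the removal of an instance or of a binding from the resulting
  configuration.\<close>

definition code_step :: "('r::finite) config \<Rightarrow> nat \<Rightarrow> 'r config \<Rightarrow> bool" where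
  "code_step C a C' \<longleftrightarrow>
     (\<exists>z \<in> insts C. a = enc_action (Del z :: 'r action) \<and> C' = strip C z) \<or>
     (\<exists>z \<in> insts C'. a = enc_action (New z (mtyp_of C' z) (the (host C' z)) (strong_providers C' z)) \<and>
        C = strip C' z \<and>
        (\<forall>b \<in> bindings C'. snd (snd b) \<noteq> z \<and>
           (fst (snd b) = z \<longrightarrow> fst b \<in> dom (req_s (mtyp_of C' z))))) \<or>
     (\<exists>b \<in> bindings C'. a = enc_action (Bind (fst b) (fst (snd b)) (snd (snd b)) :: 'r action) \<and>
        fst b \<in> dom (req_w (mtyp_of C' (fst (snd b)))) \<and>
        C = sub_config C' (insts C') {b' \<in> bindings C'. b' \<noteq> b})"

lemma step_Del: "z \<in> insts C \<Longrightarrow> step C (Del z) (strip C z)"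
  using step.del[of z C] by (simp add: strip_def sub_config_def)

lemma step_Bind:
  assumes "configuration C" "(p, z1, z2) \<in> bindings C" "p \<in> dom (req_w (mtyp_of C z1))"
  shows "step (sub_config C (insts C) (bindings C - {(p, z1, z2)})) (Bind p z1 z2) C"
proof -
  let ?D = "sub_config C (insts C) (bindings C - {(p, z1, z2)})"
  note b = configuration_bindingD[OF assms(1,2)]
  have "step ?D (Bind p z1 z2) (?D\<lparr>bindings := bindings ?D \<union> {(p, z1, z2)}\<rparr>)"
    using b assms(3) by (intro step.bind) auto
  moreover have "?D\<lparr>bindings := bindings ?D \<union> {(p, z1, z2)}\<rparr> = sub_config C (insts C) (bindings C)"
    using assms(2) by (auto simp: sub_config_def)
  moreover have "\<dots> = C"
    using assms(1) by (intro sub_config_self) (auto simp: configuration_def)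
  ultimately show ?thesis by simp
qed

text \<open>A creation adds exactly strong bindings that start at the new instance. So
  \<open>z\<close> can have been created last only if nothing is bound to it and it has no weak
  bindings yet.\<close>

lemma step_New:
  assumes C: "provisionally_correct C" and z: "z \<in> insts C"
    and prov: "\<And>p z1 z2. (p, z1, z2) \<in> bindings C \<Longrightarrow> z2 \<noteq> z"
    and strong: "\<And>p z2. (p, z, z2) \<in> bindings C \<Longrightarrow> p \<in> dom (req_s (mtyp_of C z))"
  shows "step (strip C z) (New z (mtyp_of C z) (the (host C z)) (strong_providers C z)) C"
proof -
  have conf: "configuration C" using C by (simp add: provisionally_correct_def)
  note b = configuration_bindingD[OF conf]
  let ?T = "mtyp_of C z" and ?Bs = "strong_providers C z" and ?D = "strip C z"
  have mz: "mtyp C z = Some ?T" "host C z = Some (the (host C z))"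
    using conf z by (auto simp: configuration_def set_eq_iff domIff)
  have "step ?D (New z ?T (the (host C z)) ?Bs)
    \<lparr>insts = insts ?D \<union> {z}, mtyp = (mtyp ?D)(z \<mapsto> ?T), host = (host ?D)(z \<mapsto> the (host C z)),
     bindings = bindings ?D \<union> {(p, z, z') | p z'. p \<in> dom (req_s ?T) \<and> z' \<in> the (?Bs p)}\<rparr>"
  proof (rule step.new)
    show "?T \<in> mtypes" using conf mz by (auto simp: configuration_def ran_def)
    show "dom ?Bs = dom (req_s ?T)" by (auto simp: strong_providers_def domIff split: if_splits)
    show "z \<notin> insts ?D" by (simp add: strip_def)
    show "\<forall>p \<in> dom (req_s ?T). z \<notin> the (?Bs p) \<and> the (req_s ?T p) \<le> card (the (?Bs p))"
    proof
      fix p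
      assume "p \<in> dom (req_s ?T)"
      then obtain n where n: "req_s ?T p = Some n" by blast
      then have "enough_providers C z p n" using C z by (simp add: provisionally_correct_def)
      then obtain S where "card S = n" "\<forall>z' \<in> S. (p, z, z') \<in> bindings C"
        by (auto simp: enough_providers_def)
      moreover have "finite {z'. (p, z, z') \<in> bindings C}"
        using conf b by (auto simp: configuration_def intro: finite_subset[of _ "insts C"])
      ultimately have "n \<le> card {z'. (p, z, z') \<in> bindings C}"
        by (metis (no_types, lifting) card_mono mem_Collect_eq subsetI)
      then show "z \<notin> the (?Bs p) \<and> the (req_s ?T p) \<le> card (the (?Bs p))"
        using n prov by (auto simp: strong_providers_def)
    qed
    show "\<forall>p \<in> dom (req_s ?T). \<forall>z' \<in> the (?Bs p). z' \<in> insts ?D \<and> p \<in> dom (prov (mtyp_of ?D z'))"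
    proof (intro ballI)
      fix p z'
      assume "p \<in> dom (req_s ?T)" "z' \<in> the (?Bs p)"
      then have "(p, z, z') \<in> bindings C" by (simp add: strong_providers_def)
      with b(2,5)[of p z z'] prov[of p z z']
      show "z' \<in> insts ?D \<and> p \<in> dom (prov (mtyp_of ?D z'))"
        by (auto simp: strip_def)
    qed
  qed
  moreover have "\<lparr>insts = insts ?D \<union> {z}, mtyp = (mtyp ?D)(z \<mapsto> ?T), host = (host ?D)(z \<mapsto> the (host C z)),
     bindings = bindings ?D \<union> {(p, z, z') | p z'. p \<in> dom (req_s ?T) \<and> z' \<in> the (?Bs p)}\<rparr> = C"
    (is "?E = C")
  proof (rule config.equality)
    show "insts ?E = insts C" using z by (auto simp: strip_def)
    show "mtyp ?E = mtyp C" "host ?E = host C"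
      using conf z by (simp_all add: strip_def configuration_def restrict_map_upd_the)
    have "(p, z1, z2) \<in> bindings ?E \<longleftrightarrow> (p, z1, z2) \<in> bindings C" for p z1 z2
      using strong[of p z2] prov[of p z1 z2]
      by (cases "z1 = z") (auto simp: strip_def strong_providers_def)
    then show "bindings ?E = bindings C" by (simp add: set_eq_iff)
  qed simp
  ultimately show ?thesis by simp
qed

text \<open>This direction is enough: arbitrary solutions are compared through \<open>target\<close>
  alone, and plans made of code steps reach every target.\<close>

lemma code_step_step:
  assumes "provisionally_correct C'" "code_step C a C'"
  shows "\<exists>\<alpha>. a = enc_action \<alpha> \<and> step C \<alpha> C'"
  using assms(2) unfolding code_step_def
proof (elim disjE bexE conjE)
  fix z
  assume "z \<in> insts C" "a = enc_action (Del z :: 'a action)" "C' = strip C z"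
  then show ?thesis using step_Del by blast
next
  fix z
  assume "z \<in> insts C'" "C = strip C' z"
    "a = enc_action (New z (mtyp_of C' z) (the (host C' z)) (strong_providers C' z))"
    "\<forall>b \<in> bindings C'. snd (snd b) \<noteq> z \<and>
      (fst (snd b) = z \<longrightarrow> fst b \<in> dom (req_s (mtyp_of C' z)))"
  then show ?thesis using step_New[OF assms(1), of z] by fastforce
next
  fix b
  assume b: "b \<in> bindings C'" "a = enc_action (Bind (fst b) (fst (snd b)) (snd (snd b)) :: 'a action)"
    "fst b \<in> dom (req_w (mtyp_of C' (fst (snd b))))"
    "C = sub_config C' (insts C') {b' \<in> bindings C'. b' \<noteq> b}"
  moreover have "{b' \<in> bindings C'. b' \<noteq> b} = bindings C' - {b}" by blast
  moreover obtain p z1 z2 where "b = (p, z1, z2)" by (cases b) auto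
  ultimately show ?thesis
    using step_Bind[of C' p z1 z2] assms(1) by (auto simp: provisionally_correct_def)
qed

section \<open>Reachability among admissible configurations\<close>

definition admissible :: "('r::finite) mtype set \<Rightarrow> 'r node set \<Rightarrow> 'r config \<Rightarrow> bool" where
  "admissible U Os C \<longleftrightarrow> provisionally_correct C \<and> over U Os C"

text \<open>Admissibility is asked only after a step, because the initial configuration may use
  types outside \<open>U\<close> or nodes outside \<open>Os\<close>.\<close>

abbreviation reaches :: "('r::finite) mtype set \<Rightarrow> 'r node set \<Rightarrow> 'r config \<Rightarrow> 'r config \<Rightarrow> bool" where
  "reaches U Os \<equiv> (\<lambda>C C'. admissible U Os C' \<and> (\<exists>a. code_step C a C'))\<^sup>*\<^sup>*"

text \<open>Acyclicity of the universe yields an instance that no other one strongly requires: it can be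
  deleted first, and created last.\<close>

lemma ex_not_strongly_required:
  assumes U: "well_formed_universe U" and C: "configuration C" "over U Os C"
    and Y: "Y \<subseteq> insts C" "Y \<noteq> {}"
  shows "\<exists>z \<in> Y. \<forall>p z1. (p, z1, z) \<in> bindings C \<longrightarrow> z1 \<in> Y \<longrightarrow> p \<notin> dom (req_s (mtyp_of C z1))"
proof -
  let ?r = "{(\<T>, \<T>'). \<T> \<in> U \<and> \<T>' \<in> U \<and> dom (req_s \<T>) \<inter> dom (prov \<T>') \<noteq> {}}"
  have "finite ?r"
    using U by (intro finite_subset[of ?r "U \<times> U"]) (auto simp: well_formed_universe_def)
  then have "wf ?r"
    using U by (intro finite_acyclic_wf) (auto simp: well_formed_universe_def)
  moreover obtain y where "y \<in> Y" using Y by blast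
  ultimately obtain T where T: "T \<in> mtyp_of C ` Y" "\<And>T'. (T', T) \<in> ?r \<Longrightarrow> T' \<notin> mtyp_of C ` Y"
    by (metis (no_types, lifting) imageI wfE_min)
  then obtain z where z: "z \<in> Y" "T = mtyp_of C z" by blast
  have "p \<notin> dom (req_s (mtyp_of C z1))" if b: "(p, z1, z) \<in> bindings C" "z1 \<in> Y" for p z1
  proof
    assume "p \<in> dom (req_s (mtyp_of C z1))"
    moreover have "p \<in> dom (prov (mtyp_of C z))" using configuration_bindingD(5)[OF C(1) b(1)] .
    moreover have "mtyp_of C z1 \<in> U" "mtyp_of C z \<in> U"
      using C(2) Y b z by (auto simp: over_def)
    ultimately have "(mtyp_of C z1, T) \<in> ?r" using z by blast
    then show False using T(2) b(2) by blast
  qed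
  then show ?thesis using z by blast
qed

text \<open>Both directions share one induction: an instance \<open>z\<close> that no member of
  \<open>Y\<close> strongly requires is deleted first and created last, and \<open>Y - {z}\<close>
  stays closed under strong requirements. Going up asks that \<open>B\<close> consist of strong
  bindings, as \<open>New\<close> makes no others.\<close>

lemma reaches_down_up:
  assumes U: "well_formed_universe U" and C: "admissible U Os C"
    and B: "B \<subseteq> bindings C"
      "\<And>p z1 z2. (p, z1, z2) \<in> bindings C \<Longrightarrow> p \<in> dom (req_s (mtyp_of C z1)) \<Longrightarrow> (p, z1, z2) \<in> B"
    and Y: "Y \<subseteq> insts C"
      "\<And>p z1 z2. (p, z1, z2) \<in> bindings C \<Longrightarrow> p \<in> dom (req_s (mtyp_of C z1)) \<Longrightarrow> z1 \<in> Y \<Longrightarrow> z2 \<in> Y"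
  defines "S \<equiv> \<lambda>Y. sub_config C Y {b \<in> B. fst (snd b) \<in> Y \<and> snd (snd b) \<in> Y}"
  shows "reaches U Os (S Y) (S {})"
    and "(\<And>p z1 z2. (p, z1, z2) \<in> B \<Longrightarrow> p \<in> dom (req_s (mtyp_of C z1))) \<Longrightarrow> reaches U Os (S {}) (S Y)"
proof -
  have pc: "provisionally_correct C" and w: "over U Os C" and conf: "configuration C"
    using C by (auto simp: admissible_def provisionally_correct_def)
  have adm: "admissible U Os (S Y)"
    if "Y \<subseteq> insts C" "\<And>p z1 z2. (p, z1, z2) \<in> bindings C \<Longrightarrow>
        p \<in> dom (req_s (mtyp_of C z1)) \<Longrightarrow> z1 \<in> Y \<Longrightarrow> z2 \<in> Y" for Y
    unfolding admissible_def S_def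
    using that B by (intro conjI provisionally_correct_sub_config[OF pc] over_sub_config[OF w]) auto
  have "finite Y" using Y(1) conf by (auto simp: configuration_def intro: finite_subset)
  then have "reaches U Os (S Y) (S {}) \<and>
    ((\<forall>p z1 z2. (p, z1, z2) \<in> B \<longrightarrow> p \<in> dom (req_s (mtyp_of C z1))) \<longrightarrow> reaches U Os (S {}) (S Y))"
    using Y
  proof (induction "card Y" arbitrary: Y)
    case 0
    then show ?case by simp
  next
    case (Suc n)
    then have "Y \<noteq> {}" by auto
    then obtain z where z: "z \<in> Y"
      "\<forall>p z1. (p, z1, z) \<in> bindings C \<longrightarrow> z1 \<in> Y \<longrightarrow> p \<notin> dom (req_s (mtyp_of C z1))"
      using ex_not_strongly_required[OF U conf w Suc.prems(2)] by blast
    let ?Y = "Y - {z}"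
    have Y': "?Y \<subseteq> insts C" "\<And>p z1 z2. (p, z1, z2) \<in> bindings C \<Longrightarrow>
        p \<in> dom (req_s (mtyp_of C z1)) \<Longrightarrow> z1 \<in> ?Y \<Longrightarrow> z2 \<in> ?Y"
      using Suc.prems z by blast+
    have IH: "reaches U Os (S ?Y) (S {})"
      "(\<forall>p z1 z2. (p, z1, z2) \<in> B \<longrightarrow> p \<in> dom (req_s (mtyp_of C z1))) \<Longrightarrow> reaches U Os (S {}) (S ?Y)"
      using Suc.hyps(1)[of ?Y] Suc.hyps(2) Suc.prems(1) Y' z(1) by auto
    have strip: "strip (S Y) z = S ?Y"
    proof -
      have "{(p, z1, z2). ((p, z1, z2) \<in> B \<and> z1 \<in> Y \<and> z2 \<in> Y) \<and> z1 \<noteq> z \<and> z2 \<noteq> z}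
          = {b \<in> B. fst (snd b) \<in> ?Y \<and> snd (snd b) \<in> ?Y}" by auto
      moreover have "Y \<inter> ?Y = ?Y" by blast
      ultimately show ?thesis by (simp add: strip_def S_def sub_config_def)
    qed
    have "code_step (S Y) (enc_action (Del z :: 'a action)) (S ?Y)"
      unfolding code_step_def using z(1) strip by (intro disjI1 bexI[of _ z]) (auto simp: S_def)
    moreover have "admissible U Os (S ?Y)" using Y' by (rule adm)
    ultimately have down: "reaches U Os (S Y) (S {})"
      by (intro converse_rtranclp_into_rtranclp[OF _ IH(1)]) blast
    have "reaches U Os (S {}) (S Y)"
      if str: "\<forall>p z1 z2. (p, z1, z2) \<in> B \<longrightarrow> p \<in> dom (req_s (mtyp_of C z1))"
    proof -
      \<comment> \<open>\<open>z\<close> provides for no instance of \<open>Y\<close>, as must be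
        the case for an instance just created.\<close>
      have "z2 \<noteq> z" if "(p, z1, z2) \<in> B" "z1 \<in> Y" for p z1 z2
        using str that z(2) B(1) by blast
      then have "\<forall>b \<in> bindings (S Y). snd (snd b) \<noteq> z \<and>
          (fst (snd b) = z \<longrightarrow> fst b \<in> dom (req_s (mtyp_of (S Y) z)))"
        using str[rule_format] z(1) by (fastforce simp: S_def simp del: domIff)
      then have "code_step (S ?Y) (enc_action (New z (mtyp_of (S Y) z) (the (host (S Y) z))
          (strong_providers (S Y) z))) (S Y)"
        unfolding code_step_def using z(1) strip
        by (intro disjI2 disjI1 bexI[of _ z]) (auto simp: S_def)
      moreover have "admissible U Os (S Y)" using Suc.prems(2,3) by (rule adm)
      ultimately show ?thesis
        by (intro rtranclp.rtrancl_into_rtrancl[OF IH(2)[OF str]]) blast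
    qed
    with down show ?case by blast
  qed
  then show "reaches U Os (S Y) (S {})"
    and "(\<And>p z1 z2. (p, z1, z2) \<in> B \<Longrightarrow> p \<in> dom (req_s (mtyp_of C z1))) \<Longrightarrow> reaches U Os (S {}) (S Y)"
    by auto
qed

text \<open>The empty configuration is a common meeting point. From it \<open>C'\<close> is built
  with strong bindings only, and the weak bindings follow one by one through
  \<open>Bind\<close>.\<close>

lemma reaches_admissible:
  assumes U: "well_formed_universe U" and C: "admissible U Os C" "admissible U Os C'"
  shows "reaches U Os C C'"
proof -
  let ?empty = "\<lparr>insts = {}, mtyp = Map.empty, host = Map.empty, bindings = {}\<rparr> :: 'a config"
  have empty: "sub_config D {} {} = ?empty" for D :: "'a config"
    by (simp add: sub_config_def)
  have conf: "configuration C" "configuration C'"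
    using C by (auto simp: admissible_def provisionally_correct_def)
  have self: "sub_config D (insts D) (bindings D) = D" if "configuration D" for D :: "'a config"
    using that by (intro sub_config_self) (auto simp: configuration_def)
  have all: "{b \<in> B. fst (snd b) \<in> insts D \<and> snd (snd b) \<in> insts D} = B"
    if "configuration D" "B \<subseteq> bindings D" for D :: "'a config" and B
    using that configuration_bindingD(1,2)[OF that(1)] by auto
  have "reaches U Os C ?empty"
  proof -
    have "reaches U Os (sub_config C (insts C)
        {b \<in> bindings C. fst (snd b) \<in> insts C \<and> snd (snd b) \<in> insts C})
        (sub_config C {} {b \<in> bindings C. fst (snd b) \<in> {} \<and> snd (snd b) \<in> {}})"
      by (rule reaches_down_up(1)[OF U C(1)]) (use configuration_bindingD(2)[OF conf(1)] in blast)+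
    then show ?thesis by (simp only: all[OF conf(1) subset_refl] self[OF conf(1)]) (simp add: empty)
  qed
  moreover
  let ?S = "{b \<in> bindings C'. fst b \<in> dom (req_s (mtyp_of C' (fst (snd b))))}"
  have S: "?S \<subseteq> bindings C'" by blast
  have "reaches U Os ?empty (sub_config C' (insts C') ?S)"
  proof -
    have "reaches U Os (sub_config C' {} {b \<in> ?S. fst (snd b) \<in> {} \<and> snd (snd b) \<in> {}})
        (sub_config C' (insts C') {b \<in> ?S. fst (snd b) \<in> insts C' \<and> snd (snd b) \<in> insts C'})"
      by (rule reaches_down_up(2)[OF U C(2) S])
        (use configuration_bindingD(2)[OF conf(2)] in \<open>simp, blast?\<close>)+
    then show ?thesis by (simp only: all[OF conf(2) S]) (simp add: empty)
  qed
  moreover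
  \<comment> \<open>Each intermediate configuration is a part of the provisionally correct
    \<open>C'\<close> that has all of its strong bindings, so no capacity is exceeded on the
    way.\<close>
  have "reaches U Os (sub_config C' (insts C') ?S) (sub_config C' (insts C') (?S \<union> W))"
    if "finite W" "W \<subseteq> bindings C' - ?S" for W
    using that
  proof induction
    case empty
    show ?case by simp
  next
    case (insert b W)
    let ?D = "sub_config C' (insts C') (?S \<union> insert b W)"
    have sub: "?S \<union> insert b W \<subseteq> bindings C'" using insert.prems by blast
    have adm: "admissible U Os ?D"
      unfolding admissible_def
    proof (rule conjI)
      show "provisionally_correct ?D"
      proof (rule provisionally_correct_sub_config)
        show "provisionally_correct C'" using C(2) by (simp add: admissible_def)
        show "z1 \<in> insts C' \<and> z2 \<in> insts C'" if "(p, z1, z2) \<in> ?S \<union> insert b W" for p z1 z2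
          using that sub configuration_bindingD[OF conf(2), of p z1 z2] by blast
      qed (use sub in auto)
      show "over U Os ?D" using C(2) by (auto simp: admissible_def intro: over_sub_config)
    qed
    have b: "b \<in> bindings C'" "b \<notin> ?S" using insert.prems by auto
    then have ins: "fst (snd b) \<in> insts C'" and dom: "fst b \<in> dom (req_w (mtyp_of C' (fst (snd b))))"
      using configuration_bindingD[OF conf(2), of "fst b" "fst (snd b)" "snd (snd b)"] by auto
    have "{b' \<in> ?S \<union> insert b W. b' \<noteq> b} = ?S \<union> W" using b(2) insert.hyps by blast
    then have "code_step (sub_config C' (insts C') (?S \<union> W))
        (enc_action (Bind (fst b) (fst (snd b)) (snd (snd b)) :: 'a action)) ?D"
      unfolding code_step_def using ins dom
      by (intro disjI2 bexI[of _ b]) (auto simp: sub_config_sub_config)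
    with adm insert show ?case
      by (smt (verit, ccfv_threshold) insert_subset rtranclp.rtrancl_into_rtrancl)
  qed
  from this[of "bindings C' - ?S"]
  have "reaches U Os (sub_config C' (insts C') ?S) C'"
    using conf(2) by (simp add: configuration_def Un_absorb1[OF S] self[OF conf(2)])
  ultimately show ?thesis by (meson rtranclp_trans)
qed

section \<open>Zero-sum blocks of vectors\<close>

text \<open>Greedy choice: if the partial sum \<open>s\<close> is at most 0, some remaining entry is
  nonnegative, since together the remaining entries cancel \<open>s\<close>; if
  \<open>s > 0\<close>, some entry is nonpositive. Adding such an entry keeps the absolute value
  within \<open>A\<close>.\<close>

lemma balanced_order:
  fixes a :: "'i \<Rightarrow> int"
  assumes "finite X" "\<forall>i \<in> X. \<bar>a i\<bar> \<le> A" "s + sum a X = 0" "\<bar>s\<bar> \<le> A"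
  shows "\<exists>xs. distinct xs \<and> set xs = X \<and> (\<forall>k. \<bar>s + sum_list (map a (take k xs))\<bar> \<le> A)"
  using assms
proof (induction "card X" arbitrary: X s)
  case 0
  then show ?case by (intro exI[of _ "[]"]) auto
next
  case (Suc n)
  then have "X \<noteq> {}" by auto
  have "\<exists>i \<in> X. \<bar>s + a i\<bar> \<le> A"
  proof (cases "s \<le> 0")
    case True
    have "\<exists>i \<in> X. a i \<ge> 0"
    proof (rule ccontr)
      assume "\<not> ?thesis"
      then have "sum a X < 0" using \<open>finite X\<close> \<open>X \<noteq> {}\<close> sum_strict_mono[of X a "\<lambda>_. 0"] by (auto simp: not_le)
      with Suc.prems(3) True show False by linarith
    qed
    then obtain i where "i \<in> X" "a i \<ge> 0" by blast
    moreover from this Suc.prems(2) have "\<bar>a i\<bar> \<le> A" by blast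
    ultimately show ?thesis using True Suc.prems(4) by (intro bexI[of _ i]) linarith+
  next
    case False
    have "\<exists>i \<in> X. a i \<le> 0"
    proof (rule ccontr)
      assume "\<not> ?thesis"
      then have "sum a X > 0" using \<open>finite X\<close> \<open>X \<noteq> {}\<close> by (intro sum_pos) (auto simp: not_le)
      with Suc.prems(3) False show False by linarith
    qed
    then obtain i where "i \<in> X" "a i \<le> 0" by blast
    moreover from this Suc.prems(2) have "\<bar>a i\<bar> \<le> A" by blast
    ultimately show ?thesis using False Suc.prems(4) by (intro bexI[of _ i]) linarith+
  qed
  then obtain i where i: "i \<in> X" "\<bar>s + a i\<bar> \<le> A" by blast
  have "sum a X = a i + sum a (X - {i})" using Suc.prems(1) i(1) by (rule sum.remove)
  then have "s + a i + sum a (X - {i}) = 0" using Suc.prems(3) by linarith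
  moreover have "n = card (X - {i})" using Suc.hyps(2) i(1) Suc.prems(1) by simp
  ultimately obtain xs where xs: "distinct xs" "set xs = X - {i}"
    "\<forall>k. \<bar>s + a i + sum_list (map a (take k xs))\<bar> \<le> A"
    using Suc.hyps(1)[of "X - {i}" "s + a i"] Suc.prems(1,2) i(2) by blast
  have "\<bar>s + sum_list (map a (take k (i # xs)))\<bar> \<le> A" for k
    using xs(3)[rule_format, of "k - 1"] Suc.prems(4) by (cases k) (auto simp: algebra_simps)
  with xs i(1) show ?case by (intro exI[of _ "i # xs"]) auto
qed

text \<open>In a balanced order the \<open>2 * A + 2\<close> prefixes of length at most
  \<open>2 * A + 1\<close> have sums among \<open>2 * A + 1\<close> values. Two of these sums agree,
  and the entries in between add up to zero.\<close>

lemma small_zero_sum_subset: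
  fixes a :: "'i \<Rightarrow> int"
  assumes X: "finite X" "X \<noteq> {}" and a: "\<forall>i \<in> X. \<bar>a i\<bar> \<le> int A" "sum a X = 0"
  shows "\<exists>Y \<subseteq> X. Y \<noteq> {} \<and> sum a Y = 0 \<and> card Y \<le> 2 * A + 1"
proof (cases "card X \<le> 2 * A + 1")
  case True
  with assms show ?thesis by blast
next
  case False
  obtain xs where xs: "distinct xs" "set xs = X" "\<And>k. \<bar>sum_list (map a (take k xs))\<bar> \<le> int A"
    using balanced_order[of X a "int A" 0] assms by auto
  let ?f = "\<lambda>k. sum_list (map a (take k xs))"
  have "?f ` {..2 * A + 1} \<subseteq> {- int A..int A}"
    using xs(3) by (auto simp: abs_le_iff) (metis minus_le_iff)+
  then have "card (?f ` {..2 * A + 1}) \<le> card {- int A..int A}" by (intro card_mono) auto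
  then have "\<not> inj_on ?f {..2 * A + 1}" by (intro pigeonhole) simp
  then obtain j k where jk: "j < k" "k \<le> 2 * A + 1" "?f j = ?f k"
    unfolding inj_on_def by (metis atMost_iff linorder_neqE_nat)
  let ?ys = "drop j (take k xs)"
  have "take k xs = take j xs @ ?ys"
    using jk(1) by (metis append_take_drop_id min.strict_order_iff take_take min.commute)
  then have "?f k = ?f j + sum_list (map a ?ys)" by (metis map_append sum_list_append)
  then have "sum_list (map a ?ys) = 0" using jk(3) by simp
  moreover have "distinct ?ys" using xs(1) by simp
  ultimately have "sum a (set ?ys) = 0" by (simp add: sum_list_distinct_conv_sum_set)
  moreover have "length xs = card X" using xs by (metis distinct_card)
  then have "length ?ys = k - j" using False jk by simp
  then have "set ?ys \<noteq> {}" "card (set ?ys) \<le> 2 * A + 1"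
    using jk \<open>distinct ?ys\<close> by (auto simp: distinct_card simp del: set_empty)
  moreover have "set ?ys \<subseteq> X" using xs(2) set_drop_subset set_take_subset by fastforce
  ultimately show ?thesis by blast
qed

text \<open>Blocks are split off one after the other. Each is labelled by one of its own elements,
  so labels of different blocks never collide, and they form a finite index set for the next
  coordinate.\<close>

lemma zero_sum_blocks:
  fixes a :: "nat \<Rightarrow> int"
  assumes "finite X" "\<forall>i \<in> X. \<bar>a i\<bar> \<le> int A" "sum a X = 0"
  shows "\<exists>g. g ` X \<subseteq> X \<and> (\<forall>b. sum a {i \<in> X. g i = b} = 0 \<and> card {i \<in> X. g i = b} \<le> 2 * A + 1)"
  using assms
proof (induction "card X" arbitrary: X rule: less_induct)
  case less
  show ?case
  proof (cases "X = {}")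
    case True
    then show ?thesis by auto
  next
    case False
    then obtain Y where Y: "Y \<subseteq> X" "Y \<noteq> {}" "sum a Y = 0" "card Y \<le> 2 * A + 1"
      using small_zero_sum_subset[OF less.prems(1) _ less.prems(2,3)] by blast
    then obtain y where y: "y \<in> Y" by blast
    have fin: "finite Y" using Y(1) less.prems(1) finite_subset by blast
    have "sum a (X - Y) = 0" using Y less.prems by (simp add: sum_diff)
    have "card (X - Y) < card X"
      using Y less.prems(1) by (intro psubset_card_mono) auto
    have "\<forall>i \<in> X - Y. \<bar>a i\<bar> \<le> int A" "finite (X - Y)" using less.prems(1,2) by auto
    from less.hyps[OF \<open>card (X - Y) < card X\<close> this(2,1) \<open>sum a (X - Y) = 0\<close>]
    obtain g where g: "g ` (X - Y) \<subseteq> X - Y"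
      "\<forall>b. sum a {i \<in> X - Y. g i = b} = 0 \<and> card {i \<in> X - Y. g i = b} \<le> 2 * A + 1"
      by (elim exE conjE)
    let ?g = "\<lambda>i. if i \<in> Y then y else g i"
    have y_block: "{i \<in> X. ?g i = y} = Y" using Y(1) y g(1) by auto
    have other_block: "{i \<in> X. ?g i = b} = {i \<in> X - Y. g i = b}" if "b \<noteq> y" for b
      using that by auto
    have "sum a {i \<in> X. ?g i = b} = 0 \<and> card {i \<in> X. ?g i = b} \<le> 2 * A + 1" for b
    proof (cases "b = y")
      case True
      show ?thesis unfolding True y_block using Y by blast
    next
      case False
      show ?thesis unfolding other_block[OF False] using g by blast
    qed
    moreover have "?g ` X \<subseteq> X" using Y(1) y g(1) by auto
    ultimately show ?thesis by blast
  qed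
qed

text \<open>Blocks that vanish in one coordinate have at most \<open>2 * A + 1\<close> members, so
  their sums have entries of size at most \<open>A * (2 * A + 1)\<close> in the other coordinates.
  The factor counts the vectors in a block of blocks; without coordinates, singletons are
  blocks.\<close>

fun block_bound :: "nat \<Rightarrow> nat \<Rightarrow> nat" where
  "block_bound 0 A = 1"
| "block_bound (Suc m) A = (2 * A + 1) * block_bound m (A * (2 * A + 1))"

text \<open>One coordinate after the other: the blocks that are zero in the last coordinate are summed up
  and become the vectors of a system with one coordinate less.\<close>

lemma zero_sum_vector_blocks:
  fixes v :: "nat \<Rightarrow> nat \<Rightarrow> int"
  assumes "finite X" "\<forall>i \<in> X. \<forall>c<m. \<bar>v i c\<bar> \<le> int A" "\<forall>c<m. (\<Sum>i\<in>X. v i c) = 0"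
  shows "\<exists>g. \<forall>b::nat. (\<forall>c<m. (\<Sum>i | i \<in> X \<and> g i = b. v i c) = 0) \<and>
    card {i \<in> X. g i = b} \<le> block_bound m A"
  using assms
proof (induction m arbitrary: X v A)
  case 0
  have "card {i \<in> X. i = b} \<le> 1" for b
    using card_mono[of "{b}" "{i \<in> X. i = b}"] by auto
  then show ?case by (intro exI[of _ "\<lambda>i. i"]) simp
next
  case (Suc m)
  obtain g where g: "g ` X \<subseteq> X"
    "\<And>b. (\<Sum>i | i \<in> X \<and> g i = b. v i m) = 0" "\<And>b. card {i \<in> X. g i = b} \<le> 2 * A + 1"
    using zero_sum_blocks[of X "\<lambda>i. v i m" A] Suc.prems by auto
  let ?w = "\<lambda>b c. \<Sum>i | i \<in> X \<and> g i = b. v i c"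
  have "\<bar>?w b c\<bar> \<le> int (A * (2 * A + 1))" if "c < m" for b c
  proof -
    have "\<bar>?w b c\<bar> \<le> (\<Sum>i | i \<in> X \<and> g i = b. \<bar>v i c\<bar>)" by (rule sum_abs)
    also have "\<dots> \<le> (\<Sum>i | i \<in> X \<and> g i = b. int A)"
      using Suc.prems(2) that by (intro sum_mono) auto
    also have "\<dots> \<le> int (2 * A + 1) * int A"
      using g(3)[of b] by (simp only: sum_constant of_nat_mult[symmetric] of_nat_le_iff mult_le_mono1)
    finally show ?thesis by (simp add: algebra_simps)
  qed
  moreover have total: "(\<Sum>b \<in> B. ?w b c) = (\<Sum>i | i \<in> X \<and> g i \<in> B. v i c)" if "finite B" for B c
  proof -
    have "(\<Sum>b \<in> B. ?w b c) = (\<Sum>b \<in> B. \<Sum>i | i \<in> {i \<in> X. g i \<in> B} \<and> g i = b. v i c)"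
      by (intro sum.cong) auto
    also have "\<dots> = (\<Sum>i | i \<in> X \<and> g i \<in> B. v i c)"
      using that Suc.prems(1) by (intro sum.group) auto
    finally show ?thesis .
  qed
  have "(\<Sum>b \<in> g ` X. ?w b c) = 0" if "c < m" for c
  proof -
    have "{i \<in> X. g i \<in> g ` X} = X" by auto
    then show ?thesis using total[of "g ` X" c] Suc.prems that by simp
  qed
  ultimately obtain h where h:
    "\<And>b c. c < m \<Longrightarrow> (\<Sum>b' | b' \<in> g ` X \<and> h b' = b. ?w b' c) = 0"
    "\<And>b::nat. card {b' \<in> g ` X. h b' = b} \<le> block_bound m (A * (2 * A + 1))"
    using Suc.IH[of "g ` X" ?w "A * (2 * A + 1)"] Suc.prems(1) by blast
  have block: "{i \<in> X. h (g i) = b} = {i \<in> X. g i \<in> {b' \<in> g ` X. h b' = b}}" for b by auto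
  have fin: "finite {b' \<in> g ` X. h b' = b}" for b using Suc.prems(1) by simp
  have "(\<Sum>i | i \<in> X \<and> h (g i) = b. v i c) = 0" if "c < Suc m" for b c
  proof -
    have "(\<Sum>i | i \<in> X \<and> h (g i) = b. v i c) = (\<Sum>b' | b' \<in> g ` X \<and> h b' = b. ?w b' c)"
      using block total[OF fin] by (metis (no_types, lifting) Collect_cong mem_Collect_eq)
    also have "\<dots> = 0" using that h(1) g(2) by (cases "c = m") auto
    finally show ?thesis .
  qed
  moreover have "card {i \<in> X. h (g i) = b} \<le> block_bound (Suc m) A" for b
  proof -
    have "{i \<in> X. h (g i) = b} = (\<Union>b' \<in> {b' \<in> g ` X. h b' = b}. {i \<in> X. g i = b'})" by auto
    then have "card {i \<in> X. h (g i) = b} \<le> (\<Sum>b' | b' \<in> g ` X \<and> h b' = b. card {i \<in> X. g i = b'})"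
      by (simp only: card_UN_le[OF fin])
    also have "\<dots> \<le> card {b' \<in> g ` X. h b' = b} * (2 * A + 1)"
      using sum_bounded_above[of "{b' \<in> g ` X. h b' = b}" _ "2 * A + 1"] g(3) by simp
    also have "\<dots> \<le> block_bound m (A * (2 * A + 1)) * (2 * A + 1)"
      using h(2) by (rule mult_le_mono1)
    finally show ?thesis by (simp add: mult.commute)
  qed
  ultimately show ?case by (intro exI[of _ "\<lambda>i. h (g i)"]) blast
qed

text \<open>An intermediate value argument for integers: lowering the entries one at a time towards
  \<open>- A\<close> reaches every total between the two extremes.\<close>

lemma lower_to_sum:
  fixes a :: "'i \<Rightarrow> int"
  assumes "finite X" "\<forall>i \<in> X. - A \<le> a i" "(\<Sum>i\<in>X. - A) \<le> t" "t \<le> sum a X"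
  shows "\<exists>a'. (\<forall>i \<in> X. - A \<le> a' i \<and> a' i \<le> a i) \<and> sum a' X = t"
  using assms
proof (induction arbitrary: t)
  case empty
  then show ?case by simp
next
  case (insert x X)
  \<comment> \<open>As low as permitted: the value still missing if the other entries keep their
    full sum, but not below \<open>- A\<close>.\<close>
  define u where "u = max (- A) (t - sum a X)"
  have "- A \<le> u" "u \<le> a x" "t - u \<le> sum a X"
    using insert by (auto simp: u_def)
  moreover have "(\<Sum>i\<in>X. - A) \<le> t - u"
  proof -
    have "(\<Sum>i\<in>X. - A) \<le> sum a X" using insert.prems(1) by (intro sum_mono) auto
    then show ?thesis using insert by (auto simp: u_def max_def algebra_simps)
  qed
  ultimately obtain a' where a': "\<forall>i \<in> X. - A \<le> a' i \<and> a' i \<le> a i" "sum a' X = t - u"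
    using insert.IH[of "t - u"] insert.prems(1) by auto
  have "sum (a'(x := u)) X = sum a' X" using insert.hyps(2) by (intro sum.cong) auto
  then show ?case
    using insert.hyps a' \<open>- A \<le> u\<close> \<open>u \<le> a x\<close> by (intro exI[of _ "a'(x := u)"]) auto
qed

text \<open>The given vectors are first lowered so that they sum up to zero.\<close>

lemma small_nonnegative_subset:
  fixes v :: "nat \<Rightarrow> nat \<Rightarrow> int"
  assumes X: "finite X" "\<forall>i \<in> X. \<forall>c<m. \<bar>v i c\<bar> \<le> int A" and b: "\<forall>c<m. \<bar>b c\<bar> \<le> int A"
    and nonneg: "\<forall>c<m. 0 \<le> b c + (\<Sum>i\<in>X. v i c)"
  shows "\<exists>Y \<subseteq> X. card Y \<le> block_bound m A \<and> (\<forall>c<m. 0 \<le> b c + (\<Sum>i\<in>Y. v i c))"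
proof -
  obtain z where z: "z \<notin> X" using X(1) ex_new_if_finite[OF infinite_UNIV_nat] by blast
  \<comment> \<open>The offset becomes one more vector, at the fresh index \<open>z\<close>, so that
    the hypothesis concerns the sum of a single family.\<close>
  let ?X = "insert z X" and ?v = "v(z := b)"
  have sum_v: "(\<Sum>i\<in>Y. ?v i c) = (\<Sum>i\<in>Y. v i c)" if "Y \<subseteq> X" for Y c
    using that z by (intro sum.cong) auto
  have bnd: "\<bar>?v i c\<bar> \<le> int A" if "i \<in> ?X" "c < m" for i c
    using that X(2) b by auto
  have "\<forall>c. \<exists>a'. c < m \<longrightarrow> (\<forall>i \<in> ?X. - int A \<le> a' i \<and> a' i \<le> ?v i c) \<and> sum a' ?X = 0"
  proof
    fix c
    show "\<exists>a'. c < m \<longrightarrow> (\<forall>i \<in> ?X. - int A \<le> a' i \<and> a' i \<le> ?v i c) \<and> sum a' ?X = 0"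
    proof (cases "c < m")
      case True
      then have "0 \<le> (\<Sum>i\<in>?X. ?v i c)" using nonneg X(1) z sum_v[of X c] by simp
      moreover have "\<forall>i \<in> ?X. - int A \<le> ?v i c" using bnd True by (metis abs_le_D2 minus_le_iff)
      ultimately show ?thesis
        using lower_to_sum[of ?X "int A" "\<lambda>i. ?v i c" 0] X(1) by (auto simp: sum_nonpos)
    qed simp
  qed
  then obtain w where w: "\<And>c i. c < m \<Longrightarrow> i \<in> ?X \<Longrightarrow> - int A \<le> w c i \<and> w c i \<le> ?v i c"
    "\<And>c. c < m \<Longrightarrow> sum (w c) ?X = 0" by metis
  have "\<bar>w c i\<bar> \<le> int A" if "i \<in> ?X" "c < m" for i c
    using w(1)[OF that(2,1)] bnd[OF that] by linarith
  then obtain g where g: "\<And>b c. c < m \<Longrightarrow> (\<Sum>i | i \<in> ?X \<and> g i = b. w c i) = 0"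
    "\<And>b::nat. card {i \<in> ?X. g i = b} \<le> block_bound m A"
    using zero_sum_vector_blocks[of ?X m "\<lambda>i c. w c i" A] X(1) w(2) by blast
  \<comment> \<open>The block of \<open>z\<close> is the one that contains the offset. Its lowered
    vectors sum to zero, so the original ones, being at least as large, have a nonnegative
    sum.\<close>
  let ?Y = "{i \<in> X. g i = g z}"
  have ins: "{i \<in> ?X. g i = g z} = insert z ?Y" by auto
  have fin: "finite ?Y" "z \<notin> ?Y" using X(1) z by auto
  have nonneg_Y: "0 \<le> b c + (\<Sum>i\<in>?Y. v i c)" if c: "c < m" for c
  proof -
    have "0 = (\<Sum>i \<in> insert z ?Y. w c i)" using g(1)[OF c, of "g z"] ins by simp
    also have "\<dots> \<le> (\<Sum>i \<in> insert z ?Y. ?v i c)"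
      using w(1)[OF c] by (intro sum_mono) blast
    also have "\<dots> = b c + (\<Sum>i\<in>?Y. v i c)" using fin sum_v[of ?Y c] by simp
    finally show ?thesis .
  qed
  have "card ?Y \<le> card (insert z ?Y)" using fin by (intro card_mono) auto
  also have "\<dots> \<le> block_bound m A" using g(2)[of "g z"] unfolding ins .
  finally have "card ?Y \<le> block_bound m A" .
  with nonneg_Y show ?thesis by (intro exI[of _ ?Y] conjI allI impI) simp_all
qed

section \<open>Small correct configurations\<close>

text \<open>The binding problem for a single interface, with demands \<open>d\<close> and capacities
  \<open>c\<close>. Requirements and capacities of different interfaces do not interact, so bindings
  can be chosen for each interface separately.\<close>

definition serves ::
  "'a set \<Rightarrow> 'a set \<Rightarrow> ('a \<Rightarrow> nat) \<Rightarrow> ('a \<Rightarrow> enat) \<Rightarrow> ('a \<times> 'a) set \<Rightarrow> bool" where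
  "serves Z Q d c R \<longleftrightarrow> R \<subseteq> Z \<times> Q \<and> irrefl R \<and>
     (\<forall>z \<in> Z. d z \<le> card (R `` {z})) \<and> (\<forall>j \<in> Q. enat (card (R\<inverse> `` {j})) \<le> c j)"

lemma card_eq_sum_Image:
  assumes "finite Z" "finite Q" "R \<subseteq> Z \<times> Q"
  shows "card R = (\<Sum>z\<in>Z. card (R `` {z}))" "card R = (\<Sum>j\<in>Q. card (R\<inverse> `` {j}))"
proof -
  have eq: "Sigma Z (\<lambda>z. R `` {z}) = R" "Sigma Q (\<lambda>j. R\<inverse> `` {j}) = R\<inverse>"
    using assms(3) by blast+
  have "finite (R `` {z})" for z
    using assms(3) by (intro finite_subset[OF _ assms(2)]) blast
  then have "card (Sigma Z (\<lambda>z. R `` {z})) = (\<Sum>z\<in>Z. card (R `` {z}))"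
    using assms(1) by (intro card_SigmaI) auto
  then show "card R = (\<Sum>z\<in>Z. card (R `` {z}))" by (simp only: eq)
  have "finite (R\<inverse> `` {j})" for j
    using assms(3) by (intro finite_subset[OF _ assms(1)]) blast
  then have "card (Sigma Q (\<lambda>j. R\<inverse> `` {j})) = (\<Sum>j\<in>Q. card (R\<inverse> `` {j}))"
    using assms(2) by (intro card_SigmaI) auto
  then show "card R = (\<Sum>j\<in>Q. card (R\<inverse> `` {j}))" by (simp only: eq card_inverse)
qed

text \<open>A relation of maximal size that exceeds neither demands nor capacities meets all demands:
  otherwise a provider \<open>j\<close> with spare capacity exists, and with enough providers
  some edge \<open>(i', j')\<close> can be rerouted to \<open>j\<close>, freeing \<open>j'\<close>.\<close>

lemma serves_if_many_providers:
  fixes c :: "'a \<Rightarrow> nat"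
  assumes Z: "finite Z" "Q \<subseteq> Z" and d: "\<forall>z \<in> Z. d z \<le> A" and c: "\<forall>j \<in> Q. 1 \<le> c j \<and> c j \<le> A"
    and Q: "A * A + A < card Q" and le: "sum d Z \<le> sum c Q"
  shows "\<exists>R. serves Z Q d (\<lambda>j. enat (c j)) R"
proof -
  define ok where "ok R \<longleftrightarrow> R \<subseteq> Z \<times> Q \<and> irrefl R \<and>
    (\<forall>z \<in> Z. card (R `` {z}) \<le> d z) \<and> (\<forall>j \<in> Q. card (R\<inverse> `` {j}) \<le> c j)" for R
  have fQ: "finite Q" using Z finite_subset by blast
  have "ok {}" by (simp add: ok_def irrefl_def)
  moreover have "card R \<le> card (Z \<times> Q)" if "ok R" for R
    using that Z(1) fQ by (intro card_mono) (auto simp: ok_def)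
  ultimately have "\<exists>R. ok R \<and> (\<forall>R'. ok R' \<longrightarrow> card R' \<le> card R)"
    by (intro ex_has_greatest_nat[of ok "{}" card "Suc (card (Z \<times> Q))"]) (auto simp: less_Suc_eq_le)
  then obtain R where R: "ok R" and max: "\<And>R'. ok R' \<Longrightarrow> card R' \<le> card R"
    by metis
  have sub: "R \<subseteq> Z \<times> Q" and irr: "irrefl R"
    and deg: "\<And>z. z \<in> Z \<Longrightarrow> card (R `` {z}) \<le> d z" "\<And>j. j \<in> Q \<Longrightarrow> card (R\<inverse> `` {j}) \<le> c j"
    using R by (auto simp: ok_def)
  have fR: "finite R" using sub Z(1) fQ finite_subset by blast
  have fI: "finite (S `` {z})" "finite (S\<inverse> `` {z})" if "finite S" for S :: "('a \<times> 'a) set" and z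
    using that by (auto intro: finite_Image)
  have "d z \<le> card (R `` {z})" if "z \<in> Z" for z
  proof (rule ccontr)
    assume "\<not> d z \<le> card (R `` {z})"
    then have less: "card (R `` {z}) < d z" by simp
    have "card R < sum d Z"
      unfolding card_eq_sum_Image(1)[OF Z(1) fQ sub]
      using Z(1) deg(1) less \<open>z \<in> Z\<close> by (intro sum_strict_mono_ex1) auto
    then have "(\<Sum>j\<in>Q. card (R\<inverse> `` {j})) < sum c Q"
      using le card_eq_sum_Image(2)[OF Z(1) fQ sub] by linarith
    then obtain j where j: "j \<in> Q" "card (R\<inverse> `` {j}) < c j"
      by (meson leD leI sum_mono)
    \<comment> \<open>Otherwise the edge \<open>(z, j')\<close> could be added, against
      maximality.\<close>
    have spare: "j' = z \<or> (z, j') \<in> R" if j': "j' \<in> Q" "card (R\<inverse> `` {j'}) < c j'" for j'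
    proof (rule ccontr)
      assume n: "\<not> (j' = z \<or> (z, j') \<in> R)"
      let ?R = "insert (z, j') R"
      have "?R `` {x} = (if x = z then insert j' (R `` {z}) else R `` {x})"
        "?R\<inverse> `` {x} = (if x = j' then insert z (R\<inverse> `` {j'}) else R\<inverse> `` {x})" for x by auto
      then have "ok ?R"
        using n j' sub irr deg less \<open>z \<in> Z\<close> fI[OF fR]
        by (auto simp: ok_def irrefl_def)
      then have "card ?R \<le> card R" by (rule max)
      then show False using n fR by simp
    qed
    have jz: "j = z \<or> (z, j) \<in> R" using spare j by blast
    \<comment> \<open>\<open>?Q\<close> holds the providers that \<open>z\<close> can still use,
      \<open>?bad\<close> the instances that cannot be rerouted to \<open>j\<close>. At most
      \<open>A\<close> providers are missing from \<open>?Q\<close>, and at most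
      \<open>A * A\<close> are used by members of \<open>?bad\<close>; this is the origin of
      \<open>A * A + A\<close>.\<close>
    let ?Q = "Q - ({z} \<union> R `` {z})" and ?bad = "{j} \<union> R\<inverse> `` {j}"
    have "card ({z} \<union> R `` {z}) \<le> 1 + card (R `` {z})" using card_Un_le[of "{z}" "R `` {z}"] by simp
    also have "\<dots> \<le> A" using less d \<open>z \<in> Z\<close> by fastforce
    finally have "A * A < card ?Q"
      using Q diff_card_le_card_Diff[of "{z} \<union> R `` {z}" Q] fI[OF fR] by fastforce
    have "card ?bad \<le> 1 + card (R\<inverse> `` {j})" using card_Un_le[of "{j}" "R\<inverse> `` {j}"] by simp
    also have "\<dots> \<le> A" using j c by fastforce
    finally have bad: "card ?bad \<le> A" .
    have bad_sub: "?bad \<subseteq> Z" using j(1) Z(2) sub by blast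
    have "card (\<Union>i \<in> ?bad. R `` {i}) \<le> (\<Sum>i\<in>?bad. card (R `` {i}))"
      using fI[OF fR] by (intro card_UN_le) auto
    also have "\<dots> \<le> card ?bad * A"
    proof -
      have "card (R `` {i}) \<le> A" if "i \<in> ?bad" for i
      proof -
        have "i \<in> Z" using that bad_sub by blast
        with deg(1)[of i] d show ?thesis by fastforce
      qed
      then show ?thesis using sum_bounded_above[of ?bad "\<lambda>i. card (R `` {i})" A] by simp
    qed
    also have "\<dots> \<le> A * A" using bad by (rule mult_le_mono1)
    finally have "card (\<Union>i \<in> ?bad. R `` {i}) < card ?Q" using \<open>A * A < card ?Q\<close> by linarith
    moreover have "finite (\<Union>i \<in> ?bad. R `` {i})" using fI[OF fR] by auto
    ultimately obtain j' where j': "j' \<in> ?Q" "j' \<notin> (\<Union>i \<in> ?bad. R `` {i})"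
      by (meson card_mono leD subsetI)
    then have "card (R\<inverse> `` {j'}) = c j'" using spare[of j'] deg(2)[of j'] by force
    then have "R\<inverse> `` {j'} \<noteq> {}" using c j'(1) by force
    then obtain i where i: "(i, j') \<in> R" "i \<noteq> j" "(i, j) \<notin> R" using j'(2) by blast
    \<comment> \<open>\<open>i\<close> moves from \<open>j'\<close> to \<open>j\<close>, and its
      place at \<open>j'\<close> goes to \<open>z\<close>: one more edge, within all bounds.\<close>
    let ?R = "insert (i, j) (insert (z, j') (R - {(i, j')}))"
    have ne: "i \<noteq> z" "j \<noteq> j'" "j' \<noteq> z" "(z, j') \<notin> R" using i j' jz by auto
    have iZ: "i \<in> Z" using i(1) sub by blast
    have "?R `` {x} = (if x = i then insert j (R `` {i} - {j'}) else if x = z then insert j' (R `` {z})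
        else R `` {x})" for x
      using ne by auto
    moreover have "?R\<inverse> `` {x} = (if x = j then insert i (R\<inverse> `` {j})
        else if x = j' then insert z (R\<inverse> `` {j'} - {i}) else R\<inverse> `` {x})" for x
      using ne by auto
    moreover have "card (insert j (R `` {i} - {j'})) \<le> d i"
    proof -
      have "Suc (card (R `` {i} - {j'})) = card (R `` {i})"
        using i(1) fI(1)[OF fR] by (intro card_Suc_Diff1) auto
      then show ?thesis
        using deg(1)[OF iZ] card_Un_le[of "{j}" "R `` {i} - {j'}"] by simp
    qed
    moreover have "card (insert z (R\<inverse> `` {j'} - {i})) \<le> c j'"
    proof -
      have "Suc (card (R\<inverse> `` {j'} - {i})) = card (R\<inverse> `` {j'})"
        using i(1) fI(2)[OF fR] by (intro card_Suc_Diff1) auto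
      then show ?thesis
        using deg(2)[of j'] j'(1) card_Un_le[of "{z}" "R\<inverse> `` {j'} - {i}"]
        by simp
    qed
    ultimately have "ok ?R"
      using sub irr deg less \<open>z \<in> Z\<close> fI[OF fR] iZ j j'(1) i ne
      by (auto simp: ok_def irrefl_def card_insert_if)
    then have "card ?R \<le> card R" by (rule max)
    moreover have "card ?R = Suc (card R)"
    proof -
      have "Suc (card (R - {(i, j')})) = card R" using i(1) fR by (intro card_Suc_Diff1) auto
      then show ?thesis using i ne fR by (simp add: card_insert_if)
    qed
    ultimately show False by simp
  qed
  then show ?thesis using sub irr deg(2) unfolding serves_def by (intro exI[of _ R]) auto
qed

text \<open>Finite capacity minus residual demand of one instance. Infinite providers are counted in
  all of \<open>Q\<close>, not among the instances kept, so that each instance contributes a fixed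
  number and sums over different subsets can be compared.\<close>

definition surplus :: "'a set \<Rightarrow> ('a \<Rightarrow> nat) \<Rightarrow> ('a \<Rightarrow> enat) \<Rightarrow> 'a \<Rightarrow> int" where
  "surplus Q d c z = (if z \<in> Q \<and> c z \<noteq> \<infinity> then int (the_enat (c z)) else 0)
     - int (d z - card ({j \<in> Q. c j = \<infinity>} - {z}))"

text \<open>Providers of infinite capacity are used by everyone; the surplus accounts for what remains to
  be served by the others.\<close>

lemma sum_surplus:
  assumes "finite Z"
  shows "(\<Sum>z\<in>Z. surplus Q d c z) = int (\<Sum>j | j \<in> Q \<inter> Z \<and> c j \<noteq> \<infinity>. the_enat (c j))
    - int (\<Sum>z\<in>Z. d z - card ({j \<in> Q. c j = \<infinity>} - {z}))"
proof -
  have "(\<Sum>z\<in>Z. if z \<in> Q \<and> c z \<noteq> \<infinity> then int (the_enat (c z)) else 0)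
      = (\<Sum>j | j \<in> Q \<inter> Z \<and> c j \<noteq> \<infinity>. int (the_enat (c j)))"
    using assms by (intro sum.mono_neutral_cong_right) auto
  then show ?thesis by (simp add: surplus_def sum_subtractf)
qed

text \<open>Double counting of the edges to providers of finite capacity: their number is at least
  the total residual demand and at most the total finite capacity.\<close>

lemma sum_surplus_nonneg:
  assumes Z: "finite Z" "Q \<subseteq> Z" and R: "serves Z Q d c R"
  shows "0 \<le> (\<Sum>z\<in>Z. surplus Q d c z)"
proof -
  let ?Qi = "{j \<in> Q. c j = \<infinity>}" and ?Qf = "{j \<in> Q. c j \<noteq> \<infinity>}"
  let ?R = "R \<inter> Z \<times> ?Qf"
  have fQ: "finite Q" using Z finite_subset by blast
  have fR: "finite R" using R Z(1) fQ by (auto simp: serves_def intro: finite_subset[of _ "Z \<times> Q"])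
  have "d z - card (?Qi - {z}) \<le> card (?R `` {z})" if "z \<in> Z" for z
  proof -
    have "R `` {z} \<subseteq> ?R `` {z} \<union> (?Qi - {z})"
      using R that by (auto simp: serves_def irrefl_def)
    then have "card (R `` {z}) \<le> card (?R `` {z} \<union> (?Qi - {z}))"
      using fR fQ by (intro card_mono) auto
    also have "\<dots> \<le> card (?R `` {z}) + card (?Qi - {z})" by (rule card_Un_le)
    finally show ?thesis using R that by (fastforce simp: serves_def)
  qed
  then have "(\<Sum>z\<in>Z. d z - card (?Qi - {z})) \<le> (\<Sum>z\<in>Z. card (?R `` {z}))" by (rule sum_mono)
  also have "\<dots> = card ?R"
    using Z(1) fQ by (intro card_eq_sum_Image(1)[where Q = ?Qf, symmetric]) auto
  also have "\<dots> = (\<Sum>j\<in>?Qf. card (?R\<inverse> `` {j}))"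
    using Z(1) fQ by (intro card_eq_sum_Image(2)[where Z = Z]) auto
  also have "\<dots> \<le> (\<Sum>j\<in>?Qf. the_enat (c j))"
  proof (rule sum_mono)
    fix j
    assume j: "j \<in> ?Qf"
    then obtain n where n: "c j = enat n" by auto
    have "card (?R\<inverse> `` {j}) \<le> card (R\<inverse> `` {j})"
      using fR by (intro card_mono) auto
    moreover have "card (R\<inverse> `` {j}) \<le> n"
      using R j n by (auto simp: serves_def)
    ultimately show "card (?R\<inverse> `` {j}) \<le> the_enat (c j)" using n by simp
  qed
  also have "?Qf = {j \<in> Q \<inter> Z. c j \<noteq> \<infinity>}" using Z(2) by auto
  finally show ?thesis using sum_surplus[OF Z(1), of Q d c] by linarith
qed

text \<open>More than \<open>A\<close> infinite providers can serve everyone, even though no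
  instance serves itself. If all providers are kept, the old relation is restricted. In the
  remaining case all infinite providers are kept, so \<open>surplus\<close> is still accurate, and
  the finite ones are numerous enough for \<open>serves_if_many_providers\<close>.\<close>

lemma serves_subset:
  assumes Z: "finite Z" "Q \<subseteq> Z" and R: "serves Z Q d c R"
    and d: "\<forall>z \<in> Z. d z \<le> A" and c: "\<forall>j \<in> Q. c j \<noteq> 0 \<and> (c j = \<infinity> \<or> c j \<le> enat A)"
    and Z': "Z' \<subseteq> Z"
    and inf: "{j \<in> Q. c j = \<infinity>} \<subseteq> Z' \<or> A < card ({j \<in> Q. c j = \<infinity>} \<inter> Z')"
    and fin: "{j \<in> Q. c j \<noteq> \<infinity>} \<subseteq> Z' \<or> A * A + A < card ({j \<in> Q. c j \<noteq> \<infinity>} \<inter> Z')"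
    and sur: "0 \<le> (\<Sum>z\<in>Z'. surplus Q d c z)"
  shows "\<exists>R'. serves Z' (Q \<inter> Z') d c R'"
proof -
  let ?Qi = "{j \<in> Q. c j = \<infinity>}" and ?Qf = "{j \<in> Q. c j \<noteq> \<infinity>}"
  have fQ: "finite Q" and fZ': "finite Z'" using Z Z' finite_subset by blast+
  have fR: "finite R" using R Z(1) fQ by (auto simp: serves_def intro: finite_subset[of _ "Z \<times> Q"])
  consider "A < card (?Qi \<inter> Z')" | "?Qi \<subseteq> Z'" "?Qf \<subseteq> Z'"
    | "?Qi \<subseteq> Z'" "A * A + A < card (?Qf \<inter> Z')"
    using inf fin by blast
  then show ?thesis
  proof cases
    case 1
    let ?R = "{(z, j). z \<in> Z' \<and> j \<in> ?Qi \<inter> Z' \<and> z \<noteq> j}"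
    have "d z \<le> card (?R `` {z})" if z: "z \<in> Z'" for z
    proof -
      have "?R `` {z} = ?Qi \<inter> Z' - {z}" using z by auto
      moreover have "card (?Qi \<inter> Z') - 1 \<le> card (?Qi \<inter> Z' - {z})"
        using diff_card_le_card_Diff[of "{z}" "?Qi \<inter> Z'"] by simp
      moreover have "d z \<le> A" using d z Z' by blast
      ultimately show ?thesis using 1 by simp
    qed
    moreover have "enat (card (?R\<inverse> `` {j})) \<le> c j" if "j \<in> Q" for j
    proof (cases "c j = \<infinity>")
      case False
      then have "?R\<inverse> `` {j} = {}" by auto
      then show ?thesis by (simp add: zero_enat_def[symmetric])
    qed simp
    ultimately show ?thesis
      by (intro exI[of _ ?R]) (auto simp: serves_def irrefl_def)
  next
    case 2
    let ?R = "R \<inter> Z' \<times> Z'"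
    have Q: "Q \<subseteq> Z'" using 2 by blast
    have "?R `` {z} = R `` {z}" if "z \<in> Z'" for z
      using R Q that by (auto simp: serves_def)
    moreover have "card (?R\<inverse> `` {j}) \<le> card (R\<inverse> `` {j})" for j
      using fR by (intro card_mono) auto
    then have "enat (card (?R\<inverse> `` {j})) \<le> c j" if "j \<in> Q" for j
      using R that by (meson enat_ord_simps(1) order_trans serves_def)
    ultimately show ?thesis
      using R Z' by (intro exI[of _ ?R]) (auto simp: serves_def irrefl_def)
  next
    case 3
    let ?d = "\<lambda>z. d z - card (?Qi - {z})"
    have "\<exists>R. serves Z' (?Qf \<inter> Z') ?d (\<lambda>j. enat (the_enat (c j))) R"
    proof (rule serves_if_many_providers)
      show "\<forall>z \<in> Z'. ?d z \<le> A" using d Z' by fastforce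
      show "\<forall>j \<in> ?Qf \<inter> Z'. 1 \<le> the_enat (c j) \<and> the_enat (c j) \<le> A"
      proof
        fix j
        assume "j \<in> ?Qf \<inter> Z'"
        with c obtain n where "c j = enat n" "n \<noteq> 0" "n \<le> A"
          by (cases "c j") (auto simp: zero_enat_def)
        then show "1 \<le> the_enat (c j) \<and> the_enat (c j) \<le> A" by simp
      qed
      have eq: "{j \<in> Q \<inter> Z'. c j \<noteq> \<infinity>} = ?Qf \<inter> Z'" by auto
      have "int (sum ?d Z') \<le> int (\<Sum>j | j \<in> Q \<inter> Z' \<and> c j \<noteq> \<infinity>. the_enat (c j))"
        using sur sum_surplus[OF fZ', of Q d c] by linarith
      then show "sum ?d Z' \<le> (\<Sum>j \<in> ?Qf \<inter> Z'. the_enat (c j))"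
        by (simp only: of_nat_le_iff eq)
    qed (use 3 fZ' in auto)
    then obtain R0 where R0: "serves Z' (?Qf \<inter> Z') ?d (\<lambda>j. enat (the_enat (c j))) R0" by blast
    then have sub: "R0 \<subseteq> Z' \<times> ?Qf" by (auto simp: serves_def)
    let ?R = "R0 \<union> {(z, j). z \<in> Z' \<and> j \<in> ?Qi \<and> z \<noteq> j}"
    have "d z \<le> card (?R `` {z})" if z: "z \<in> Z'" for z
    proof -
      have "?R `` {z} = R0 `` {z} \<union> (?Qi - {z})" using z by auto
      moreover have "R0 `` {z} \<inter> (?Qi - {z}) = {}" using sub by auto
      moreover have "finite (R0 `` {z})"
        using sub by (intro finite_subset[OF _ fQ]) blast
      ultimately have "card (?R `` {z}) = card (R0 `` {z}) + card (?Qi - {z})"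
        using fQ by (simp add: card_Un_disjoint)
      moreover have "?d z \<le> card (R0 `` {z})" using R0 z by (simp add: serves_def)
      ultimately show ?thesis by linarith
    qed
    moreover have "enat (card (?R\<inverse> `` {j})) \<le> c j" if "j \<in> Q \<inter> Z'" for j
    proof (cases "c j")
      case (enat n)
      then have "?R\<inverse> `` {j} = R0\<inverse> `` {j}" by auto
      moreover have "enat (card (R0\<inverse> `` {j})) \<le> enat (the_enat (c j))"
      proof -
        have "j \<in> ?Qf \<inter> Z'" using that enat by simp
        with R0 show ?thesis unfolding serves_def by blast
      qed
      ultimately show ?thesis using enat by simp
    qed simp
    ultimately show ?thesis
      using R0 3(1) by (intro exI[of _ ?R]) (auto simp: serves_def irrefl_def)
  qed
qed

section \<open>Correctness in terms of numbers of bindings\<close>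

lemma enough_providers_iff:
  assumes C: "configuration C"
  shows "enough_providers C z p n \<longleftrightarrow> n \<le> card {z'. (p, z, z') \<in> bindings C}"
proof
  have fin: "finite {z'. (p, z, z') \<in> bindings C}"
    using C configuration_bindingD(2)[OF C]
    by (auto simp: configuration_def intro: finite_subset[of _ "insts C"])
  assume "enough_providers C z p n"
  then show "n \<le> card {z'. (p, z, z') \<in> bindings C}"
    unfolding enough_providers_def using fin by (metis (no_types, lifting) card_mono mem_Collect_eq subsetI)
next
  assume "n \<le> card {z'. (p, z, z') \<in> bindings C}"
  then obtain S where "S \<subseteq> {z'. (p, z, z') \<in> bindings C}" "card S = n" "finite S"
    by (rule obtain_subset_with_card_n)
  then show "enough_providers C z p n"
    unfolding enough_providers_def using configuration_bindingD(2,3,5)[OF C]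
    by (intro exI[of _ S]) blast
qed

lemma within_capacity_iff:
  assumes C: "configuration C"
  shows "within_capacity C z p n \<longleftrightarrow> enat (card {z'. (p, z', z) \<in> bindings C}) \<le> n"
proof -
  let ?S = "{z'. (p, z', z) \<in> bindings C}"
  have fin: "finite ?S"
    using C configuration_bindingD(1)[OF C]
    by (auto simp: configuration_def intro: finite_subset[of _ "insts C"])
  have "\<not> within_capacity C z p n \<longleftrightarrow> n < enat (card ?S)"
  proof
    assume "\<not> within_capacity C z p n"
    then obtain S where "n < enat (card S)" "S \<subseteq> ?S" by (auto simp: within_capacity_def)
    then show "n < enat (card ?S)"
      using card_mono[OF fin] by (meson enat_ord_simps(1) less_le_trans)
  next
    assume "n < enat (card ?S)"
    moreover have "?S \<subseteq> insts C - {z}" "\<forall>z' \<in> ?S. p \<in> req_dom (mtyp_of C z')"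
      using configuration_bindingD(1,3,4)[OF C] by blast+
    ultimately show "\<not> within_capacity C z p n"
      unfolding within_capacity_def not_not using fin by (intro exI[of _ ?S]) simp
  qed
  then show ?thesis by auto
qed

definition demand :: "('r::finite) mtype \<Rightarrow> iface \<Rightarrow> nat" where
  "demand T p = (case req_s T p of Some n \<Rightarrow> n | None \<Rightarrow>
     (case req_w T p of Some n \<Rightarrow> n | None \<Rightarrow> 0))"

lemma demand_eq:
  assumes "T \<in> mtypes"
  shows "req_s T p = Some n \<Longrightarrow> demand T p = n" "req_w T p = Some n \<Longrightarrow> demand T p = n"
proof -
  show "req_s T p = Some n \<Longrightarrow> demand T p = n" by (simp add: demand_def)
  assume "req_w T p = Some n"
  moreover from this have "req_s T p = None" using assms by (auto simp: mtypes_def)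
  ultimately show "demand T p = n" by (simp add: demand_def)
qed

lemma demand_pos_dom: "0 < demand T p \<Longrightarrow> p \<in> req_dom T"
  by (auto simp: demand_def split: option.splits)

definition providers :: "('r::finite) config \<Rightarrow> iface \<Rightarrow> inst set" where
  "providers C p = {z \<in> insts C. p \<in> dom (prov (mtyp_of C z))}"

text \<open>A weakening of \<open>configuration\<close> that makes lookups succeed and, for given
  \<open>U\<close> and \<open>Os\<close>, can be recognised from the mere shape of a code.\<close>

definition preconfiguration :: "('r::finite) config \<Rightarrow> bool" where
  "preconfiguration C \<longleftrightarrow> finite (insts C) \<and> dom (mtyp C) = insts C \<and> ran (mtyp C) \<subseteq> mtypes \<and>
     dom (host C) = insts C \<and> finite (bindings C)"

lemma preconfiguration_mtypes:
  assumes "preconfiguration C" "z \<in> insts C"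
  shows "mtyp_of C z \<in> mtypes"
proof -
  have "z \<in> dom (mtyp C)" using assms by (simp add: preconfiguration_def)
  then have "mtyp_of C z \<in> ran (mtyp C)" by (auto simp: ran_def)
  then show ?thesis using assms by (auto simp: preconfiguration_def)
qed

lemma configuration_preconfiguration: "configuration C \<Longrightarrow> preconfiguration C"
  by (simp add: preconfiguration_def configuration_def)

lemma correct_serves:
  assumes C: "correct C"
  shows "serves (insts C) (providers C p) (\<lambda>z. demand (mtyp_of C z) p)
    (\<lambda>z. the (prov (mtyp_of C z) p)) {(z, z'). (p, z, z') \<in> bindings C}"
proof -
  have conf: "configuration C" using C by (simp add: correct_def provisionally_correct_def)
  note b = configuration_bindingD[OF conf]
  have "demand (mtyp_of C z) p \<le> card {z'. (p, z, z') \<in> bindings C}" if z: "z \<in> insts C" for z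
  proof (cases "demand (mtyp_of C z) p = 0")
    case False
    then obtain n where "req_s (mtyp_of C z) p = Some n \<or> req_w (mtyp_of C z) p = Some n"
      using demand_pos_dom[of "mtyp_of C z" p] by auto
    moreover from this have "demand (mtyp_of C z) p = n"
      using demand_eq[OF preconfiguration_mtypes[OF configuration_preconfiguration[OF conf] z]] by blast
    moreover from calculation(1) have "enough_providers C z p n"
      using C z by (auto simp: correct_def provisionally_correct_def)
    ultimately show ?thesis using enough_providers_iff[OF conf] by simp
  qed simp
  moreover have "enat (card {z'. (p, z', z) \<in> bindings C}) \<le> the (prov (mtyp_of C z) p)"
    if "z \<in> providers C p" for z
  proof -
    have "within_capacity C z p (the (prov (mtyp_of C z) p))"
      using that C by (auto simp: providers_def correct_def provisionally_correct_def)
    then show ?thesis using within_capacity_iff[OF conf] by simp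
  qed
  moreover have "{(z, z'). (p, z, z') \<in> bindings C} \<subseteq> insts C \<times> providers C p"
    unfolding providers_def using b(1,2,5) by blast
  moreover have "irrefl {(z, z'). (p, z, z') \<in> bindings C}"
    using b(3) by (auto simp: irrefl_def)
  moreover have "{(z, z'). (p, z, z') \<in> bindings C} `` {z} = {z'. (p, z, z') \<in> bindings C}"
    "{(z, z'). (p, z, z') \<in> bindings C}\<inverse> `` {z} = {z'. (p, z', z) \<in> bindings C}" for z by auto
  ultimately show ?thesis by (simp add: serves_def)
qed

text \<open>Conflicts, resources and cost cannot get worse on a subset, so just the bindings are
  chosen anew. Renaming to \<open>{..<N}\<close> keeps the codes bounded. The condition on
  \<open>demand\<close> discards edges of \<open>R p\<close> from instances that do not require
  \<open>p\<close>, as may occur with providers of infinite capacity.\<close>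

lemma ex_correct_config_on_subset:
  assumes C: "correct C" and Z': "Z' \<subseteq> insts C" and h: "bij_betw h {..<N} Z'"
    and R: "\<And>p. p < n \<Longrightarrow> serves Z' (providers C p \<inter> Z') (\<lambda>z. demand (mtyp_of C z) p)
      (\<lambda>z. the (prov (mtyp_of C z) p)) (R p)"
    and n: "\<And>z p. z \<in> Z' \<Longrightarrow> n \<le> p \<Longrightarrow> demand (mtyp_of C z) p = 0"
  defines "D \<equiv> \<lparr>insts = {..<N},
     mtyp = (\<lambda>i. if i < N then mtyp C (h i) else None),
     host = (\<lambda>i. if i < N then host C (h i) else None),
     bindings = {(p, i, j). p < n \<and> i < N \<and> j < N \<and> (h i, h j) \<in> R p \<and>
       0 < demand (mtyp_of C (h i)) p}\<rparr>"
  shows "correct D" and "total_cost D \<le> total_cost C"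
proof -
  have conf: "configuration C" and pc: "provisionally_correct C"
    using C by (auto simp: correct_def provisionally_correct_def)
  have D: "insts D = {..<N}" "\<And>i. i < N \<Longrightarrow> mtyp D i = mtyp C (h i)"
    "\<And>i. i < N \<Longrightarrow> host D i = host C (h i)"
    "bindings D = {(p, i, j). p < n \<and> i < N \<and> j < N \<and> (h i, h j) \<in> R p \<and>
       0 < demand (mtyp_of C (h i)) p}"
    by (auto simp: D_def)
  have hZ: "h i \<in> Z'" "h i \<in> insts C" if "i < N" for i
    using h Z' that by (auto simp: bij_betw_def)
  have inj: "inj_on h {..<N}" and img: "h ` {..<N} = Z'" using h by (auto simp: bij_betw_def)
  have finC: "finite (insts C)" using conf by (simp add: configuration_def)
  have dom: "mtyp C (h i) \<noteq> None" "host C (h i) \<noteq> None" if "i < N" for i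
    using hZ(2)[OF that] conf by (auto simp: configuration_def set_eq_iff domIff)
  have ranD: "ran (mtyp D) \<subseteq> ran (mtyp C)" "ran (host D) \<subseteq> ran (host C)"
    by (auto simp: D_def ran_def split: if_splits)
  have confD: "configuration D"
    unfolding configuration_def
  proof (intro conjI)
    show "dom (mtyp D) = insts D" "dom (host D) = insts D"
      using dom by (auto simp: D_def domIff split: if_splits)
    show "ran (mtyp D) \<subseteq> mtypes" using ranD(1) conf by (auto simp: configuration_def)
    show "finite (bindings D)"
      unfolding D by (rule finite_subset[of _ "{..<n} \<times> {..<N} \<times> {..<N}"]) auto
    show "\<forall>(p, i, j) \<in> bindings D. i \<in> insts D \<and> j \<in> insts D \<and> i \<noteq> j \<and>
        p \<in> req_dom (mtyp_of D i) \<inter> dom (prov (mtyp_of D j))"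
    proof clarify
      fix p i j
      assume "(p, i, j) \<in> bindings D"
      then have b: "p < n" "i < N" "j < N" "(h i, h j) \<in> R p" "0 < demand (mtyp_of C (h i)) p"
        by (auto simp: D)
      have "h j \<in> providers C p" "h i \<noteq> h j"
        using R[OF b(1)] b(4) unfolding serves_def irrefl_def by (blast, metis)
      then have "i \<noteq> j" "p \<in> dom (prov (mtyp_of C (h j)))" by (auto simp: providers_def)
      then show "i \<in> insts D \<and> j \<in> insts D \<and> i \<noteq> j \<and>
          p \<in> req_dom (mtyp_of D i) \<inter> dom (prov (mtyp_of D j))"
        using b(2,3) demand_pos_dom[OF b(5)] by (auto simp: D)
    qed
  qed (simp add: D)
  have prov_card: "card {j. (p, i, j) \<in> bindings D} = card (R p `` {h i})"
    if "p < n" "i < N" "0 < demand (mtyp_of C (h i)) p" for p i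
  proof -
    have sub: "R p `` {h i} \<subseteq> h ` {..<N}"
      using R[OF that(1)] unfolding serves_def img by blast
    have "h ` {j. (p, i, j) \<in> bindings D} = R p `` {h i}"
    proof
      show "R p `` {h i} \<subseteq> h ` {j. (p, i, j) \<in> bindings D}"
        using sub that by (auto simp: D)
    qed (auto simp: D)
    moreover have "inj_on h {j. (p, i, j) \<in> bindings D}"
      using inj by (auto simp: D inj_on_def)
    ultimately show ?thesis by (metis card_image)
  qed
  have enough: "enough_providers D i p (demand (mtyp_of C (h i)) p)" if "i < N" for i p
  proof (cases "demand (mtyp_of C (h i)) p = 0")
    case False
    then have "p < n" using n[OF hZ(1)[OF that], of p] by (meson not_le)
    moreover have "demand (mtyp_of C (h i)) p \<le> card (R p `` {h i})"
      using R[OF \<open>p < n\<close>] hZ(1)[OF that] unfolding serves_def by blast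
    ultimately show ?thesis
      using prov_card[of p i] that False by (simp add: enough_providers_iff[OF confD])
  qed (simp add: enough_providers_iff[OF confD])
  have capacity: "within_capacity D i p c" if "i < N" "prov (mtyp_of C (h i)) p = Some c" for i p c
  proof (cases "p < n")
    case False
    then have "{j. (p, j, i) \<in> bindings D} = {}" by (simp add: D)
    then show ?thesis by (simp add: within_capacity_iff[OF confD] zero_enat_def[symmetric])
  next
    case True
    have finR: "finite ((R p)\<inverse> `` {h i})"
      using R[OF True] by (intro finite_subset[OF _ finC]) (use Z' in \<open>auto simp: serves_def\<close>)
    have "card {j. (p, j, i) \<in> bindings D} = card (h ` {j. (p, j, i) \<in> bindings D})"
      using inj by (intro card_image[symmetric]) (auto simp: D inj_on_def)
    also have "\<dots> \<le> card ((R p)\<inverse> `` {h i})"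
      using finR by (intro card_mono) (auto simp: D)
    also have "enat \<dots> \<le> c"
    proof -
      have "h i \<in> providers C p \<inter> Z'" using that hZ[OF that(1)] by (auto simp: providers_def)
      then have "enat (card ((R p)\<inverse> `` {h i})) \<le> the (prov (mtyp_of C (h i)) p)"
        using R[OF True] unfolding serves_def by blast
      then show ?thesis using that by simp
    qed
    finally show ?thesis by (simp add: within_capacity_iff[OF confD])
  qed
  show "correct D"
    unfolding correct_def provisionally_correct_def
  proof (intro conjI ballI allI impI confD)
    fix o' r
    assume "o' \<in> ran (host D)"
    then have "(\<Sum>z | z \<in> insts C \<and> host C z = Some o'. res (mtyp_of C z) r) \<le> avail o' r"
      using pc ranD(2) by (auto simp: provisionally_correct_def)
    moreover have "(\<Sum>i | i \<in> insts D \<and> host D i = Some o'. res (mtyp_of D i) r)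
        = (\<Sum>i | i < N \<and> host C (h i) = Some o'. res (mtyp_of C (h i)) r)"
      by (rule sum.cong) (auto simp: D)
    moreover have "\<dots> = (\<Sum>z \<in> h ` {i. i < N \<and> host C (h i) = Some o'}. res (mtyp_of C z) r)"
      using inj by (subst sum.reindex) (auto simp: inj_on_def)
    moreover have "\<dots> \<le> (\<Sum>z | z \<in> insts C \<and> host C z = Some o'. res (mtyp_of C z) r)"
      using finC hZ(2) by (intro sum_mono2) auto
    ultimately show "(\<Sum>i | i \<in> insts D \<and> host D i = Some o'. res (mtyp_of D i) r) \<le> avail o' r"
      by linarith
  next
    fix i p k
    assume i: "i \<in> insts D"
    then have T: "mtyp_of C (h i) \<in> mtypes" using preconfiguration_mtypes[OF configuration_preconfiguration[OF conf]] hZ(2) by (simp add: D)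
    {
      assume "req_s (mtyp_of D i) p = Some k"
      then show "enough_providers D i p k"
        using enough[of i p] demand_eq(1)[OF T] i by (auto simp: D)
    next
      assume "req_w (mtyp_of D i) p = Some k"
      then show "enough_providers D i p k"
        using enough[of i p] demand_eq(2)[OF T] i by (auto simp: D)
    }
  next
    fix i p c
    assume "i \<in> insts D" "prov (mtyp_of D i) p = Some c"
    then show "within_capacity D i p c" using capacity by (simp add: D)
  next
    fix i p j
    assume ij: "i \<in> insts D" "p \<in> conf (mtyp_of D i)" "j \<in> insts D - {i}"
    then have "h j \<in> insts C - {h i}" using hZ(2) inj by (auto simp: D inj_on_def)
    moreover have "p \<in> conf (mtyp_of C (h i))" "h i \<in> insts C" using ij(1,2) hZ(2) by (auto simp: D)
    ultimately have "p \<notin> dom (prov (mtyp_of C (h j)))"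
      using C unfolding correct_def by blast
    then show "p \<notin> dom (prov (mtyp_of D j))" using ij(3) by (simp add: D)
  qed
  have "finite (dom (host C))" using conf by (simp add: configuration_def)
  then have "finite (ran (host C))" by (rule finite_ran)
  then show "total_cost D \<le> total_cost C"
    unfolding total_cost_def using ranD(2) by (intro sum_mono2) auto
qed

text \<open>The first summand bounds the instances kept for at most \<open>n\<close> types, where
  \<open>Suc (n * n + n)\<close> just exceeds the threshold of \<open>serves_subset\<close> for
  \<open>A = n\<close>. The second bounds the further ones, with one coordinate per interface below
  \<open>n\<close>.\<close>

definition inst_bound :: "nat \<Rightarrow> nat" where
  "inst_bound n = n * Suc (n * n + n) + block_bound n (n * (n * Suc (n * n + n)) + n)"

text \<open>No type requires an interface at or above \<open>n\<close>, so \<open>n\<close>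
  coordinates suffice. Infinite capacities are exempt because they do not enter the sums as
  summands.\<close>

definition bounded_by :: "nat \<Rightarrow> ('r::finite) mtype set \<Rightarrow> bool" where
  "bounded_by n U \<longleftrightarrow> finite U \<and> card U \<le> n \<and>
     (\<forall>T \<in> U. (\<forall>p k. req_s T p = Some k \<or> req_w T p = Some k \<longrightarrow> p < n \<and> k \<le> n) \<and>
       (\<forall>p c. prov T p = Some (enat c) \<longrightarrow> c \<le> n))"

lemma ex_small_correct_config:
  fixes C :: "('r::finite) config"
  assumes C: "correct C" "over U Os C" and U: "bounded_by n U"
    and t: "z0 \<in> insts C" "mtyp_of C z0 = \<T>t"
  shows "\<exists>D :: 'r config. correct D \<and> over U Os D \<and> (\<exists>z \<in> insts D. mtyp_of D z = \<T>t) \<and>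
    total_cost D \<le> total_cost C \<and> insts D \<subseteq> {..<inst_bound n} \<and>
    (\<forall>(p, z1, z2) \<in> bindings D. p < n)"
proof -
  let ?Z = "insts C" and ?K = "Suc (n * n + n)"
  have conf: "configuration C" using C by (auto simp: correct_def provisionally_correct_def)
  have finZ: "finite ?Z" using conf by (simp add: configuration_def)
  have ty: "mtyp_of C z \<in> U" "mtyp_of C z \<in> mtypes" if "z \<in> ?Z" for z
    using C(2) preconfiguration_mtypes[OF configuration_preconfiguration[OF conf]] that by (auto simp: over_def)
  have finU: "finite U" "card U \<le> n" using U by (auto simp: bounded_by_def)
  let ?cl = "\<lambda>T. {z \<in> ?Z. mtyp_of C z = T}"
  have "\<forall>T. \<exists>B \<subseteq> ?cl T. card B = min ?K (card (?cl T))"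
    by (meson min.cobounded2 obtain_subset_with_card_n)
  then obtain B where B: "\<And>T. B T \<subseteq> ?cl T" "\<And>T. card (B T) = min ?K (card (?cl T))" by metis
  let ?B = "\<Union>T \<in> U. B T"
  have BZ: "?B \<subseteq> ?Z" using B(1) by blast
  have finB: "finite ?B" using BZ finZ finite_subset by blast
  have "card ?B \<le> (\<Sum>T\<in>U. card (B T))" using finU(1) by (rule card_UN_le)
  also have "\<dots> \<le> card U * ?K" 
  proof -
    have "card (B T) \<le> ?K" for T unfolding B(2) by (rule min.cobounded1)
    then show ?thesis using sum_bounded_above[of U "\<lambda>T. card (B T)" ?K] by (simp only: of_nat_id)
  qed
  also have "\<dots> \<le> n * ?K" using finU(2) by (rule mult_le_mono1)
  finally have cardB: "card ?B \<le> n * ?K" .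
  \<comment> \<open>For the providers of an interface with infinite, or with finite, capacity this
    is the alternative assumed by \<open>serves_subset\<close>: a type whose instances are kept only
    in part already contributes more than \<open>n * n + n\<close> of them.\<close>
  have large: "{z \<in> ?Z. P (mtyp_of C z)} \<subseteq> Z' \<or> n * n + n < card ({z \<in> ?Z. P (mtyp_of C z)} \<inter> Z')"
    if Z': "?B \<subseteq> Z'" "Z' \<subseteq> ?Z" for P Z'
  proof (cases "\<forall>T \<in> U. P T \<longrightarrow> B T = ?cl T")
    case True
    then have "{z \<in> ?Z. P (mtyp_of C z)} \<subseteq> ?B" using ty(1) by blast
    then show ?thesis using Z' by blast
  next
    case False
    then obtain T where T: "T \<in> U" "P T" "B T \<noteq> ?cl T" by blast
    have "card (B T) \<noteq> card (?cl T)"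
      using T(3) B(1) finZ card_subset_eq[of "?cl T" "B T"] by auto
    then have "?K = card (B T)" using B(2)[of T] by linarith
    also have "\<dots> \<le> card ({z \<in> ?Z. P (mtyp_of C z)} \<inter> Z')"
      using T(1,2) B(1)[of T] Z' finZ by (intro card_mono) auto
    finally show ?thesis by linarith
  qed
  let ?d = "\<lambda>p z. demand (mtyp_of C z) p" and ?c = "\<lambda>p z. the (prov (mtyp_of C z) p)"
  let ?Q = "providers C" and ?v = "\<lambda>z p. surplus (providers C p) (\<lambda>z. demand (mtyp_of C z) p)
    (\<lambda>z. the (prov (mtyp_of C z) p)) z"
  have QZ: "?Q p \<subseteq> ?Z" for p by (auto simp: providers_def)
  have dn: "?d p z \<le> n" "n \<le> p \<Longrightarrow> ?d p z = 0" if "z \<in> ?Z" for p z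
    using U ty(1)[OF that] by (fastforce simp: demand_def bounded_by_def split: option.splits)+
  have cn: "?c p z \<noteq> 0 \<and> (?c p z = \<infinity> \<or> ?c p z \<le> enat n)" if "z \<in> ?Q p" for p z
  proof -
    have z: "z \<in> ?Z" and "p \<in> dom (prov (mtyp_of C z))" using that by (auto simp: providers_def)
    then obtain c where c: "prov (mtyp_of C z) p = Some c" by blast
    then have "c \<noteq> 0" using ty(2)[OF z] by (auto simp: mtypes_def ran_def)
    moreover have "c = \<infinity> \<or> c \<le> enat n"
      using U ty(1)[OF z] c by (cases c) (auto simp: bounded_by_def)
    ultimately show ?thesis using c by simp
  qed
  have v: "\<bar>?v z p\<bar> \<le> int n" if "z \<in> ?Z" for z p
  proof -
    have "z \<in> ?Q p \<Longrightarrow> ?c p z \<noteq> \<infinity> \<Longrightarrow> the_enat (?c p z) \<le> n"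
      using cn[of z p] by (cases "?c p z") auto
    then show ?thesis using dn(1)[OF that, of p] by (auto simp: surplus_def)
  qed
  \<comment> \<open>At most \<open>n * ?K\<close> kept instances, each with a surplus of size at
    most \<open>n\<close>, bound the offset; the summand \<open>n\<close> covers the single
    vectors.\<close>
  let ?A = "n * (n * ?K) + n"
  have "\<exists>Y \<subseteq> ?Z - ?B. card Y \<le> block_bound n ?A \<and>
      (\<forall>p<n. 0 \<le> (\<Sum>z\<in>?B. ?v z p) + (\<Sum>z\<in>Y. ?v z p))"
  proof (rule small_nonnegative_subset)
    show "\<forall>z \<in> ?Z - ?B. \<forall>p<n. \<bar>?v z p\<bar> \<le> int ?A"
    proof (intro ballI allI impI)
      fix z p
      assume "z \<in> ?Z - ?B"
      then have "\<bar>?v z p\<bar> \<le> int n" using v by blast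
      also have "\<dots> \<le> int ?A" by (simp only: of_nat_le_iff)
      finally show "\<bar>?v z p\<bar> \<le> int ?A" .
    qed
    show "\<forall>p<n. \<bar>\<Sum>z\<in>?B. ?v z p\<bar> \<le> int ?A"
    proof (intro allI impI)
      fix p
      have "\<bar>\<Sum>z\<in>?B. ?v z p\<bar> \<le> (\<Sum>z\<in>?B. \<bar>?v z p\<bar>)" by (rule sum_abs)
      also have "\<dots> \<le> int (card ?B) * int n"
        using v BZ by (intro sum_bounded_above[of ?B _ "int n", simplified]) blast
      also have "\<dots> \<le> int (n * ?K) * int n"
        using cardB by (intro mult_right_mono) (simp_all only: of_nat_le_iff of_nat_0_le_iff)
      finally show "\<bar>\<Sum>z\<in>?B. ?v z p\<bar> \<le> int ?A" by (simp add: algebra_simps)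
    qed
    show "\<forall>p<n. 0 \<le> (\<Sum>z\<in>?B. ?v z p) + (\<Sum>z\<in>?Z - ?B. ?v z p)"
      using sum_surplus_nonneg[OF finZ QZ correct_serves[OF C(1)]] sum.subset_diff[OF BZ finZ]
      by (metis (no_types, lifting) add.commute)
  qed (use finZ in simp)
  then obtain Y where Y: "Y \<subseteq> ?Z - ?B" "card Y \<le> block_bound n ?A"
    "\<And>p. p < n \<Longrightarrow> 0 \<le> (\<Sum>z\<in>?B. ?v z p) + (\<Sum>z\<in>Y. ?v z p)" by blast
  let ?Z' = "?B \<union> Y"
  have Z': "?Z' \<subseteq> ?Z" using BZ Y(1) by blast
  have finY: "finite Y" using Y(1) finZ finite_subset by blast
  have "\<exists>R. serves ?Z' (?Q p \<inter> ?Z') (?d p) (?c p) R" if p: "p < n" for p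
  proof (rule serves_subset[OF finZ QZ correct_serves[OF C(1)]])
    show "\<forall>z \<in> ?Z. ?d p z \<le> n" "\<forall>z \<in> ?Q p. ?c p z \<noteq> 0 \<and> (?c p z = \<infinity> \<or> ?c p z \<le> enat n)"
      using dn(1) cn by blast+
    have "{j \<in> ?Q p. ?c p j = \<infinity>}
        = {z \<in> ?Z. p \<in> dom (prov (mtyp_of C z)) \<and> the (prov (mtyp_of C z) p) = \<infinity>}"
      by (auto simp: providers_def)
    then show "{j \<in> ?Q p. ?c p j = \<infinity>} \<subseteq> ?Z' \<or> n < card ({j \<in> ?Q p. ?c p j = \<infinity>} \<inter> ?Z')"
      using large[of ?Z' "\<lambda>T. p \<in> dom (prov T) \<and> the (prov T p) = \<infinity>"] Z' by auto
    have "{j \<in> ?Q p. ?c p j \<noteq> \<infinity>}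
        = {z \<in> ?Z. p \<in> dom (prov (mtyp_of C z)) \<and> the (prov (mtyp_of C z) p) \<noteq> \<infinity>}"
      by (auto simp: providers_def)
    then show "{j \<in> ?Q p. ?c p j \<noteq> \<infinity>} \<subseteq> ?Z' \<or> n * n + n < card ({j \<in> ?Q p. ?c p j \<noteq> \<infinity>} \<inter> ?Z')"
      using large[of ?Z' "\<lambda>T. p \<in> dom (prov T) \<and> the (prov T p) \<noteq> \<infinity>"] Z' by auto
    have "?B \<inter> Y = {}" using Y(1) by blast
    then show "0 \<le> (\<Sum>z\<in>?Z'. ?v z p)"
      using Y(3)[OF p] sum.union_disjoint[OF finB finY] by metis
  qed (rule Z')
  then obtain R where R: "\<And>p. p < n \<Longrightarrow> serves ?Z' (?Q p \<inter> ?Z') (?d p) (?c p) (R p)" by metis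
  let ?N = "card ?Z'"
  have "finite ?Z'" using finB finY by blast
  then obtain h where h: "bij_betw h {..<?N} ?Z'"
    using ex_bij_betw_nat_finite[of ?Z'] by (auto simp: lessThan_atLeast0)
  have n: "?d p z = 0" if "z \<in> ?Z'" "n \<le> p" for z p
    using dn(2) that Z' by blast
  define D :: "'r config" where "D = \<lparr>insts = {..<?N},
     mtyp = (\<lambda>i. if i < ?N then mtyp C (h i) else None),
     host = (\<lambda>i. if i < ?N then host C (h i) else None),
     bindings = {(p, i, j). p < n \<and> i < ?N \<and> j < ?N \<and> (h i, h j) \<in> R p \<and>
       0 < demand (mtyp_of C (h i)) p}\<rparr>"
  note D = ex_correct_config_on_subset[OF C(1) Z' h R n, folded D_def]
  have img: "h ` {..<?N} = ?Z'" using h by (simp add: bij_betw_def)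
  then have "h i \<in> ?Z" if "i < ?N" for i
    using Z' that by blast
  then have "over U Os D"
    using C(2) by (simp add: over_def D_def)
  moreover have "\<exists>z \<in> insts D. mtyp_of D z = \<T>t"
  proof -
    have "\<T>t \<in> U" using t ty by blast
    \<comment> \<open>The minimum of \<open>?K\<close> and a positive number is positive, so an
      instance of the target type is kept.\<close>
    moreover have "B \<T>t \<noteq> {}"
    proof -
      have "0 < card (?cl \<T>t)" using t finZ by (auto simp: card_gt_0_iff)
      then have "0 < card (B \<T>t)" using B(2)[of \<T>t] by linarith
      then show ?thesis by auto
    qed
    ultimately obtain z where "z \<in> ?Z'" "mtyp_of C z = \<T>t" using B(1)[of \<T>t] by blast
    then obtain i where "i < ?N" "mtyp_of C (h i) = \<T>t" using img by (metis imageE lessThan_iff)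
    then show ?thesis by (auto simp: D_def)
  qed
  moreover have "?N \<le> inst_bound n"
  proof -
    have "?N \<le> card ?B + card Y" by (rule card_Un_le)
    then show ?thesis using cardB Y(2) unfolding inst_bound_def by linarith
  qed
  then have "insts D \<subseteq> {..<inst_bound n}" by (auto simp: D_def)
  ultimately show ?thesis using D by (intro exI[of _ D]) (auto simp: D_def)
qed

section \<open>Realizers for configurations\<close>

lemma realizable_restrict: "realizable D E enc f \<Longrightarrow> realizable {e \<in> D. P e} E enc f"
  by (erule realizable_subset) blast

lemma realizable_encode: "realizable D E enc f \<Longrightarrow> realizable D E id (\<lambda>e. enc (f e))"
  by (simp add: realizable_def)

lemma realizable_component:
  assumes "realizable D E enc f"
    and "\<And>e. e \<in> D \<Longrightarrow> i < length (list_decode (enc (f e))) \<and> list_decode (enc (f e)) ! i = enc2 (g e)"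
  shows "realizable D E enc2 g"
  by (rule realizable_map[OF assms(1), of "\<lambda>n. if i < length (list_decode n) then list_decode n ! i else 0"])
    (auto intro!: rec1_list_nth rec1_const rec1_id simp: assms(2))

lemma realizable_set_decode:
  "realizable D E id x \<Longrightarrow> realizable D E (enc_set id) (\<lambda>e. set_decode (x e))"
  by (simp add: realizable_def)

lemma realizable_list_decode:
  "realizable D E id x \<Longrightarrow> realizable D E list_encode (\<lambda>e. list_decode (x e))"
  by (simp add: realizable_def)

lemma realizable_prod_decode:
  assumes "realizable D E id x"
  shows "realizable D E id (\<lambda>e. fst (prod_decode (x e)))" "realizable D E id (\<lambda>e. snd (prod_decode (x e)))"
  by (rule realizable_map[OF assms], rule rec1_prod_decode, rule rec1_id, simp)+

lemma realizable_config:
  assumes "realizable D E enc_config C"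
  shows realizable_insts: "realizable D E (enc_set id) (\<lambda>e. insts (C e))"
    and realizable_mtyp: "realizable D E (enc_map enc_mtype) (\<lambda>e. mtyp (C e))"
    and realizable_host: "realizable D E (enc_map enc_node) (\<lambda>e. host (C e))"
    and realizable_bindings: "realizable D E (enc_set enc_binding) (\<lambda>e. bindings (C e))"
  by (rule realizable_component[OF assms, where i = 0], simp add: enc_config_def del: list_encode.simps)
    (rule realizable_component[OF assms, where i = 1], simp add: enc_config_def del: list_encode.simps,
     rule realizable_component[OF assms, where i = 2], simp add: enc_config_def del: list_encode.simps,
     rule realizable_component[OF assms, where i = 3], simp add: enc_config_def del: list_encode.simps)

lemma realizable_mtype:
  assumes "realizable D E enc_mtype T"
  shows realizable_prov: "realizable D E (enc_map enc_enat) (\<lambda>e. prov (T e))"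
    and realizable_req_s: "realizable D E (enc_map id) (\<lambda>e. req_s (T e))"
    and realizable_req_w: "realizable D E (enc_map id) (\<lambda>e. req_w (T e))"
    and realizable_conf: "realizable D E (enc_set id) (\<lambda>e. conf (T e))"
    and realizable_enc_res: "realizable D E enc_res (\<lambda>e. res (T e))"
  by (rule realizable_component[OF assms, where i = 0], simp add: enc_mtype_def del: list_encode.simps)
    (rule realizable_component[OF assms, where i = 1], simp add: enc_mtype_def del: list_encode.simps,
     rule realizable_component[OF assms, where i = 2], simp add: enc_mtype_def del: list_encode.simps,
     rule realizable_component[OF assms, where i = 3], simp add: enc_mtype_def del: list_encode.simps,
     rule realizable_component[OF assms, where i = 4], simp add: enc_mtype_def del: list_encode.simps)

lemma realizable_res_apply:
  fixes f :: "'e \<Rightarrow> 'r::finite \<Rightarrow> nat"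
  assumes "realizable D E enc_res f"
  shows "realizable D E id (\<lambda>e. f e r)"
proof (rule realizable_map[OF assms])
  show "rec1 (\<lambda>n. \<Sum>b \<in> set_decode n. (\<lambda>w. if fst (prod_decode (fst (prod_decode w))) = to_nat r
      then snd (prod_decode (fst (prod_decode w))) else 0) (prod_encode (b, n)))"
    by (intro rec1_sum_set rec1_if rec1_eq rec1_const rec1_prod_decode rec1_id)
  fix e
  let ?S = "range (\<lambda>r. prod_encode (to_nat r, f e r))"
  have "(\<Sum>b \<in> set_decode (enc_res (f e)). (\<lambda>w. if fst (prod_decode (fst (prod_decode w))) = to_nat r
      then snd (prod_decode (fst (prod_decode w))) else 0) (prod_encode (b, enc_res (f e))))
      = (\<Sum>b \<in> ?S. if fst (prod_decode b) = to_nat r then snd (prod_decode b) else 0)"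
    by (simp add: enc_res_def cong: if_cong)
  also have "\<dots> = (\<Sum>b \<in> ?S. if b = prod_encode (to_nat r, f e r) then f e r else 0)"
    by (intro sum.cong) auto
  also have "\<dots> = f e r" by (simp add: sum.delta)
  finally show "(\<Sum>b \<in> set_decode (enc_res (f e)). (\<lambda>w. if fst (prod_decode (fst (prod_decode w))) = to_nat r
      then snd (prod_decode (fst (prod_decode w))) else 0) (prod_encode (b, enc_res (f e)))) = id (f e r)"
    by simp
qed

lemma realizable_res: "realizable D E enc_mtype T \<Longrightarrow> realizable D E id (\<lambda>e. res (T e) r)"
  by (rule realizable_res_apply[OF realizable_enc_res])

lemma realizable_node:
  fixes o' :: "'e \<Rightarrow> ('r::finite) node"
  assumes "realizable D E enc_node o'"
  shows realizable_avail: "realizable D E id (\<lambda>e. avail (o' e) r)"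
    and realizable_cost: "realizable D E id (\<lambda>e. cost (o' e))"
proof -
  have "realizable D E enc_res (\<lambda>e. avail (o' e))"
    by (rule realizable_component[OF assms, where i = 1], simp add: enc_node_def del: list_encode.simps)
  then show "realizable D E id (\<lambda>e. avail (o' e) r)" by (rule realizable_res_apply)
  show "realizable D E id (\<lambda>e. cost (o' e))"
    by (rule realizable_component[OF assms, where i = 2], simp add: enc_node_def del: list_encode.simps)
qed

lemma realizable_binding:
  assumes "realizable D E enc_binding b"
  shows "realizable D E id (\<lambda>e. fst (b e))" "realizable D E id (\<lambda>e. fst (snd (b e)))"
    "realizable D E id (\<lambda>e. snd (snd (b e)))"
  by (rule realizable_component[OF assms, where i = 0], simp add: enc_binding_def split_beta del: list_encode.simps)
    (rule realizable_component[OF assms, where i = 1], simp add: enc_binding_def split_beta del: list_encode.simps,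
     rule realizable_component[OF assms, where i = 2], simp add: enc_binding_def split_beta del: list_encode.simps)

lemma realizable_enc_binding:
  assumes "realizable D E id p" "realizable D E id z1" "realizable D E id z2"
  shows "realizable D E enc_binding (\<lambda>e. (p e, z1 e, z2 e))"
proof -
  have "realizable D E list_encode (\<lambda>e. [p e, z1 e, z2 e])"
    using assms by (intro realizable_Cons realizable_Nil)
  then show ?thesis by (simp add: realizable_def enc_binding_def del: list_encode.simps)
qed

lemma realizable_enat_le:
  assumes n: "realizable D E id n" and c: "realizable D E enc_enat c"
  shows "realizable D E of_bool (\<lambda>e. enat (n e) \<le> c e)"
proof -
  \<comment> \<open>\<open>\<infinity>\<close> has code 0 and \<open>enat k\<close> has code
    \<open>Suc k\<close>, which makes the comparison strict.\<close>
  have "realizable D E of_bool (\<lambda>e. enc_enat (c e) = 0 \<or> n e < enc_enat (c e))"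
    using n realizable_encode[OF c]
    by (intro realizable_disj realizable_less realizable_eq[where enc = id] realizable_const) auto
  moreover have "(enc_enat x = 0 \<or> m < enc_enat x) = (enat m \<le> x)" for x m
    by (cases x) auto
  ultimately show ?thesis by simp
qed

lemma inj_on_enc_pair_map_graph: "inj_on (enc_pair enc) (map_graph f)"
  by (auto simp: inj_on_def map_graph_def enc_pair_def)

lemma realizable_restrict_map:
  assumes f: "realizable D E (enc_map enc) f" and A: "realizable D E (enc_set id) A"
    and fin: "\<And>e. e \<in> D \<Longrightarrow> finite (dom (f e)) \<and> finite (A e)"
  shows "realizable D E (enc_map enc) (\<lambda>e. f e |` A e)"
proof -
  have "realizable D E (enc_set (enc_pair enc)) (\<lambda>e. {x \<in> map_graph (f e). fst x \<in> A e})"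
  proof (rule realizable_filter)
    show "realizable (ext_dom D (\<lambda>e. map_graph (f e))) (ext_enc (enc_pair enc) E) of_bool
        (\<lambda>v. fst (fst v) \<in> A (snd v))"
      using fin
      by (intro realizable_member[where enc = id] realizable_fst[OF realizable_var] realizable_weaken A) auto
  qed (use f fin in \<open>auto simp: realizable_map_graph inj_on_enc_pair_map_graph intro: finite_map_graph_iff\<close>)
  moreover have "{x \<in> map_graph (f e). fst x \<in> A e} = map_graph (f e |` A e)" for e
    by (auto simp: map_graph_def restrict_map_def split: if_splits)
  ultimately show ?thesis by (simp add: realizable_map_graph)
qed

lemma realizable_mem_nat:
  assumes "realizable D E id f" "realizable D E (enc_set id) A" "\<And>e. e \<in> D \<Longrightarrow> finite (A e)"
  shows "realizable D E of_bool (\<lambda>e. f e \<in> A e)"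
  using assms by (rule realizable_member) auto

lemma realizable_mem_binding:
  assumes "realizable D E enc_binding f" "realizable D E (enc_set enc_binding) A"
    "\<And>e. e \<in> D \<Longrightarrow> finite (A e)"
  shows "realizable D E of_bool (\<lambda>e. f e \<in> A e)"
  using assms by (rule realizable_member) (auto dest: injD[OF inj_enc_binding])

lemma realizable_eq_nat:
  assumes "realizable D E id f" "realizable D E id g"
  shows "realizable D E of_bool (\<lambda>e. f e = g e)"
  using assms by (rule realizable_eq) simp

lemma realizable_eq_node:
  assumes "realizable D E enc_node f" "realizable D E enc_node g"
  shows "realizable D E of_bool (\<lambda>e. f e = g e)"
  using assms by (rule realizable_eq) (rule injD[OF inj_enc_node])

lemma realizable_eq_mtype:
  assumes "realizable D E enc_mtype f" "realizable D E enc_mtype g"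
    "\<And>e. e \<in> D \<Longrightarrow> f e \<in> mtypes \<and> g e \<in> mtypes"
  shows "realizable D E of_bool (\<lambda>e. f e = g e)"
  using assms(1,2) by (rule realizable_eq) (use assms(3) inj_onD[OF inj_on_enc_mtype] in blast)

lemma preconfiguration_finite:
  assumes "preconfiguration C"
  shows "finite (insts C)" "finite (bindings C)" "finite (ran (host C))" "finite (dom (host C))"
    "finite (dom (mtyp C))"
    "z \<in> insts C \<Longrightarrow> finite (dom (prov (mtyp_of C z)))"
    "z \<in> insts C \<Longrightarrow> finite (dom (req_s (mtyp_of C z)))"
    "z \<in> insts C \<Longrightarrow> finite (dom (req_w (mtyp_of C z)))"
    "z \<in> insts C \<Longrightarrow> finite (conf (mtyp_of C z))"
  using assms preconfiguration_mtypes[OF assms, of z]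
  by (auto simp: preconfiguration_def mtypes_def intro: finite_ran)

lemma realizable_mtyp_of:
  assumes "realizable D E enc_config C" "realizable D E id z"
    "\<And>e. e \<in> D \<Longrightarrow> preconfiguration (C e) \<and> z e \<in> insts (C e)"
  shows "realizable D E enc_mtype (\<lambda>e. mtyp_of (C e) (z e))"
  using assms(3) by (intro realizable_lookup realizable_mtyp assms(1,2)) (auto simp: preconfiguration_def)

lemma realizable_host_of:
  assumes "realizable D E enc_config C" "realizable D E id z"
    "\<And>e. e \<in> D \<Longrightarrow> preconfiguration (C e) \<and> z e \<in> insts (C e)"
  shows "realizable D E enc_node (\<lambda>e. the (host (C e) (z e)))"
  using assms(3) by (intro realizable_lookup realizable_host assms(1,2)) (auto simp: preconfiguration_def)

lemmas realizable_vars = realizable_var realizable_binding[OF realizable_var]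

text \<open>Backward application of these rules follows the syntax of a formula and assembles its
  realizer; the side conditions mostly concern finiteness and successful lookups.\<close>

lemmas realizable_intros = realizable_conj realizable_imp realizable_disj realizable_not
  realizable_less realizable_le realizable_mem_nat realizable_mem_binding
  realizable_all[where enc = id] realizable_ex[where enc = id] realizable_finite_all
  realizable_insts realizable_bindings realizable_mtyp_of realizable_host_of realizable_lookup
  realizable_enat_le realizable_req_s realizable_req_w realizable_prov realizable_conf realizable_res
  realizable_avail realizable_cost
  realizable_dom realizable_card[where enc = id] realizable_filter[where enc = id]
  realizable_enc_binding realizable_restrict realizable_weaken realizable_const

lemma realizable_configuration:
  assumes C: "realizable D E enc_config C" and pre: "\<And>e. e \<in> D \<Longrightarrow> preconfiguration (C e)"
  shows "realizable D E of_bool (\<lambda>e. configuration (C e))"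
proof (rule realizable_cong)
  show "realizable D E of_bool (\<lambda>e. \<forall>b \<in> bindings (C e).
      fst (snd b) \<in> insts (C e) \<and> snd (snd b) \<in> insts (C e) \<and> \<not> fst (snd b) = snd (snd b) \<and>
      (fst b \<in> dom (req_s (mtyp_of (C e) (fst (snd b)))) \<or> fst b \<in> dom (req_w (mtyp_of (C e) (fst (snd b))))) \<and>
      fst b \<in> dom (prov (mtyp_of (C e) (snd (snd b)))))"
    by (rule realizable_all[where enc = enc_binding])
      (rule C realizable_vars realizable_eq_nat realizable_intros | (simp add: preconfiguration_finite pre; fail))+
qed (use pre in \<open>auto simp: preconfiguration_def configuration_def split_beta\<close>)

lemma ball_dom_the_iff:
  "(\<forall>p \<in> dom f. the (f p) \<le> g p) \<longleftrightarrow> (\<forall>p n. f p = Some n \<longrightarrow> n \<le> g p)"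
  "(\<forall>p \<in> dom f. g p \<le> the (f p)) \<longleftrightarrow> (\<forall>p n. f p = Some n \<longrightarrow> g p \<le> n)"
  by (metis domD domI option.sel)+

text \<open>Witness sets give way to cardinalities, and the quantifiers outside
  \<open>configuration\<close> range over finite sets computable from the code or over the finite
  type of resources, as the realizability rules demand.\<close>

lemma provisionally_correct_iff:
  assumes "preconfiguration C"
  shows "provisionally_correct C \<longleftrightarrow> configuration C \<and>
      (\<forall>o' \<in> ran (host C). \<forall>r.
         (\<Sum>z \<in> {z \<in> insts C. the (host C z) = o'}. res (mtyp_of C z) r) \<le> avail o' r) \<and>
      (\<forall>z \<in> insts C.
        (\<forall>p \<in> dom (req_s (mtyp_of C z)).
           the (req_s (mtyp_of C z) p) \<le> card {z' \<in> insts C. (p, z, z') \<in> bindings C}) \<and>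
        (\<forall>p \<in> dom (prov (mtyp_of C z)).
           enat (card {z' \<in> insts C. (p, z', z) \<in> bindings C}) \<le> the (prov (mtyp_of C z) p)))"
proof (cases "configuration C")
  case True
  have "{z' \<in> insts C. (p, z, z') \<in> bindings C} = {z'. (p, z, z') \<in> bindings C}"
    "{z' \<in> insts C. (p, z', z) \<in> bindings C} = {z'. (p, z', z) \<in> bindings C}" for p z
    using configuration_bindingD(1,2)[OF True] by blast+
  moreover have "{z \<in> insts C. the (host C z) = o'} = {z \<in> insts C. host C z = Some o'}" for o'
    using True by (auto simp: configuration_def set_eq_iff domIff)
  ultimately show ?thesis
    using True
    by (simp add: provisionally_correct_def enough_providers_iff within_capacity_iff ball_dom_the_iff)
qed (simp add: provisionally_correct_def)

lemma correct_iff: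
  assumes "preconfiguration C"
  shows "correct C \<longleftrightarrow> provisionally_correct C \<and>
     (\<forall>z \<in> insts C.
        (\<forall>p \<in> dom (req_w (mtyp_of C z)).
           the (req_w (mtyp_of C z) p) \<le> card {z' \<in> insts C. (p, z, z') \<in> bindings C}) \<and>
        (\<forall>p \<in> conf (mtyp_of C z). \<forall>z' \<in> insts C. \<not> z' = z \<longrightarrow> \<not> p \<in> dom (prov (mtyp_of C z'))))"
proof (cases "provisionally_correct C")
  case True
  then have conf: "configuration C" by (simp add: provisionally_correct_def)
  have "{z' \<in> insts C. (p, z, z') \<in> bindings C} = {z'. (p, z, z') \<in> bindings C}" for p z
    using configuration_bindingD(2)[OF conf] by blast
  moreover have ball: "(\<forall>z' \<in> A - {z}. P z') \<longleftrightarrow> (\<forall>z' \<in> A. \<not> z' = z \<longrightarrow> P z')"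
    for A z and P :: "inst \<Rightarrow> bool" by blast
  ultimately show ?thesis
    using True
    by (simp add: correct_def enough_providers_iff[OF conf] ball_dom_the_iff ball)
qed (simp add: correct_def)

lemma realizable_provisionally_correct:
  assumes C: "realizable D E enc_config C" and pre: "\<And>e. e \<in> D \<Longrightarrow> preconfiguration (C e)"
  shows "realizable D E of_bool (\<lambda>e. provisionally_correct (C e))"
  by (rule realizable_cong[OF _ provisionally_correct_iff[OF pre, symmetric]])
    (rule realizable_configuration[OF C pre] C realizable_vars realizable_ran realizable_host
      realizable_all[where enc = enc_node] realizable_sum[where enc = id] realizable_eq_node realizable_intros
      | assumption | (simp add: preconfiguration_finite pre; fail))+

lemma realizable_correct:
  assumes C: "realizable D E enc_config C" and pre: "\<And>e. e \<in> D \<Longrightarrow> preconfiguration (C e)"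
  shows "realizable D E of_bool (\<lambda>e. correct (C e))"
  by (rule realizable_cong[OF _ correct_iff[OF pre, symmetric]])
    (rule realizable_provisionally_correct[OF C pre] C realizable_vars realizable_eq_nat realizable_intros
      | assumption | (simp add: preconfiguration_finite pre; fail))+

lemma realizable_over:
  assumes C: "realizable D E enc_config C" and pre: "\<And>e. e \<in> D \<Longrightarrow> preconfiguration (C e)"
    and U: "realizable D E (enc_set enc_mtype) U" "\<And>e. e \<in> D \<Longrightarrow> finite (U e) \<and> U e \<subseteq> mtypes"
    and Os: "realizable D E (enc_set enc_node) Os" "\<And>e. e \<in> D \<Longrightarrow> finite (Os e)"
  shows "realizable D E of_bool (\<lambda>e. over (U e) (Os e) (C e))"
proof -
  have T: "mtyp_of (C e) z \<in> U e"
    if "e \<in> D" "z \<in> insts (C e)" "T \<in> U e" "enc_mtype (mtyp_of (C e) z) = enc_mtype T" for e z T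
    using that U(2)[OF that(1)] preconfiguration_mtypes[OF pre[OF that(1)] that(2)]
      inj_onD[OF inj_on_enc_mtype that(4)] by auto
  show ?thesis
    unfolding over_def
    by (rule realizable_all[where enc = id] realizable_conj realizable_member[where enc = enc_mtype]
      realizable_member[where enc = enc_node] C U(1) Os(1) realizable_vars realizable_intros
      | (simp add: preconfiguration_finite pre U(2) Os(2); fail) | (auto dest: T injD[OF inj_enc_node]; fail))+
qed

lemma realizable_has_type:
  assumes C: "realizable D E enc_config C" and pre: "\<And>e. e \<in> D \<Longrightarrow> preconfiguration (C e)"
    and T: "realizable D E enc_mtype T" "\<And>e. e \<in> D \<Longrightarrow> T e \<in> mtypes"
  shows "realizable D E of_bool (\<lambda>e. \<exists>z \<in> insts (C e). mtyp_of (C e) z = T e)"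
  by (rule C T(1) realizable_vars realizable_eq_mtype realizable_intros
      | (simp add: preconfiguration_finite pre T(2) preconfiguration_mtypes; fail))+

lemma realizable_total_cost:
  assumes C: "realizable D E enc_config C" and pre: "\<And>e. e \<in> D \<Longrightarrow> preconfiguration (C e)"
  shows "realizable D E id (\<lambda>e. total_cost (C e))"
  unfolding total_cost_def
proof (rule realizable_sum)
  show "realizable D E (enc_set enc_node) (\<lambda>e. ran (host (C e)))"
    by (intro realizable_ran realizable_host C) (simp add: preconfiguration_finite pre)
qed (use pre in \<open>auto simp: preconfiguration_finite intro: realizable_cost realizable_var inj_on_subset[OF inj_enc_node]\<close>)

lemma realizable_enc_config:
  assumes "realizable D E (enc_set id) Z" "realizable D E (enc_map enc_mtype) M"
    "realizable D E (enc_map enc_node) H" "realizable D E (enc_set enc_binding) B"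
  shows "realizable D E enc_config (\<lambda>e. \<lparr>insts = Z e, mtyp = M e, host = H e, bindings = B e\<rparr>)"
proof -
  have "realizable D E list_encode (\<lambda>e. [set_encode (id ` Z e), enc_map enc_mtype (M e),
      enc_map enc_node (H e), set_encode (enc_binding ` B e)])"
    using assms[THEN realizable_encode] by (intro realizable_Cons realizable_Nil)
  then show ?thesis by (simp add: realizable_def enc_config_def del: list_encode.simps)
qed

lemma realizable_sub_config:
  assumes C: "realizable D E enc_config C" and Y: "realizable D E (enc_set id) Y"
    and B: "realizable D E (enc_set enc_binding) B"
    and pre: "\<And>e. e \<in> D \<Longrightarrow> preconfiguration (C e) \<and> finite (Y e)"
  shows "realizable D E enc_config (\<lambda>e. sub_config (C e) (Y e) (B e))"
  unfolding sub_config_def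
  by (intro realizable_enc_config Y B realizable_restrict_map realizable_mtyp realizable_host C)
    (simp_all add: preconfiguration_finite pre)

section \<open>Realizers for actions and codes\<close>

lemma realizable_set_encode: "realizable D E set_encode A \<longleftrightarrow> realizable D E (enc_set id) A"
  by (simp add: realizable_def)

lemma realizable_eq_config:
  assumes "realizable D E enc_config f" "realizable D E enc_config g"
    "\<And>e. e \<in> D \<Longrightarrow> configuration (f e) \<and> configuration (g e)"
  shows "realizable D E of_bool (\<lambda>e. f e = g e)"
  using assms(1,2) by (rule realizable_eq) (use assms(3) inj_onD[OF inj_on_enc_config] in blast)

lemma configuration_strip: "configuration C \<Longrightarrow> configuration (strip C z)"
  unfolding strip_def by (rule configuration_sub_config) (auto dest: configuration_bindingD(1,2))

lemma strip_eq:
  "strip C z = sub_config C {z' \<in> insts C. \<not> z' = z}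
     {b \<in> bindings C. \<not> fst (snd b) = z \<and> \<not> snd (snd b) = z}"
proof -
  have "insts C - {z} = {z' \<in> insts C. \<not> z' = z}"
    "{(p, z1, z2) \<in> bindings C. z1 \<noteq> z \<and> z2 \<noteq> z}
      = {b \<in> bindings C. \<not> fst (snd b) = z \<and> \<not> snd (snd b) = z}" by auto
  then show ?thesis by (simp only: strip_def)
qed

lemma inj_on_enc_binding: "inj_on enc_binding A"
  using inj_enc_binding inj_on_subset by blast

lemma realizable_strip:
  assumes C: "realizable D E enc_config C" and z: "realizable D E id z"
    and pre: "\<And>e. e \<in> D \<Longrightarrow> preconfiguration (C e)"
  shows "realizable D E enc_config (\<lambda>e. strip (C e) (z e))"
  unfolding strip_eq
  by (rule realizable_sub_config C z realizable_vars realizable_eq_nat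
      realizable_filter[where enc = enc_binding] realizable_intros
    | (simp add: preconfiguration_finite pre inj_on_enc_binding; fail))+

lemma realizable_strong_providers:
  assumes C: "realizable D E enc_config C" and z: "realizable D E id z"
    and pre: "\<And>e. e \<in> D \<Longrightarrow> configuration (C e) \<and> z e \<in> insts (C e)"
  shows "realizable D E (enc_map set_encode) (\<lambda>e. strong_providers (C e) (z e))"
  unfolding realizable_map_graph
proof (rule realizable_cong)
  have pre': "preconfiguration (C e)" "z e \<in> insts (C e)" if "e \<in> D" for e
    using pre[OF that] configuration_preconfiguration by auto
  show "realizable D E (enc_set (enc_pair set_encode))
      (\<lambda>e. (\<lambda>p. (p, {z' \<in> insts (C e). (p, z e, z') \<in> bindings (C e)})) ` dom (req_s (mtyp_of (C e) (z e))))"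
    by (rule realizable_image[where enc = id] C z realizable_vars realizable_Pair
        realizable_set_encode[THEN iffD2] realizable_intros
      | (simp add: preconfiguration_finite pre'; fail))+
  fix e
  assume "e \<in> D"
  then have "{z' \<in> insts (C e). (p, z e, z') \<in> bindings (C e)} = {z'. (p, z e, z') \<in> bindings (C e)}" for p
    using pre configuration_bindingD(2) by blast
  then show "(\<lambda>p. (p, {z' \<in> insts (C e). (p, z e, z') \<in> bindings (C e)})) ` dom (req_s (mtyp_of (C e) (z e)))
      = map_graph (strong_providers (C e) (z e))"
    by (auto simp: map_graph_def strong_providers_def split: if_splits)
qed

text \<open>Resulting configurations are compared by their codes, and \<open>enc_config\<close> is
  injective only on proper configurations; hence the assumption on both of them.\<close>

lemma realizable_code_step:
  assumes C: "realizable D E enc_config C" and a: "realizable D E id a"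
    and C': "realizable D E enc_config C'"
    and conf: "\<And>e. e \<in> D \<Longrightarrow> configuration (C e) \<and> configuration (C' e)"
  shows "realizable D E of_bool (\<lambda>e. code_step (C e) (a e) (C' e))"
proof -
  have pre: "preconfiguration (C e)" "preconfiguration (C' e)" "configuration (C e)" "configuration (C' e)"
    "configuration (strip (C e) z)" "configuration (strip (C' e) z)"
    if "e \<in> D" for e z
    using conf[OF that] configuration_preconfiguration configuration_strip by auto
  have conf': "configuration (sub_config (C' e) (insts (C' e)) {b' \<in> bindings (C' e). b' \<noteq> b})"
    if "e \<in> D" for e b
    using pre(4)[OF that] by (intro configuration_sub_config) (auto dest: configuration_bindingD(1,2))
  have bd: "fst (snd b) \<in> insts (C' e)" if "e \<in> D" "b \<in> bindings (C' e)" for e b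
    using configuration_bindingD(1)[OF pre(4)[OF that(1)], of "fst b" "fst (snd b)" "snd (snd b)"] that(2)
    by simp
  have eq_binding: "realizable D' E' of_bool (\<lambda>e. f e = g e)"
    if "realizable D' E' enc_binding f" "realizable D' E' enc_binding g" for D' E' and f g :: "'x \<Rightarrow> _"
    using that by (rule realizable_eq) (rule injD[OF inj_enc_binding])
  show ?thesis
    unfolding code_step_def enc_action.simps
    by (rule C a C' realizable_vars realizable_disj realizable_conj
        realizable_ex[where enc = id] realizable_ex[where enc = enc_binding]
        realizable_all[where enc = enc_binding]
        realizable_eq_config realizable_strip realizable_sub_config
        realizable_filter[where enc = enc_binding]
        realizable_eq_nat eq_binding realizable_encode[where enc = list_encode]
        realizable_encode[where enc = enc_mtype] realizable_encode[where enc = enc_node]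
        realizable_encode[where enc = "enc_map set_encode"]
        realizable_strong_providers realizable_Cons realizable_Nil realizable_intros
      | (simp add: preconfiguration_finite pre conf' bd inj_on_enc_binding; fail))+
qed

section \<open>Recognising the codes of configurations\<close>

definition is_graph :: "nat \<Rightarrow> nat set \<Rightarrow> nat set \<Rightarrow> bool" where
  "is_graph g Z V \<longleftrightarrow>
     (\<forall>a \<in> set_decode g. fst (prod_decode a) \<in> Z \<and> snd (prod_decode a) \<in> V) \<and>
     (\<forall>z \<in> Z. \<exists>a \<in> set_decode g. fst (prod_decode a) = z) \<and>
     (\<forall>a \<in> set_decode g. \<forall>b \<in> set_decode g. fst (prod_decode a) = fst (prod_decode b) \<longrightarrow> a = b)"

text \<open>A map is recovered by choosing a preimage for each coded value. Since each argument
  occurs once in the graph, this accounts for every element of \<open>set_decode g\<close>.\<close>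

lemma is_graph_iff:
  assumes Z: "finite Z"
  shows "is_graph g Z (enc ` V) \<longleftrightarrow> (\<exists>f. dom f = Z \<and> ran f \<subseteq> V \<and> g = enc_map enc f)"
proof
  assume "\<exists>f. dom f = Z \<and> ran f \<subseteq> V \<and> g = enc_map enc f"
  then obtain f where f: "dom f = Z" "ran f \<subseteq> V" "g = enc_map enc f" by blast
  have "set_decode g = enc_pair enc ` map_graph f"
    using f Z by (simp add: enc_map_graph finite_map_graph_iff)
  moreover have "z \<in> Z \<Longrightarrow> \<exists>v. f z = Some v" for z using f(1) by blast
  ultimately show "is_graph g Z (enc ` V)"
    using f(1,2) unfolding is_graph_def by (fastforce simp: map_graph_def enc_pair_def ran_def)
next
  assume g: "is_graph g Z (enc ` V)"
  then have "\<forall>z \<in> Z. \<exists>v. v \<in> V \<and> prod_encode (z, enc v) \<in> set_decode g"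
    unfolding is_graph_def by (metis (no_types, lifting) imageE prod.collapse prod_decode_inverse)
  then obtain h where h: "\<And>z. z \<in> Z \<Longrightarrow> h z \<in> V \<and> prod_encode (z, enc (h z)) \<in> set_decode g"
    by metis
  define f where "f = (\<lambda>z. if z \<in> Z then Some (h z) else None)"
  have dom: "dom f = Z" by (auto simp: f_def split: if_splits)
  have "set_decode g = enc_pair enc ` map_graph f"
  proof
    show "enc_pair enc ` map_graph f \<subseteq> set_decode g"
      using h by (auto simp: map_graph_def enc_pair_def f_def split: if_splits)
    show "set_decode g \<subseteq> enc_pair enc ` map_graph f"
    proof
      fix a
      assume a: "a \<in> set_decode g"
      let ?z = "fst (prod_decode a)"
      have "?z \<in> Z" using a g by (simp add: is_graph_def)
      with h[of ?z] a g have "a = prod_encode (?z, enc (h ?z))"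
        unfolding is_graph_def by (metis fst_conv prod_encode_inverse)
      then show "a \<in> enc_pair enc ` map_graph f"
        using \<open>?z \<in> Z\<close> by (intro image_eqI[of _ _ "(?z, h ?z)"]) (auto simp: enc_pair_def map_graph_def f_def)
    qed
  qed
  then have "g = enc_map enc f" by (metis enc_map_graph set_decode_inverse)
  moreover have "ran f \<subseteq> V" using h by (auto simp: f_def ran_def split: if_splits)
  ultimately show "\<exists>f. dom f = Z \<and> ran f \<subseteq> V \<and> g = enc_map enc f" using dom by blast
qed

lemma realizable_is_graph:
  assumes "realizable D E id g" "realizable D E (enc_set id) Z" "realizable D E (enc_set id) V"
    and "\<And>e. e \<in> D \<Longrightarrow> finite (Z e) \<and> finite (V e)"
  shows "realizable D E of_bool (\<lambda>e. is_graph (g e) (Z e) (V e))"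
  unfolding is_graph_def
  by (rule assms(1-3) realizable_vars realizable_eq_nat realizable_prod_decode realizable_set_decode
      realizable_intros | (simp add: assms(4); fail))+

text \<open>With types from a given \<open>U\<close> and nodes from a given \<open>Os\<close>, their
  codes can be looked up among those in the input; codes of arbitrary types need not be
  recognised.\<close>

definition preconfigurations_over :: "('r::finite) mtype set \<Rightarrow> 'r node set \<Rightarrow> 'r config set" where
  "preconfigurations_over U Os = {C. preconfiguration C \<and> over U Os C}"

lemma preconfiguration_code_iff:
  assumes U: "U \<subseteq> mtypes"
  shows "c \<in> enc_config ` preconfigurations_over U Os \<longleftrightarrow>
    length (list_decode c) = 4 \<and>
    is_graph (list_decode c ! 1) (set_decode (list_decode c ! 0)) (enc_mtype ` U) \<and>
    is_graph (list_decode c ! 2) (set_decode (list_decode c ! 0)) (enc_node ` Os) \<and>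
    (\<forall>b \<in> set_decode (list_decode c ! 3). length (list_decode b) = 3)"
    (is "?L \<longleftrightarrow> ?R")
proof
  have over: "over U Os C \<longleftrightarrow> ran (mtyp C) \<subseteq> U \<and> ran (host C) \<subseteq> Os" if "preconfiguration C" for C
  proof -
    have "insts C = dom (mtyp C)" "insts C = dom (host C)" using that by (auto simp: preconfiguration_def)
    then have "(\<forall>z \<in> insts C. mtyp_of C z \<in> U) \<longleftrightarrow> ran (mtyp C) \<subseteq> U"
      "(\<forall>z \<in> insts C. the (host C z) \<in> Os) \<longleftrightarrow> ran (host C) \<subseteq> Os"
      by (force simp: ran_def)+
    then show ?thesis by (auto simp: over_def)
  qed
  {
    assume ?L
    then obtain C where C: "preconfiguration C" "over U Os C" "c = enc_config C"
      by (auto simp: preconfigurations_over_def)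
    have ld: "list_decode c = [set_encode (insts C), enc_map enc_mtype (mtyp C), enc_map enc_node (host C),
        set_encode (enc_binding ` bindings C)]"
      using C(3) by (simp add: enc_config_def del: list_encode.simps)
    have fin: "finite (insts C)" "finite (bindings C)" using C(1) by (auto simp: preconfiguration_def)
    moreover have "is_graph (enc_map enc_mtype (mtyp C)) (insts C) (enc_mtype ` U)"
      "is_graph (enc_map enc_node (host C)) (insts C) (enc_node ` Os)"
      using C over[OF C(1)] by (auto simp: is_graph_iff[OF fin(1)] preconfiguration_def)
    moreover have "length (list_decode b) = 3" if "b \<in> enc_binding ` bindings C" for b
      using that by (auto simp: enc_binding_def simp del: list_encode.simps)
    ultimately show ?R by (simp add: ld)
  next
    assume R: ?R
    let ?Z = "set_decode (list_decode c ! 0)"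
    obtain M where M: "dom M = ?Z" "ran M \<subseteq> U" "list_decode c ! 1 = enc_map enc_mtype M"
      using R is_graph_iff[of ?Z _ enc_mtype U] by auto
    obtain H where H: "dom H = ?Z" "ran H \<subseteq> Os" "list_decode c ! 2 = enc_map enc_node H"
      using R is_graph_iff[of ?Z _ enc_node Os] by auto
    let ?S = "set_decode (list_decode c ! 3)"
    \<comment> \<open>Every number that decodes to a list of length three is the code of a binding,
      so the image of this preimage is all of \<open>?S\<close>.\<close>
    let ?B = "{b. enc_binding b \<in> ?S}"
    have "?S \<subseteq> enc_binding ` ?B"
    proof
      fix a
      assume a: "a \<in> ?S"
      then have "length (list_decode a) = 3" using R by blast
      then obtain p z1 z2 where "list_decode a = [p, z1, z2]"
        by (auto simp: numeral_3_eq_3 length_Suc_conv)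
      then have "a = enc_binding (p, z1, z2)"
        unfolding enc_binding_def by (metis case_prod_conv list_decode_inverse)
      with a show "a \<in> enc_binding ` ?B" by blast
    qed
    then have B: "enc_binding ` ?B = ?S" by auto
    then have finB: "finite ?B"
      by (metis finite_imageD finite_set_decode inj_on_enc_binding)
    let ?C = "\<lparr>insts = ?Z, mtyp = M, host = H, bindings = ?B\<rparr>"
    have pre: "preconfiguration ?C" using M H U finB by (auto simp: preconfiguration_def)
    have "list_decode c = [set_encode ?Z, enc_map enc_mtype M, enc_map enc_node H, set_encode (enc_binding ` ?B)]"
    proof (rule nth_equalityI)
      fix i
      assume "i < length (list_decode c)"
      then have "i = 0 \<or> i = 1 \<or> i = 2 \<or> i = 3" using R by auto
      then show "list_decode c ! i = [set_encode ?Z, enc_map enc_mtype M, enc_map enc_node H,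
          set_encode (enc_binding ` ?B)] ! i"
        using M(3) H(3) arg_cong[OF B, of set_encode]
        by (elim disjE) (simp_all add: numeral_2_eq_2 numeral_3_eq_3)
    qed (use R in simp)
    then have "c = enc_config ?C"
      unfolding enc_config_def config.simps by (metis list_decode_inverse)
    moreover have "?C \<in> preconfigurations_over U Os"
      using pre M H over[OF pre] by (simp add: preconfigurations_over_def)
    ultimately show ?L by blast
  }
qed

lemma realizable_preconfiguration_code:
  assumes c: "realizable D E id c"
    and U: "realizable D E (enc_set enc_mtype) U" "\<And>e. e \<in> D \<Longrightarrow> finite (U e) \<and> U e \<subseteq> mtypes"
    and Os: "realizable D E (enc_set enc_node) Os" "\<And>e. e \<in> D \<Longrightarrow> finite (Os e)"
  shows "realizable D E of_bool (\<lambda>e. c e \<in> enc_config ` preconfigurations_over (U e) (Os e))"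
proof -
  have code: "realizable D' E' (enc_set id) (\<lambda>e. enc ` A e)"
    if "realizable D' E' (enc_set enc) A" for D' E' and A :: "'x \<Rightarrow> 'y set" and enc
    using that by (simp add: realizable_def)
  have eq: "(c e \<in> enc_config ` preconfigurations_over (U e) (Os e)) =
    (length (list_decode (c e)) = 4 \<and>
      is_graph (list_decode (c e) ! 1) (set_decode (list_decode (c e) ! 0)) (enc_mtype ` U e) \<and>
      is_graph (list_decode (c e) ! 2) (set_decode (list_decode (c e) ! 0)) (enc_node ` Os e) \<and>
      (\<forall>b \<in> set_decode (list_decode (c e) ! 3). length (list_decode b) = 3))" if "e \<in> D" for e
    using preconfiguration_code_iff U(2)[OF that] by blast
  show ?thesis
    by (rule realizable_cong[OF _ eq[symmetric]])
      (rule c U(1) Os(1) code realizable_vars realizable_conj realizable_is_graph realizable_eq_nat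
        realizable_length realizable_nth realizable_set_decode realizable_list_decode
        realizable_intros | assumption | (simp add: U(2) Os(2); fail))+
qed

lemma realizable_admissible:
  assumes C: "realizable D E enc_config C" and pre: "\<And>e. e \<in> D \<Longrightarrow> preconfiguration (C e)"
    and U: "realizable D E (enc_set enc_mtype) U" "\<And>e. e \<in> D \<Longrightarrow> finite (U e) \<and> U e \<subseteq> mtypes"
    and Os: "realizable D E (enc_set enc_node) Os" "\<And>e. e \<in> D \<Longrightarrow> finite (Os e)"
  shows "realizable D E of_bool (\<lambda>e. admissible (U e) (Os e) (C e))"
  unfolding admissible_def
  by (intro realizable_conj realizable_restrict realizable_provisionally_correct realizable_over
      C U Os pre)

lemma realizable_admissible_code:
  assumes c: "realizable D E id c"
    and U: "realizable D E (enc_set enc_mtype) U" "\<And>e. e \<in> D \<Longrightarrow> finite (U e) \<and> U e \<subseteq> mtypes"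
    and Os: "realizable D E (enc_set enc_node) Os" "\<And>e. e \<in> D \<Longrightarrow> finite (Os e)"
  shows "realizable D E of_bool (\<lambda>e. c e \<in> enc_config ` {C. admissible (U e) (Os e) C})"
proof (rule realizable_cong)
  show "realizable D E of_bool (\<lambda>e. \<exists>C \<in> preconfigurations_over (U e) (Os e).
      c e = enc_config C \<and> admissible (U e) (Os e) C)"
    by (rule realizable_ex_decode[OF c] realizable_preconfiguration_code[OF c U Os])+
     (rule realizable_admissible realizable_var realizable_weaken U(1) Os(1)
      | (simp add: U(2) Os(2) preconfigurations_over_def; fail))+
  have "preconfiguration C" if "provisionally_correct C" for C :: "'b config"
    using that by (simp add: provisionally_correct_def configuration_preconfiguration)
  then show "(\<exists>C \<in> preconfigurations_over (U e) (Os e). c e = enc_config C \<and> admissible (U e) (Os e) C)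
      = (c e \<in> enc_config ` {C. admissible (U e) (Os e) C})" for e
    by (auto simp: preconfigurations_over_def admissible_def)
qed

section \<open>A computable bound on codes\<close>

lemma triangle_mono: "m \<le> n \<Longrightarrow> triangle m \<le> triangle n"
  by (rule lift_Suc_mono_le[of triangle]) auto

lemma prod_encode_mono: "a \<le> a' \<Longrightarrow> b \<le> b' \<Longrightarrow> prod_encode (a, b) \<le> prod_encode (a', b')"
  unfolding prod_encode_def using triangle_mono[of "a + b" "a' + b'"] by simp

lemma list_encode_mono: "list_all2 (\<le>) xs ys \<Longrightarrow> list_encode xs \<le> list_encode ys"
  by (induction rule: list_all2_induct) (auto intro: prod_encode_mono)

lemma member_less_list_encode: "x \<in> set xs \<Longrightarrow> x < list_encode xs"
proof (induction xs)
  case (Cons y ys)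
  then show ?case
    using le_prod_encode_1[of y "list_encode ys"] le_prod_encode_2[of "list_encode ys" y] by auto
qed simp

lemma set_encode_le_power: "A \<subseteq> {..<m} \<Longrightarrow> set_encode A \<le> 2 ^ m"
proof -
  assume "A \<subseteq> {..<m}"
  then have "set_encode A \<le> (\<Sum>i<m. 2 ^ i)" unfolding set_encode_def by (intro sum_mono2) auto
  also have "\<dots> < 2 ^ m" by (induction m) auto
  finally show ?thesis by simp
qed

text \<open>All four fields code sets contained in initial segments, whence the powers of 2:
  instances below \<open>inst_bound n\<close>, pairs of an instance with a code at most
  \<open>n\<close> (twice), and triples of an interface below \<open>n\<close> and two
  instances.\<close>

definition code_bound :: "nat \<Rightarrow> nat" where
  "code_bound n = Suc (list_encode
     [2 ^ inst_bound n, 2 ^ Suc (prod_encode (inst_bound n, n)), 2 ^ Suc (prod_encode (inst_bound n, n)),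
      2 ^ Suc (list_encode [n, inst_bound n, inst_bound n])])"

lemma enc_config_less_code_bound:
  assumes pre: "preconfiguration C" and over: "over U Os C"
    and U: "\<And>T. T \<in> U \<Longrightarrow> enc_mtype T \<le> n" and Os: "\<And>o'. o' \<in> Os \<Longrightarrow> enc_node o' \<le> n"
    and Z: "insts C \<subseteq> {..<inst_bound n}"
    and B: "\<And>b. b \<in> bindings C \<Longrightarrow> fst b < n \<and> fst (snd b) \<in> insts C \<and> snd (snd b) \<in> insts C"
  shows "enc_config C < code_bound n"
proof -
  let ?N = "inst_bound n"
  have graph: "enc_map enc f \<le> 2 ^ Suc (prod_encode (?N, n))"
    if "dom f = insts C" "\<And>z v. z \<in> insts C \<Longrightarrow> f z = Some v \<Longrightarrow> enc v \<le> n" for enc and f :: "nat \<rightharpoonup> 'b"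
    unfolding enc_map_def
  proof (rule set_encode_le_power, clarify)
    fix a v
    assume v: "f a = Some v"
    then have a: "a \<in> insts C" using that(1) by blast
    then have "prod_encode (a, enc v) \<le> prod_encode (?N, n)"
      using that(2)[OF a v] Z by (intro prod_encode_mono) auto
    then show "prod_encode (a, enc v) < Suc (prod_encode (?N, n))" by simp
  qed
  have dom: "dom (mtyp C) = insts C" "dom (host C) = insts C" using pre by (auto simp: preconfiguration_def)
  have "set_encode (enc_binding ` bindings C) \<le> 2 ^ Suc (list_encode [n, ?N, ?N])"
  proof (rule set_encode_le_power, clarify)
    fix p z1 z2
    assume "(p, z1, z2) \<in> bindings C"
    then have "p < n" "z1 \<in> {..<?N}" "z2 \<in> {..<?N}" using B[of "(p, z1, z2)"] Z by auto
    then have "list_encode [p, z1, z2] \<le> list_encode [n, ?N, ?N]"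
      by (intro list_encode_mono) auto
    then show "enc_binding (p, z1, z2) < Suc (list_encode [n, ?N, ?N])"
      by (simp add: enc_binding_def del: list_encode.simps)
  qed
  moreover have "enc_map enc_mtype (mtyp C) \<le> 2 ^ Suc (prod_encode (?N, n))"
    using over U by (intro graph dom) (force simp: over_def)
  moreover have "enc_map enc_node (host C) \<le> 2 ^ Suc (prod_encode (?N, n))"
    using over Os by (intro graph dom) (force simp: over_def)
  ultimately have "enc_config C \<le> list_encode
     [2 ^ ?N, 2 ^ Suc (prod_encode (?N, n)), 2 ^ Suc (prod_encode (?N, n)), 2 ^ Suc (list_encode [n, ?N, ?N])]"
    unfolding enc_config_def using set_encode_le_power[OF Z]
    by (intro list_encode_mono) (simp del: list_encode.simps power_Suc)
  then show ?thesis by (simp add: code_bound_def del: list_encode.simps power_Suc)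
qed

text \<open>\<open>block_bound\<close> changes its parameter \<open>A\<close> in the recursive call,
  which the scheme of primitive recursion does not provide for. Iteration on the pair of current
  parameter and accumulated product avoids this.\<close>

lemma block_bound_funpow:
  "snd (((\<lambda>(A, P). (A * (2 * A + 1), P * (2 * A + 1))) ^^ m) (A, P)) = P * block_bound m A"
proof (induction m arbitrary: A P)
  case (Suc m)
  show ?case
    unfolding funpow_Suc_right o_apply prod.case Suc block_bound.simps by (simp only: mult.assoc)
qed simp

lemma rec1_block_bound:
  assumes "rec1 f" "rec1 g"
  shows "rec1 (\<lambda>n. block_bound (f n) (g n))"
proof -
  let ?s = "\<lambda>(A, P). (A * (2 * A + 1), P * (2 * A + 1))"
  let ?c = "\<lambda>w. fst (prod_decode (snd (prod_decode w)))"
  let ?h = "\<lambda>w. prod_encode (fst (prod_decode (?c w)) * (2 * fst (prod_decode (?c w)) + 1),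
      snd (prod_decode (?c w)) * (2 * fst (prod_decode (?c w)) + 1))"
  have "rec_nat (prod_encode x) (\<lambda>k y. ?h (prod_encode (k, prod_encode (y, n)))) m = prod_encode ((?s ^^ m) x)" for x n m
    by (induction m) (auto simp: split_beta)
  moreover have "rec1 (\<lambda>n. snd (prod_decode (rec_nat (prod_encode (g n, 1))
      (\<lambda>k y. ?h (prod_encode (k, prod_encode (y, n)))) (f n))))"
    using assms
    by (intro rec1_prod_decode rec1_rec_nat rec1_prod_encode rec1_mult rec1_add rec1_const rec1_id)
  ultimately have "rec1 (\<lambda>n. snd ((?s ^^ f n) (g n, 1)))" by simp
  moreover have "snd ((?s ^^ m) (A, 1)) = block_bound m A" for m A
    by (simp only: block_bound_funpow mult_1)
  ultimately show ?thesis by simp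
qed

lemma rec1_list_encode_Cons:
  "rec1 f \<Longrightarrow> rec1 (\<lambda>n. list_encode (g n)) \<Longrightarrow> rec1 (\<lambda>n. list_encode (f n # g n))"
  by (auto intro: rec1_Suc rec1_prod_encode)

lemma rec1_code_bound: "rec1 code_bound"
proof -
  have inst: "rec1 inst_bound"
    unfolding inst_bound_def[abs_def]
    by (intro rec1_add rec1_mult rec1_Suc rec1_block_bound rec1_id)
  show ?thesis
    unfolding code_bound_def[abs_def]
    by (intro rec1_Suc rec1_list_encode_Cons rec1_power2 rec1_prod_encode inst rec1_id rec1_const)
qed

text \<open>The numbers inside a coded object do not exceed its code, so the code of the universe,
  or anything above it, can serve as the bound \<open>n\<close>.\<close>

lemma bounded_by_code:
  assumes U: "finite U" "U \<subseteq> mtypes" and n: "set_encode (enc_mtype ` U) \<le> n"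
  shows "bounded_by n U" and "T \<in> U \<Longrightarrow> enc_mtype T \<le> n"
proof -
  have T: "enc_mtype T < n" if "T \<in> U" for T
    using less_set_encode[of "enc_mtype ` U" "enc_mtype T"] that U(1) n by auto
  then show "T \<in> U \<Longrightarrow> enc_mtype T \<le> n" by (simp add: less_imp_le)
  have graph: "a \<le> enc_map enc f \<and> enc v \<le> enc_map enc f" if "finite (dom f)" "f a = Some v" for enc a v
    and f :: "nat \<rightharpoonup> 'b"
  proof -
    have "prod_encode (a, enc v) < enc_map enc f"
      unfolding enc_map_def using finite_map_graph[OF that(1)] that(2) by (intro less_set_encode) auto
    then show ?thesis
      using le_prod_encode_1[of a "enc v"] le_prod_encode_2[of "enc v" a] by linarith
  qed
  have "card U = card (enc_mtype ` U)"
    using U(2) by (intro card_image[symmetric] inj_on_subset[OF inj_on_enc_mtype])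
  also have "\<dots> \<le> card {..<n}" using T by (intro card_mono) auto
  finally have "card U \<le> n" by simp
  moreover have "(\<forall>p k. req_s T p = Some k \<or> req_w T p = Some k \<longrightarrow> p < n \<and> k \<le> n) \<and>
      (\<forall>p c. prov T p = Some (enat c) \<longrightarrow> c \<le> n)" if "T \<in> U" for T
  proof -
    have fin: "finite (dom (req_s T))" "finite (dom (req_w T))" "finite (dom (prov T))"
      using that U(2) by (auto simp: mtypes_def)
    have "enc_map id (req_s T) < n" "enc_map id (req_w T) < n" "enc_map enc_enat (prov T) < n"
      using T[OF that] member_less_list_encode[of _ "[enc_map enc_enat (prov T), enc_map id (req_s T),
          enc_map id (req_w T), set_encode (conf T), enc_res (res T)]"]
      unfolding enc_mtype_def by (auto intro: less_trans simp del: list_encode.simps)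
    then show ?thesis
      using graph[OF fin(1), of _ _ id] graph[OF fin(2), of _ _ id] graph[OF fin(3), of _ "enat _" enc_enat]
      by (fastforce intro: order.trans order.strict_trans1)
  qed
  ultimately show "bounded_by n U" using U(1) by (simp add: bounded_by_def)
qed

section \<open>Optimal plans\<close>

text \<open>The initial configuration may use types outside \<open>U\<close> and nodes outside \<open>Os\<close>. The first action
  has to remove them, so at most one instance may be affected.\<close>

definition clearable :: "('r::finite) mtype set \<Rightarrow> 'r node set \<Rightarrow> 'r config \<Rightarrow> bool" where
  "clearable U Os C0 \<longleftrightarrow> over U Os C0 \<or> (\<exists>z \<in> insts C0. admissible U Os (strip C0 z))"

text \<open>A characterisation of last configurations that mentions no plan. The disjunct
  \<open>C = C0\<close> covers the empty plan, which puts no condition on the types and nodes of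
  \<open>C0\<close>.\<close>

definition target ::
  "('r::finite) mtype set \<Rightarrow> 'r node set \<Rightarrow> 'r config \<Rightarrow> 'r mtype \<Rightarrow> 'r config \<Rightarrow> bool" where
  "target U Os C0 T C \<longleftrightarrow> correct C \<and> (\<exists>z \<in> insts C. mtyp_of C z = T) \<and>
     (C = C0 \<or> clearable U Os C0 \<and> over U Os C)"

text \<open>Except for \<open>Del\<close>, an action keeps all instances of \<open>C0\<close> with
  their types and hosts, so \<open>C0\<close> lies over \<open>U\<close> and \<open>Os\<close>
  already if \<open>C1\<close> does.\<close>

lemma step_clearable:
  assumes "step C0 \<alpha> C1" "admissible U Os C1"
  shows "clearable U Os C0"
  using assms(1)
proof cases
  case (new \<T> Bs z o\<^sub>1)
  have "mtyp_of C0 x \<in> U \<and> the (host C0 x) \<in> Os" if "x \<in> insts C0" for x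
  proof -
    have "x \<noteq> z" using that new by blast
    moreover have "mtyp_of C1 x \<in> U \<and> the (host C1 x) \<in> Os"
      using assms(2) that new(2) by (simp add: admissible_def over_def)
    ultimately show ?thesis using new(2) by simp
  qed
  then show ?thesis by (simp add: clearable_def over_def)
next
  case (del z)
  then have "C1 = strip C0 z" by (simp add: strip_def sub_config_def)
  then show ?thesis using assms(2) del unfolding clearable_def by blast
qed (use assms(2) in \<open>simp_all add: clearable_def admissible_def over_def\<close>)

lemma solution_target:
  assumes sol: "solution_via U Os C0 T \<alpha>s Cs"
  shows "target U Os C0 T (Cs ! length \<alpha>s)"
proof -
  have plan: "Cs ! 0 = C0" "\<And>i. i \<le> length \<alpha>s \<Longrightarrow> provisionally_correct (Cs ! i)"
    "\<And>i. i < length \<alpha>s \<Longrightarrow> step (Cs ! i) (\<alpha>s ! i) (Cs ! Suc i)" "correct (Cs ! length \<alpha>s)"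
    using sol by (auto simp: solution_via_def plan_via_def)
  have over: "over U Os (Cs ! i)" if "i \<in> {1..length \<alpha>s}" for i
    using sol that unfolding solution_via_def over_def by blast
  have t: "\<exists>z \<in> insts (Cs ! length \<alpha>s). mtyp_of (Cs ! length \<alpha>s) z = T"
    using sol by (simp add: solution_via_def)
  show ?thesis
  proof (cases "length \<alpha>s = 0")
    case True
    then show ?thesis using plan(1,4) t by (simp add: target_def)
  next
    case False
    then have "admissible U Os (Cs ! 1)" "step C0 (\<alpha>s ! 0) (Cs ! 1)"
      using plan(1) plan(2)[of 1] plan(3)[of 0] over[of 1] by (simp_all add: admissible_def Suc_le_eq)
    then have "clearable U Os C0" by (auto intro: step_clearable)
    then show ?thesis using plan(4) t over[of "length \<alpha>s"] False by (simp add: target_def)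
  qed
qed

definition code_plan ::
  "('r::finite) mtype set \<Rightarrow> 'r node set \<Rightarrow> 'r config \<Rightarrow> nat list \<Rightarrow> 'r config list \<Rightarrow> bool" where
  "code_plan U Os C0 as Cs \<longleftrightarrow> length Cs = Suc (length as) \<and> Cs ! 0 = C0 \<and>
     (\<forall>i < length as. code_step (Cs ! i) (as ! i) (Cs ! Suc i) \<and> admissible U Os (Cs ! Suc i))"

lemma reaches_code_plan:
  "reaches U Os C C' \<Longrightarrow> \<exists>as Cs. code_plan U Os C as Cs \<and> Cs ! length as = C'"
proof (induction rule: rtranclp_induct)
  case base
  show ?case by (intro exI[of _ "[]"] exI[of _ "[C]"]) (simp add: code_plan_def)
next
  case (step C' C'')
  then obtain as Cs a where "code_plan U Os C as Cs" "Cs ! length as = C'"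
    "admissible U Os C''" "code_step C' a C''" by blast
  then show ?case
    by (intro exI[of _ "as @ [a]"] exI[of _ "Cs @ [C'']"])
      (auto simp: code_plan_def nth_append less_Suc_eq)
qed

text \<open>After at most one deletion the configuration is admissible, and from there on
  \<open>reaches_admissible\<close> applies.\<close>

lemma target_code_plan:
  assumes U: "well_formed_universe U" and C0: "provisionally_correct C0" and t: "target U Os C0 T C"
  shows "\<exists>as Cs. code_plan U Os C0 as Cs \<and> Cs ! length as = C"
proof (rule reaches_code_plan)
  show "reaches U Os C0 C"
  proof (cases "C = C0")
    case False
    then have C: "admissible U Os C" and clear: "clearable U Os C0"
      using t by (auto simp: target_def admissible_def correct_def)
    show ?thesis
    proof (cases "over U Os C0")
      case True
      then show ?thesis using reaches_admissible[OF U _ C] C0 by (simp add: admissible_def)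
    next
      case False
      then obtain z where z: "z \<in> insts C0" "admissible U Os (strip C0 z)"
        using clear by (auto simp: clearable_def)
      then have "code_step C0 (enc_action (Del z :: 'a action)) (strip C0 z)"
        unfolding code_step_def by blast
      with z(2) show ?thesis
        by (intro converse_rtranclp_into_rtranclp[OF _ reaches_admissible[OF U z(2) C]]) blast
    qed
  qed simp
qed

lemma code_plan_solution:
  assumes C0: "provisionally_correct C0" and plan: "code_plan U Os C0 as Cs"
    and "correct (Cs ! length as)" "\<exists>z \<in> insts (Cs ! length as). mtyp_of (Cs ! length as) z = T"
  shows "\<exists>\<alpha>s. map enc_action \<alpha>s = as \<and> solution_via U Os C0 T \<alpha>s Cs"
proof -
  have adm: "admissible U Os (Cs ! i)" if "i \<in> {1..length as}" for i
    using plan that unfolding code_plan_def by (cases i) auto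
  have pc: "provisionally_correct (Cs ! i)" if "i \<le> length as" for i
    using adm[of i] C0 plan that by (cases i) (auto simp: code_plan_def admissible_def)
  have "\<forall>i. \<exists>\<alpha>. i < length as \<longrightarrow> as ! i = enc_action \<alpha> \<and> step (Cs ! i) \<alpha> (Cs ! Suc i)"
    using plan pc code_step_step unfolding code_plan_def by (metis Suc_leI)
  then obtain act where act: "\<And>i. i < length as \<Longrightarrow> as ! i = enc_action (act i) \<and>
      step (Cs ! i) (act i) (Cs ! Suc i)" by metis
  let ?acts = "map act [0..<length as]"
  have "map enc_action ?acts = as" using act by (intro nth_equalityI) auto
  moreover have "solution_via U Os C0 T ?acts Cs"
    using plan pc adm act assms(3,4)
    by (auto simp: solution_via_def plan_via_def code_plan_def admissible_def over_def)
  ultimately show ?thesis by blast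
qed

section \<open>Optimal plans as a decidable predicate on codes\<close>

definition admissible_step ::
  "('r::finite) mtype set \<Rightarrow> 'r node set \<Rightarrow> 'r config \<Rightarrow> nat \<Rightarrow> nat \<Rightarrow> nat \<Rightarrow> bool" where
  "admissible_step U Os C0 c a c' \<longleftrightarrow>
     (\<exists>C \<in> insert C0 {C. admissible U Os C}. c = enc_config C \<and>
        (\<exists>C' \<in> {C. admissible U Os C}. c' = enc_config C' \<and> code_step C a C'))"

text \<open>Reachability is left to the steps in \<open>optimal_code\<close>. Minimality is put as a
  bounded search over costs \<open>k\<close>, for each of which \<open>realizable_ex_target\<close>
  decides whether a target exists; a comparison with all plans would not be bounded.\<close>

definition optimum ::
  "('r::finite) mtype set \<Rightarrow> 'r node set \<Rightarrow> 'r config \<Rightarrow> 'r mtype \<Rightarrow> nat \<Rightarrow> bool" where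
  "optimum U Os C0 T c \<longleftrightarrow>
     (\<exists>C \<in> insert C0 {C. admissible U Os C}. c = enc_config C \<and>
        correct C \<and> (\<exists>z \<in> insts C. mtyp_of C z = T) \<and>
        (\<forall>k < total_cost C. \<not> (\<exists>C'. target U Os C0 T C' \<and> total_cost C' \<le> k)))"

definition optimal_code ::
  "('r::finite) mtype set \<Rightarrow> 'r node set \<Rightarrow> 'r config \<Rightarrow> 'r mtype \<Rightarrow> nat list \<Rightarrow> nat list \<Rightarrow> bool" where
  "optimal_code U Os C0 T as cs \<longleftrightarrow> length cs = Suc (length as) \<and> cs ! 0 = enc_config C0 \<and>
     (\<forall>i < length as. admissible_step U Os C0 (cs ! i) (as ! i) (cs ! Suc i)) \<and>
     optimum U Os C0 T (cs ! length as)"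

lemma optimal_code_solution:
  assumes C0: "provisionally_correct C0" and oc: "optimal_code U Os C0 T as cs"
  shows "\<exists>\<alpha>s. as = map enc_action \<alpha>s \<and> optimal_solution U Os C0 T \<alpha>s"
proof -
  let ?X = "insert C0 {C. admissible U Os C}"
  have "?X \<subseteq> {C. configuration C}"
    using C0 by (auto simp: admissible_def provisionally_correct_def)
  then have inj: "inj_on enc_config ?X" using inj_on_enc_config inj_on_subset by blast
  \<comment> \<open>Decoding takes place inside \<open>?X\<close>, where \<open>enc_config\<close>
    is injective; \<open>C0\<close> is included because it may fail to be admissible.\<close>
  define dec where "dec = inv_into ?X enc_config"
  have dec: "dec (enc_config C) = C" if "C \<in> ?X" for C
    unfolding dec_def using inv_into_f_f[OF inj that] .
  let ?Cs = "map dec cs"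
  have len: "length cs = Suc (length as)" and cs0: "cs ! 0 = enc_config C0"
    using oc by (auto simp: optimal_code_def)
  have "code_step (?Cs ! i) (as ! i) (?Cs ! Suc i) \<and> admissible U Os (?Cs ! Suc i)"
    if i: "i < length as" for i
  proof -
    obtain C C' where "C \<in> ?X" "cs ! i = enc_config C" "C' \<in> {C. admissible U Os C}"
      "cs ! Suc i = enc_config C'" "code_step C (as ! i) C'"
      using oc i unfolding optimal_code_def admissible_step_def by blast
    then show ?thesis using dec[of C] dec[of C'] i len by simp
  qed
  then have plan: "code_plan U Os C0 as ?Cs"
    using len cs0 dec[of C0] by (simp add: code_plan_def)
  obtain C where C: "C \<in> ?X" "cs ! length as = enc_config C" "correct C" "\<exists>z \<in> insts C. mtyp_of C z = T"
    and min: "\<forall>k < total_cost C. \<not> (\<exists>C'. target U Os C0 T C' \<and> total_cost C' \<le> k)"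
    using oc unfolding optimal_code_def optimum_def by blast
  have last: "?Cs ! length as = C" using C(1,2) dec[of C] len by simp
  obtain \<alpha>s where \<alpha>s: "map enc_action \<alpha>s = as" "solution_via U Os C0 T \<alpha>s ?Cs"
    using code_plan_solution[OF C0 plan] C(3,4) last by blast
  have "length \<alpha>s = length as" using \<alpha>s(1) by (metis length_map)
  moreover have "total_cost C \<le> total_cost (Cs' ! length \<alpha>s')" if "solution_via U Os C0 T \<alpha>s' Cs'" for \<alpha>s' Cs'
    using min solution_target[OF that] by (meson not_le order_refl)
  ultimately have "optimal_solution U Os C0 T \<alpha>s"
    unfolding optimal_solution_def using \<alpha>s(2) last by (intro exI[of _ ?Cs]) auto
  with \<alpha>s(1) show ?thesis by blast
qed

lemma ex_optimal_code:
  assumes U: "well_formed_universe U" and C0: "provisionally_correct C0" and t: "target U Os C0 T C"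
  shows "\<exists>as cs. optimal_code U Os C0 T as cs"
proof -
  obtain C' where C': "target U Os C0 T C'" "\<And>D. target U Os C0 T D \<Longrightarrow> total_cost C' \<le> total_cost D"
    using ex_has_least_nat[of "target U Os C0 T" C total_cost] t by blast
  obtain as Cs where plan: "code_plan U Os C0 as Cs" "Cs ! length as = C'"
    using target_code_plan[OF U C0 C'(1)] by blast
  have X: "Cs ! i \<in> insert C0 {C. admissible U Os C}" if "i \<le> length as" for i
    using plan(1) that by (cases i) (auto simp: code_plan_def)
  have "optimal_code U Os C0 T as (map enc_config Cs)"
    unfolding optimal_code_def
  proof (intro conjI allI impI)
    fix i
    assume "i < length as"
    then show "admissible_step U Os C0 (map enc_config Cs ! i) (as ! i) (map enc_config Cs ! Suc i)"
      unfolding admissible_step_def using plan(1) X[of i]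
      by (intro bexI[of _ "Cs ! i"] conjI bexI[of _ "Cs ! Suc i"]) (auto simp: code_plan_def)
  next
    show "optimum U Os C0 T (map enc_config Cs ! length as)"
      unfolding optimum_def
    proof (intro bexI[of _ C'] conjI allI impI)
      show "C' \<in> insert C0 {C. admissible U Os C}" using X[of "length as"] plan(2) by simp
      show "map enc_config Cs ! length as = enc_config C'" using plan by (simp add: code_plan_def)
      show "correct C'" "\<exists>z \<in> insts C'. mtyp_of C' z = T" using C'(1) by (auto simp: target_def)
      fix k
      assume "k < total_cost C'"
      then show "\<not> (\<exists>C'. target U Os C0 T C' \<and> total_cost C' \<le> k)"
        using C'(2) by (meson le_less_trans not_le)
    qed
  qed (use plan(1) in \<open>simp_all add: code_plan_def\<close>)
  then show ?thesis by blast
qed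

lemma realizable_ex_target:
  fixes U :: "'e \<Rightarrow> ('r::finite) mtype set"
  assumes input: "\<And>e. e \<in> D \<Longrightarrow> deployment_input (U e) (Os e) (C0 e) (T e)"
    and U: "realizable D E (enc_set enc_mtype) U" and Os: "realizable D E (enc_set enc_node) Os"
    and C0: "realizable D E enc_config C0" and T: "realizable D E enc_mtype T"
    and n: "realizable D E id n"
      "\<And>e. e \<in> D \<Longrightarrow> enc_set enc_mtype (U e) \<le> n e \<and> enc_set enc_node (Os e) \<le> n e"
    and k: "realizable D E id k"
  shows "realizable D E of_bool (\<lambda>e. \<exists>C. target (U e) (Os e) (C0 e) (T e) C \<and> total_cost C \<le> k e)"
proof -
  have fin: "finite (U e)" "U e \<subseteq> mtypes" "finite (Os e)" "provisionally_correct (C0 e)" "T e \<in> mtypes"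
    "configuration (C0 e)" "preconfiguration (C0 e)"
    "configuration (strip (C0 e) z)" "preconfiguration (strip (C0 e) z)"
    if "e \<in> D" for e z
    using input[OF that] configuration_preconfiguration configuration_strip
    by (auto simp: deployment_input_def well_formed_universe_def provisionally_correct_def)
  let ?b = "\<lambda>e. code_bound (n e)"
  have b: "realizable D E id ?b" by (rule realizable_map[OF n(1) rec1_code_bound]) simp
  let ?X = "\<lambda>e. {C \<in> preconfigurations_over (U e) (Os e). enc_config C < ?b e}"
  \<comment> \<open>By thinning out, the existential over all configurations becomes one over codes
    below a computable bound.\<close>
  have small: "(\<exists>C. correct C \<and> over (U e) (Os e) C \<and> (\<exists>z \<in> insts C. mtyp_of C z = T e) \<and> total_cost C \<le> k e)
    = (\<exists>C \<in> ?X e. correct C \<and> (\<exists>z \<in> insts C. mtyp_of C z = T e) \<and> total_cost C \<le> k e)" if e: "e \<in> D" for e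
  proof
    assume "\<exists>C. correct C \<and> over (U e) (Os e) C \<and> (\<exists>z \<in> insts C. mtyp_of C z = T e) \<and> total_cost C \<le> k e"
    then obtain C z where C: "correct C" "over (U e) (Os e) C" "z \<in> insts C" "mtyp_of C z = T e"
      "total_cost C \<le> k e" by blast
    have n': "enc_set enc_mtype (U e) \<le> n e" "enc_set enc_node (Os e) \<le> n e" using n(2)[OF e] by auto
    obtain G where G: "correct G" "over (U e) (Os e) G" "\<exists>z \<in> insts G. mtyp_of G z = T e"
      "total_cost G \<le> total_cost C" "insts G \<subseteq> {..<inst_bound (n e)}" "\<forall>(p, z1, z2) \<in> bindings G. p < n e"
      using ex_small_correct_config[OF C(1,2) bounded_by_code(1)[OF fin(1,2)[OF e] n'(1)] C(3,4)] by blast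
    have conf: "configuration G" using G(1) by (simp add: correct_def provisionally_correct_def)
    then have pre: "preconfiguration G" by (rule configuration_preconfiguration)
    have "enc_config G < ?b e"
    proof (rule enc_config_less_code_bound[OF pre G(2) _ _ G(5)])
      show "enc_mtype S \<le> n e" if "S \<in> U e" for S
        using bounded_by_code(2)[OF fin(1,2)[OF e] n'(1) that] .
      show "enc_node o' \<le> n e" if "o' \<in> Os e" for o'
        using less_set_encode[of "enc_node ` Os e" "enc_node o'"] fin(3)[OF e] n'(2) that by auto
      show "fst b < n e \<and> fst (snd b) \<in> insts G \<and> snd (snd b) \<in> insts G" if "b \<in> bindings G" for b
        using that G(6) configuration_bindingD(1,2)[OF conf, of "fst b" "fst (snd b)" "snd (snd b)"]
        by (auto simp: split_beta)
    qed
    then have "G \<in> ?X e" using pre G(2) by (simp add: preconfigurations_over_def)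
    then show "\<exists>C \<in> ?X e. correct C \<and> (\<exists>z \<in> insts C. mtyp_of C z = T e) \<and> total_cost C \<le> k e"
      using G C(5) by (intro bexI[of _ G]) auto
  qed (auto simp: preconfigurations_over_def)
  have search: "realizable D E of_bool
    (\<lambda>e. \<exists>C \<in> ?X e. correct C \<and> (\<exists>z \<in> insts C. mtyp_of C z = T e) \<and> total_cost C \<le> k e)"
  proof (rule realizable_ex_code[OF b])
    have "realizable (ext_dom D (\<lambda>e. {..<?b e})) (ext_enc id E) of_bool
        (\<lambda>v. fst v \<in> enc_config ` preconfigurations_over (U (snd v)) (Os (snd v)))"
      by (intro realizable_preconfiguration_code realizable_var realizable_weaken U Os) (auto simp: fin)
    then show "realizable (ext_dom D (\<lambda>e. {..<?b e})) (ext_enc id E) of_bool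
        (\<lambda>v. fst v \<in> enc_config ` ?X (snd v))"
      by (rule realizable_cong) auto
    let ?D = "ext_dom (ext_dom D (\<lambda>e. {..<?b e})) (\<lambda>v. ?X (snd v))"
    have pre: "preconfiguration (fst v)" if "v \<in> ?D" for v
      using that by (auto simp: preconfigurations_over_def)
    show "realizable ?D (ext_enc enc_config (ext_enc id E)) of_bool
        (\<lambda>v. correct (fst v) \<and> (\<exists>z \<in> insts (fst v). mtyp_of (fst v) z = T (snd (snd v))) \<and>
          total_cost (fst v) \<le> k (snd (snd v)))"
      by (intro realizable_conj realizable_restrict realizable_le realizable_correct realizable_has_type
          realizable_total_cost realizable_var realizable_weaken T k) (use pre fin in auto)
  qed auto
  show ?thesis
  proof (rule realizable_cong)
    show "realizable D E of_bool (\<lambda>e. (correct (C0 e) \<and> (\<exists>z \<in> insts (C0 e). mtyp_of (C0 e) z = T e) \<and>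
        total_cost (C0 e) \<le> k e) \<or>
      ((over (U e) (Os e) (C0 e) \<or> (\<exists>z \<in> insts (C0 e). admissible (U e) (Os e) (strip (C0 e) z))) \<and>
        (\<exists>C \<in> ?X e. correct C \<and> (\<exists>z \<in> insts C. mtyp_of C z = T e) \<and> total_cost C \<le> k e)))"
    proof (intro realizable_disj realizable_conj)
      show "realizable D E of_bool (\<lambda>e. \<exists>z \<in> insts (C0 e). admissible (U e) (Os e) (strip (C0 e) z))"
        by (rule realizable_ex[where enc = id] realizable_admissible realizable_strip realizable_insts
            realizable_var realizable_weaken C0 U Os | (simp add: preconfiguration_finite fin; fail))+
    qed (intro realizable_restrict realizable_correct realizable_has_type realizable_le
        realizable_total_cost realizable_over search C0 T k U Os; simp add: fin)+
    fix e
    assume "e \<in> D"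
    from small[OF this]
    show "((correct (C0 e) \<and> (\<exists>z \<in> insts (C0 e). mtyp_of (C0 e) z = T e) \<and> total_cost (C0 e) \<le> k e) \<or>
      ((over (U e) (Os e) (C0 e) \<or> (\<exists>z \<in> insts (C0 e). admissible (U e) (Os e) (strip (C0 e) z))) \<and>
        (\<exists>C \<in> ?X e. correct C \<and> (\<exists>z \<in> insts C. mtyp_of C z = T e) \<and> total_cost C \<le> k e)))
      = (\<exists>C. target (U e) (Os e) (C0 e) (T e) C \<and> total_cost C \<le> k e)"
      unfolding target_def clearable_def by blast
  qed
qed

lemma realizable_admissible_or_initial_code:
  assumes "realizable D E id c" "realizable D E enc_config C0"
    and "realizable D E (enc_set enc_mtype) U" "\<And>e. e \<in> D \<Longrightarrow> finite (U e) \<and> U e \<subseteq> mtypes"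
    and "realizable D E (enc_set enc_node) Os" "\<And>e. e \<in> D \<Longrightarrow> finite (Os e)"
  shows "realizable D E of_bool (\<lambda>e. c e \<in> enc_config ` insert (C0 e) {C. admissible (U e) (Os e) C})"
  unfolding image_insert insert_iff
  by (intro realizable_disj realizable_eq_nat realizable_encode realizable_admissible_code assms)

lemma realizable_admissible_step:
  fixes U :: "'e \<Rightarrow> ('r::finite) mtype set"
  assumes input: "\<And>e. e \<in> D \<Longrightarrow> deployment_input (U e) (Os e) (C0 e) (T e)"
    and U: "realizable D E (enc_set enc_mtype) U" and Os: "realizable D E (enc_set enc_node) Os"
    and C0: "realizable D E enc_config C0"
    and c: "realizable D E id c" and a: "realizable D E id a" and c': "realizable D E id c'"
  shows "realizable D E of_bool (\<lambda>e. admissible_step (U e) (Os e) (C0 e) (c e) (a e) (c' e))"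
proof -
  have fin: "finite (U e)" "U e \<subseteq> mtypes" "finite (Os e)" "configuration (C0 e)" if "e \<in> D" for e
    using input[OF that]
    by (auto simp: deployment_input_def well_formed_universe_def provisionally_correct_def)
  have adm: "configuration C" if "admissible U' Os' C" for U' Os' and C :: "'r config"
    using that by (simp add: admissible_def provisionally_correct_def)
  show ?thesis
    unfolding admissible_step_def
    by (intro realizable_ex_decode realizable_admissible_or_initial_code realizable_admissible_code
        realizable_code_step realizable_var realizable_weaken c a c' C0 U Os) (auto simp: fin adm)
qed

lemma realizable_optimum:
  fixes U :: "'e \<Rightarrow> ('r::finite) mtype set"
  assumes input: "\<And>e. e \<in> D \<Longrightarrow> deployment_input (U e) (Os e) (C0 e) (T e)"
    and U: "realizable D E (enc_set enc_mtype) U" and Os: "realizable D E (enc_set enc_node) Os"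
    and C0: "realizable D E enc_config C0" and T: "realizable D E enc_mtype T"
    and n: "realizable D E id n"
      "\<And>e. e \<in> D \<Longrightarrow> enc_set enc_mtype (U e) \<le> n e \<and> enc_set enc_node (Os e) \<le> n e"
    and c: "realizable D E id c"
  shows "realizable D E of_bool (\<lambda>e. optimum (U e) (Os e) (C0 e) (T e) (c e))"
proof -
  have fin: "finite (U e)" "U e \<subseteq> mtypes" "finite (Os e)" "T e \<in> mtypes"
    "configuration (C0 e)" "preconfiguration (C0 e)" if "e \<in> D" for e
    using input[OF that] configuration_preconfiguration
    by (auto simp: deployment_input_def well_formed_universe_def provisionally_correct_def)
  have adm: "preconfiguration C" if "admissible U' Os' C" for U' Os' and C :: "'r config"
    using that by (simp add: admissible_def provisionally_correct_def configuration_preconfiguration)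
  let ?X = "\<lambda>e. insert (C0 e) {C. admissible (U e) (Os e) C}"
  have pre: "preconfiguration (fst v)" if "v \<in> ext_dom D ?X" for v
    using that fin(6) adm by auto
  show ?thesis
    unfolding optimum_def
  proof (rule realizable_ex_decode[OF c])
    show "realizable D E of_bool (\<lambda>e. c e \<in> enc_config ` ?X e)"
      by (intro realizable_admissible_or_initial_code c C0 U Os) (auto simp: fin)
    let ?E = "ext_enc enc_config E"
    have "realizable (ext_dom (ext_dom D ?X) (\<lambda>v. {..<total_cost (fst v)})) (ext_enc id ?E) of_bool
        (\<lambda>v. \<exists>C'. target (U (snd (snd v))) (Os (snd (snd v))) (C0 (snd (snd v))) (T (snd (snd v))) C' \<and>
          total_cost C' \<le> fst v)"
      by (rule realizable_ex_target[where n = "\<lambda>v. n (snd (snd v))"])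
        (auto intro: realizable_var realizable_weaken[OF realizable_weaken] U Os C0 T n(1) simp: input n(2))
    then show "realizable (ext_dom D ?X) ?E of_bool
        (\<lambda>v. correct (fst v) \<and> (\<exists>z \<in> insts (fst v). mtyp_of (fst v) z = T (snd v)) \<and>
          (\<forall>k < total_cost (fst v). \<not> (\<exists>C'. target (U (snd v)) (Os (snd v)) (C0 (snd v)) (T (snd v)) C' \<and>
            total_cost C' \<le> k)))"
      by (intro realizable_conj realizable_restrict realizable_correct realizable_has_type
          realizable_all_less realizable_not realizable_total_cost realizable_var realizable_weaken T)
        (use pre fin in auto)
  qed
qed

lemma realizable_optimal_code:
  fixes U :: "'e \<Rightarrow> ('r::finite) mtype set"
  assumes input: "\<And>e. e \<in> D \<Longrightarrow> deployment_input (U e) (Os e) (C0 e) (T e)"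
    and U: "realizable D E (enc_set enc_mtype) U" and Os: "realizable D E (enc_set enc_node) Os"
    and C0: "realizable D E enc_config C0" and T: "realizable D E enc_mtype T"
    and n: "realizable D E id n"
      "\<And>e. e \<in> D \<Longrightarrow> enc_set enc_mtype (U e) \<le> n e \<and> enc_set enc_node (Os e) \<le> n e"
    and as: "realizable D E list_encode as" and cs: "realizable D E list_encode cs"
  shows "realizable D E of_bool (\<lambda>e. optimal_code (U e) (Os e) (C0 e) (T e) (as e) (cs e))"
proof -
  \<comment> \<open>On this domain all positions accessed by \<open>!\<close> are in range; the
    equation of lengths is the first conjunct, so the others are realized under it.\<close>
  let ?D = "{e \<in> D. length (cs e) = Suc (length (as e))}"
  have "realizable ?D E of_bool (\<lambda>e. \<forall>i<length (as e).
      admissible_step (U e) (Os e) (C0 e) (cs e ! i) (as e ! i) (cs e ! Suc i))"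
  proof (rule realizable_all_less)
    show "realizable (ext_dom ?D (\<lambda>e. {..<length (as e)})) (ext_enc id E) of_bool
        (\<lambda>v. admissible_step (U (snd v)) (Os (snd v)) (C0 (snd v))
          (cs (snd v) ! fst v) (as (snd v) ! fst v) (cs (snd v) ! Suc (fst v)))"
      by (rule realizable_admissible_step[where T = "\<lambda>v. T (snd v)"])
        (intro realizable_nth realizable_Suc realizable_var realizable_weaken realizable_restrict U Os C0 as cs
          | (simp add: input; fail))+
  qed (intro realizable_length realizable_restrict as)
  moreover have "realizable ?D E of_bool (\<lambda>e. optimum (U e) (Os e) (C0 e) (T e) (cs e ! length (as e)))"
    by (rule realizable_optimum[where n = n])
      (intro realizable_nth realizable_length realizable_restrict U Os C0 T n(1) as cs
        | (simp add: input n(2); fail))+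
  moreover have "realizable ?D E of_bool (\<lambda>e. cs e ! 0 = enc_config (C0 e))"
    by (intro realizable_eq_nat realizable_nth realizable_encode realizable_restrict realizable_const C0 cs) simp
  moreover have "realizable D E of_bool (\<lambda>e. length (cs e) = Suc (length (as e)))"
    by (intro realizable_eq_nat realizable_Suc realizable_length as cs)
  ultimately show ?thesis
    unfolding optimal_code_def by (intro realizable_conj[where D = D] realizable_conj[OF _ realizable_restrict])
qed

section \<open>Unbounded search and the final algorithm\<close>

lemma computes_Mu:
  assumes t: "\<And>w. computes t [w, n] (of_bool (\<not> P w))" and "P w"
  shows "computes (Mu t) [n] (Least P)" "P (Least P)"
proof -
  show "P (Least P)" using \<open>P w\<close> by (rule LeastI)
  then have "computes t [Least P, n] 0" using t[of "Least P"] by simp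
  moreover have "\<exists>y>0. computes t [k, n] y" if "k < Least P" for k
    using t[of k] not_less_Least[OF that] by (intro exI[of _ 1]) simp
  ultimately show "computes (Mu t) [n] (Least P)" by (intro computes.Mu) auto
qed

lemma total_rec_2I:
  assumes "rec1 F"
  shows "\<exists>t. \<forall>w n. computes t [w, n] (F (prod_encode (w, n)))"
proof -
  have "total_rec 2 (\<lambda>xs. F (prod_encode (xs ! 0, xs ! 1)))"
    using assms unfolding rec1_def
    by (rule total_rec_comp1) (intro total_rec_prod_encode total_rec_nth; simp)
  then obtain t where t: "\<And>xs. length xs = 2 \<Longrightarrow> computes t xs (F (prod_encode (xs ! 0, xs ! 1)))"
    unfolding total_rec_def by blast
  have "computes t [w, n] (F (prod_encode (w, n)))" for w n
    using t[of "[w, n]"] by simp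
  then show ?thesis by blast
qed

text \<open>The search also stops, at once, on inputs that are known to have no solution.\<close>

lemma ex_search_program:
  assumes S: "rec1 S" and K: "rec1 K"
  shows "\<exists>f. \<forall>n. (S n = 0 \<longrightarrow> computes f [n] 0) \<and>
    (S n = 1 \<longrightarrow> (\<exists>w. K (prod_encode (w, n)) = 1) \<longrightarrow>
      (\<exists>w. K (prod_encode (w, n)) = 1 \<and> computes f [n] (Suc (fst (prod_decode w)))))"
proof -
  let ?P = "\<lambda>n w. \<not> S n = 1 \<or> K (prod_encode (w, n)) = 1"
  have "rec1 (\<lambda>v. of_bool (S (snd (prod_decode v)) = 1 \<and> \<not> K v = 1))"
    by (intro rec1_conj rec1_not rec1_eq rec1_const K rec1_comp[OF S] rec1_prod_decode rec1_id)
  from total_rec_2I[OF this] obtain t where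
    t: "\<And>w n. computes t [w, n] (of_bool (S n = 1 \<and> \<not> K (prod_encode (w, n)) = 1))" by auto
  have "rec1 (\<lambda>v. if S (snd (prod_decode v)) = 1 then Suc (fst (prod_decode (fst (prod_decode v)))) else 0)"
    by (intro rec1_if rec1_eq rec1_const rec1_Suc rec1_comp[OF S] rec1_prod_decode rec1_id)
  from total_rec_2I[OF this] obtain u where
    u: "\<And>w n. computes u [w, n] (if S n = 1 then Suc (fst (prod_decode w)) else 0)"
    by (auto cong: if_cong)
  have f: "computes (Comp u [Mu t, Proj 0]) [n] (if S n = 1 then Suc (fst (prod_decode (Least (?P n)))) else 0)"
    and least: "?P n (Least (?P n))" if ex: "?P n w" for n w
  proof -
    have "computes t [w, n] (of_bool (\<not> ?P n w))" for w using t[of w n] by simp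
    note mu = computes_Mu[of t n "?P n" w, OF this ex]
    show "?P n (Least (?P n))" by (rule mu(2))
    show "computes (Comp u [Mu t, Proj 0]) [n] (if S n = 1 then Suc (fst (prod_decode (Least (?P n)))) else 0)"
    proof (rule computes.Comp[where ys = "[Least (?P n), n]"])
      show "\<forall>i < length [Mu t, Proj 0]. computes ([Mu t, Proj 0] ! i) [n] ([Least (?P n), n] ! i)"
        using mu(1) computes.Proj[of 0 "[n]"] by (auto simp: less_Suc_eq)
    qed (simp, rule u)
  qed
  show ?thesis
  proof (intro exI[of _ "Comp u [Mu t, Proj 0]"] allI conjI impI)
    fix n
    assume "S n = 0"
    then show "computes (Comp u [Mu t, Proj 0]) [n] 0" using f[of n 0] by simp
  next
    fix n
    assume "S n = 1" "\<exists>w. K (prod_encode (w, n)) = 1"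
    then show "\<exists>w. K (prod_encode (w, n)) = 1 \<and>
        computes (Comp u [Mu t, Proj 0]) [n] (Suc (fst (prod_decode w)))"
      using f[of n] least[of n] by auto
  qed
qed

text \<open>No configuration over \<open>Os\<close> costs more than all nodes together, which turns
  a decision procedure with a cost bound into one without.\<close>

lemma total_cost_le:
  assumes "configuration C" "over U Os C" "finite Os"
  shows "total_cost C \<le> (\<Sum>o' \<in> Os. cost o')"
  unfolding total_cost_def
proof (rule sum_mono2)
  show "ran (host C) \<subseteq> Os"
  proof
    fix o'
    assume "o' \<in> ran (host C)"
    then obtain z where z: "host C z = Some o'" by (auto simp: ran_def)
    then have "z \<in> insts C" using assms(1) by (auto simp: configuration_def)
    then show "o' \<in> Os" using assms(2) z by (force simp: over_def)
  qed
qed (use assms(3) in auto)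

theorem theorem1:
  shows "\<exists>f. \<forall>(U :: ('r::finite) mtype set) Os \<C>0 \<T>t.
    deployment_input U Os \<C>0 \<T>t \<longrightarrow>
      (if \<exists>\<alpha>s. deployment_solution U Os \<C>0 \<T>t \<alpha>s
       then \<exists>\<alpha>s. optimal_solution U Os \<C>0 \<T>t \<alpha>s \<and>
              computes f [enc_input U Os \<C>0 \<T>t] (enc_output (Some \<alpha>s))
       else computes f [enc_input U Os \<C>0 \<T>t] (enc_output (None :: 'r action list option)))"
proof -
  \<comment> \<open>The whole input is the environment \<open>e\<close>; its components are
    realizable as entries of the list that \<open>enc_input\<close> encodes.\<close>
  define U :: "'r mtype set \<times> 'r node set \<times> 'r config \<times> 'r mtype \<Rightarrow> _" where "U = fst"
  define Os :: "'r mtype set \<times> 'r node set \<times> 'r config \<times> 'r mtype \<Rightarrow> _" where "Os e = fst (snd e)" for e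
  define C0 :: "'r mtype set \<times> 'r node set \<times> 'r config \<times> 'r mtype \<Rightarrow> _" where "C0 e = fst (snd (snd e))" for e
  define T :: "'r mtype set \<times> 'r node set \<times> 'r config \<times> 'r mtype \<Rightarrow> _" where "T e = snd (snd (snd e))" for e
  define D where "D = {e. deployment_input (U e) (Os e) (C0 e) (T e)}"
  define E where "E e = enc_input (U e) (Os e) (C0 e) (T e)" for e
  have input: "deployment_input (U e) (Os e) (C0 e) (T e)" if "e \<in> D" for e
    using that by (simp add: D_def)
  have env: "realizable D E id E"
    unfolding realizable_def using rec1_id by auto
  have comps: "realizable D E (enc_set enc_mtype) U" "realizable D E (enc_set enc_node) Os"
    "realizable D E enc_config C0" "realizable D E enc_mtype T"
    by (rule realizable_component[OF env, where i = 0], simp add: E_def enc_input_def del: list_encode.simps)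
      (rule realizable_component[OF env, where i = 1], simp add: E_def enc_input_def del: list_encode.simps,
       rule realizable_component[OF env, where i = 2], simp add: E_def enc_input_def del: list_encode.simps,
       rule realizable_component[OF env, where i = 3], simp add: E_def enc_input_def del: list_encode.simps)
  have bound: "enc_set enc_mtype (U e) \<le> E e \<and> enc_set enc_node (Os e) \<le> E e" for e
    unfolding E_def enc_input_def
    by (intro conjI less_imp_le member_less_list_encode) simp_all
  \<comment> \<open>A target is \<open>C0\<close> or uses only nodes of \<open>Os\<close>, so none
    costs more than this, and existence below the bound is existence outright.\<close>
  let ?K = "\<lambda>e. total_cost (C0 e) + (\<Sum>o' \<in> Os e. cost o')"
  have fin: "finite (Os e)" "preconfiguration (C0 e)" if "e \<in> D" for e
    using input[OF that]
    by (simp_all add: deployment_input_def provisionally_correct_def configuration_preconfiguration)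
  have "realizable D E id ?K"
  proof (intro realizable_add realizable_total_cost realizable_sum[OF comps(2)])
    show "realizable (ext_dom D Os) (ext_enc enc_node E) id (\<lambda>v. cost (fst v))"
      by (intro realizable_cost realizable_var)
    show "inj_on enc_node (Os e)" for e using inj_enc_node inj_on_subset by blast
  qed (use comps fin in auto)
  then have "realizable D E of_bool (\<lambda>e. \<exists>C. target (U e) (Os e) (C0 e) (T e) C \<and> total_cost C \<le> ?K e)"
    using bound input by (intro realizable_ex_target[where n = E] comps env) auto
  moreover have "(\<exists>C. target (U e) (Os e) (C0 e) (T e) C \<and> total_cost C \<le> ?K e)
      = (\<exists>C. target (U e) (Os e) (C0 e) (T e) C)" if "e \<in> D" for e
  proof -
    have "total_cost C \<le> ?K e" if "target (U e) (Os e) (C0 e) (T e) C" for C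
      using that total_cost_le[of C "U e" "Os e"] fin(1)[OF \<open>e \<in> D\<close>]
      by (auto simp: target_def correct_def provisionally_correct_def)
    then show ?thesis by blast
  qed
  ultimately have "realizable D E of_bool (\<lambda>e. \<exists>C. target (U e) (Os e) (C0 e) (T e) C)"
    by (rule realizable_cong)
  then obtain S where S: "rec1 S" "\<And>e. e \<in> D \<Longrightarrow> S (E e) = of_bool (\<exists>C. target (U e) (Os e) (C0 e) (T e) C)"
    by (auto simp: realizable_def)
  \<comment> \<open>A candidate pairs a coded list of action codes with a coded list of
    configuration codes; the latter serves as a certificate and is dropped from the output.\<close>
  let ?as = "\<lambda>w. list_decode (fst (prod_decode w))" and ?cs = "\<lambda>w. list_decode (snd (prod_decode w))"
  have "realizable (ext_dom D (\<lambda>_. UNIV)) (ext_enc id E) of_bool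
      (\<lambda>v. optimal_code (U (snd v)) (Os (snd v)) (C0 (snd v)) (T (snd v)) (?as (fst v)) (?cs (fst v)))"
    using bound input
    by (intro realizable_optimal_code[where n = "\<lambda>v. E (snd v)"] realizable_list_decode
        realizable_prod_decode realizable_var realizable_weaken comps env) auto
  then obtain K where K1: "rec1 K" "\<forall>v \<in> ext_dom D (\<lambda>_. UNIV). K (ext_enc id E v)
      = of_bool (optimal_code (U (snd v)) (Os (snd v)) (C0 (snd v)) (T (snd v)) (?as (fst v)) (?cs (fst v)))"
    unfolding realizable_def by blast
  have K2: "K (prod_encode (w, E e)) = of_bool (optimal_code (U e) (Os e) (C0 e) (T e) (?as w) (?cs w))"
    if "e \<in> D" for e w
    using K1(2)[rule_format, of "(w, e)"] that by (simp add: ext_enc_def)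
  obtain f where f: "\<And>n. S n = 0 \<Longrightarrow> computes f [n] 0"
    "\<And>n. S n = 1 \<Longrightarrow> \<exists>w. K (prod_encode (w, n)) = 1 \<Longrightarrow>
      \<exists>w. K (prod_encode (w, n)) = 1 \<and> computes f [n] (Suc (fst (prod_decode w)))"
    using ex_search_program[OF S(1) K1(1)] by metis
  have main: "if \<exists>\<alpha>s. deployment_solution (U e) (Os e) (C0 e) (T e) \<alpha>s
       then \<exists>\<alpha>s. optimal_solution (U e) (Os e) (C0 e) (T e) \<alpha>s \<and>
              computes f [E e] (enc_output (Some \<alpha>s))
       else computes f [E e] (enc_output (None :: 'r action list option))" if e: "e \<in> D" for e
  proof -
    have U: "well_formed_universe (U e)" and C0: "provisionally_correct (C0 e)"
      using input[OF e] by (auto simp: deployment_input_def)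
    show ?thesis
    proof (cases "\<exists>C. target (U e) (Os e) (C0 e) (T e) C")
      case True
      then obtain as cs where "optimal_code (U e) (Os e) (C0 e) (T e) as cs"
        using ex_optimal_code[OF U C0] by blast
      then have "K (prod_encode (prod_encode (list_encode as, list_encode cs), E e)) = 1"
        using K2[OF e] by simp
      then obtain w where w: "K (prod_encode (w, E e)) = 1" "computes f [E e] (Suc (fst (prod_decode w)))"
        using f(2)[of "E e"] S(2)[OF e] True by auto
      then have "optimal_code (U e) (Os e) (C0 e) (T e) (?as w) (?cs w)"
        using K2[OF e, of w] by (simp del: One_nat_def)
      then obtain \<alpha>s where \<alpha>s: "?as w = map enc_action \<alpha>s" "optimal_solution (U e) (Os e) (C0 e) (T e) \<alpha>s"
        using optimal_code_solution[OF C0] by blast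
      have "enc_output (Some \<alpha>s) = Suc (fst (prod_decode w))"
        using \<alpha>s(1)[symmetric] by simp
      moreover have "\<exists>\<alpha>s. deployment_solution (U e) (Os e) (C0 e) (T e) \<alpha>s"
        using \<alpha>s(2) by (auto simp: optimal_solution_def deployment_solution_def)
      ultimately show ?thesis using w(2) \<alpha>s(2) by auto
    next
      case False
      then have "\<not> (\<exists>\<alpha>s. deployment_solution (U e) (Os e) (C0 e) (T e) \<alpha>s)"
        using solution_target unfolding deployment_solution_def by blast
      moreover have "computes f [E e] 0" using f(1) S(2)[OF e] False by simp
      ultimately show ?thesis by simp
    qed
  qed
  show ?thesis
  proof (intro exI[of _ f] allI impI)
    fix U' :: "'r mtype set" and Os' C0' T'
    assume input': "deployment_input U' Os' C0' T'"
    show "if \<exists>\<alpha>s. deployment_solution U' Os' C0' T' \<alpha>s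
       then \<exists>\<alpha>s. optimal_solution U' Os' C0' T' \<alpha>s \<and>
              computes f [enc_input U' Os' C0' T'] (enc_output (Some \<alpha>s))
       else computes f [enc_input U' Os' C0' T'] (enc_output (None :: 'r action list option))"
      using main[of "(U', Os', C0', T')", unfolded D_def E_def U_def Os_def C0_def T_def
          mem_Collect_eq fst_conv snd_conv, OF input'] .
  qed
qed

end
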